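(* Let $\Bbbk$ be a field, let $\mathfrak A,\mathfrak Q$ be groups, and let $A=\Bbbk\mathfrak A$ and $Q=\Bbbk\mathfrak Q$ be their group rings, regarded as Hopf algebras with $\Delta(g)=g\otimes g$ for group elements $g$. Then $A\wr Q\cong\Bbbk(\mathfrak A\wr\mathfrak Q)$ as Hopf algebras, where $A\wr Q$ is the wreath product of cocommutative Hopf algebras and $\mathfrak A\wr\mathfrak Q$ is the (unrestricted) wreath product of groups.
   Context: Wreath product of groups: $\mathfrak A\wr\mathfrak Q=\mathfrak A^{\mathfrak Q}\rtimes\mathfrak Q$, where $\mathfrak A^{\mathfrak Q}$ is the group of all functions $\mathfrak Q\to\mathfrak A$ under pointwise multiplication and $\mathfrak Q$ acts by right translation, $(q\cdot f)(r)=f(rq)$. Wreath product of Hopf algebras: all coalgebras and Hopf algebras are cocommutative, over the field $\Bbbk$; coalgebra maps preserve comultiplication and counit. Sweedler notation $\Delta(u)=u_1\otimes u_2$ is used with summation suppressed. The category of cocommutative counital $\Bbbk$-coalgebras is cartesian closed (with product $\otimes$). For coalgebras $C,D$ the exponential $D^C$ comes with a coalgebra map $@\colon D^C\otimes C\to D$, $u\otimes c\mapsto u@c$, such that for every cocommutative coalgebra $R$, $\phi\mapsto @(\phi\otimes 1_C)$ is a bijection from coalgebra maps $R\to D^C$ to coalgebra maps $R\otimes C\to D$ (the image of $\phi$ is called its transpose). For cocommutative Hopf algebras $A,Q$, $A^Q$ is a cocommutative Hopf algebra whose structure maps are the unique coalgebra maps whose transposes are given by $(xy)@c=(x@c_1)(y@c_2)$,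 $1@c=\varepsilon(c)1$, $(Sx)@c=S(x@c)$, and $Q$ acts on $A^Q$ through the unique coalgebra map $\star\colon Q\otimes A^Q\to A^Q$ whose transpose is given by $(q\star x)@r=x@(rq)$. Then $A\wr Q=A^Q\#Q$ is the smash product Hopf algebra, with underlying coalgebra $A^Q\otimes Q$, multiplication $(h\#q)(k\#r)=h(q_1\star k)\#q_2r$ and antipode $S(h\#q)=(S(q_1)\star S(h))\#S(q_2)$. *)

theory Defs
  imports
    Complex_Main
    "HOL-Algebra.Product_Groups"
    "HOL-Library.Poly_Mapping"
    "HOL-Library.Function_Algebras"
begin

section \<open>Vector spaces and tensor products\<close>

text \<open>A vector space over the field \<open>'k\<close> is a linear subspace \<open>carrier V\<close> of some type with
  scalar multiplication \<open>scal V\<close>. Only the values of maps on carriers are meaningful.\<close>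

record ('k, 'v) vspace = "'v partial_object" +
  scal :: "'k \<Rightarrow> 'v \<Rightarrow> 'v"

definition is_vspace :: "('k::field, 'v::ab_group_add, 'z) vspace_scheme \<Rightarrow> bool" where
  "is_vspace V \<longleftrightarrow> vector_space (scal V) \<and> Modules.module.subspace (scal V) (carrier V)"

definition base_space :: "('k::field, 'k) vspace" where
  "base_space = \<lparr>carrier = UNIV, scal = (*)\<rparr>"

definition linear_map ::
  "('k, 'v::plus, 'y) vspace_scheme \<Rightarrow> ('k, 'w::plus, 'z) vspace_scheme \<Rightarrow> ('v \<Rightarrow> 'w) \<Rightarrow> bool" where
  "linear_map V W f \<longleftrightarrow>
     (\<forall>x\<in>carrier V. f x \<in> carrier W) \<and>
     (\<forall>x\<in>carrier V. \<forall>y\<in>carrier V. f (x + y) = f x + f y) \<and>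
     (\<forall>c. \<forall>x\<in>carrier V. f (scal V c x) = scal W c (f x))"

definition bilinear_map ::
  "('k, 'v::plus, 'x) vspace_scheme \<Rightarrow> ('k, 'w::plus, 'y) vspace_scheme \<Rightarrow>
   ('k, 'u::plus, 'z) vspace_scheme \<Rightarrow> ('v \<Rightarrow> 'w \<Rightarrow> 'u) \<Rightarrow> bool" where
  "bilinear_map V W U f \<longleftrightarrow>
     (\<forall>v\<in>carrier V. linear_map W U (f v)) \<and> (\<forall>w\<in>carrier W. linear_map V U (\<lambda>v. f v w))"

text \<open>Over a field, the tensor product of \<open>V\<close> and \<open>W\<close> embeds into the dual of the space of
  bilinear forms on \<open>V \<times> W\<close>, a pure tensor \<open>v \<otimes> w\<close> going to evaluation at \<open>(v, w)\<close>. It is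
  represented by its image, so that it lives on a type which is an abelian group whatever \<open>V\<close>
  and \<open>W\<close> are. Its universal property is lemma \<open>tensor_lift_sum_list\<close> below.\<close>

type_synonym ('k, 'v, 'w) tensor = "('v \<Rightarrow> 'w \<Rightarrow> 'k) \<Rightarrow> 'k"

definition tensor ::
  "('k::field, 'v::ab_group_add, 'y) vspace_scheme \<Rightarrow> ('k, 'w::ab_group_add, 'z) vspace_scheme \<Rightarrow>
   'v \<Rightarrow> 'w \<Rightarrow> ('k, 'v, 'w) tensor" where
  "tensor V W v w = (\<lambda>\<beta>. if bilinear_map V W base_space \<beta> then \<beta> v w else 0)"

definition tensor_space ::
  "('k::field, 'v::ab_group_add, 'y) vspace_scheme \<Rightarrow> ('k, 'w::ab_group_add, 'z) vspace_scheme \<Rightarrow>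
   ('k, ('k, 'v, 'w) tensor) vspace" where
  "tensor_space V W =
     \<lparr>carrier = {\<Sum>(v, w)\<leftarrow>ps. tensor V W v w | ps. set ps \<subseteq> carrier V \<times> carrier W},
      scal = (\<lambda>c t \<beta>. c * t \<beta>)\<rparr>"

text \<open>The value at \<open>t\<close> of the linear map on the tensor product induced by a bilinear map \<open>f\<close>:
  write \<open>t\<close> in any way as a sum of pure tensors \<open>v \<otimes> w\<close> and add up the \<open>f v w\<close>.\<close>

definition tensor_lift ::
  "('k::field, 'v::ab_group_add, 'y) vspace_scheme \<Rightarrow> ('k, 'w::ab_group_add, 'z) vspace_scheme \<Rightarrow>
   ('v \<Rightarrow> 'w \<Rightarrow> 'u::ab_group_add) \<Rightarrow> ('k, 'v, 'w) tensor \<Rightarrow> 'u" where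
  "tensor_lift V W f t =
     (let ps = SOME ps. set ps \<subseteq> carrier V \<times> carrier W \<and> t = (\<Sum>(v, w)\<leftarrow>ps. tensor V W v w)
      in \<Sum>(v, w)\<leftarrow>ps. f v w)"

definition tensor_map ::
  "('k::field, 'v::ab_group_add, 'm) vspace_scheme \<Rightarrow> ('k, 'w::ab_group_add, 'n) vspace_scheme \<Rightarrow>
   ('k, 'v'::ab_group_add, 'o) vspace_scheme \<Rightarrow> ('k, 'w'::ab_group_add, 'p) vspace_scheme \<Rightarrow>
   ('v \<Rightarrow> 'v') \<Rightarrow> ('w \<Rightarrow> 'w') \<Rightarrow> ('k, 'v, 'w) tensor \<Rightarrow> ('k, 'v', 'w') tensor" where
  "tensor_map V W V' W' f g = tensor_lift V W (\<lambda>v w. tensor V' W' (f v) (g w))"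

lemma sum_list_apply: "(\<Sum>x\<leftarrow>xs. F x) \<beta> = (\<Sum>x\<leftarrow>xs. F x \<beta>)"
  for F :: "'x \<Rightarrow> 'a \<Rightarrow> 'b::comm_monoid_add"
  by (induction xs) auto

lemma tensor_lift_sum_list:
  fixes V :: "('k::field, 'v::ab_group_add, 'x) vspace_scheme"
    and W :: "('k, 'w::ab_group_add, 'y) vspace_scheme"
    and U :: "('k, 'u::ab_group_add, 'z) vspace_scheme"
  assumes V: "is_vspace V" and W: "is_vspace W" and U: "is_vspace U"
    and f: "bilinear_map V W U f"
    and ps: "set ps \<subseteq> carrier V \<times> carrier W"
  shows "tensor_lift V W f (\<Sum>(v, w)\<leftarrow>ps. tensor V W v w) = (\<Sum>(v, w)\<leftarrow>ps. f v w)"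
proof -
  let ?t = "\<lambda>ps. \<Sum>(v, w)\<leftarrow>ps. tensor V W v w" and ?s = "\<lambda>ps. \<Sum>(v, w)\<leftarrow>ps. f v w"
  interpret U: vector_space "scal U" using U by (simp add: is_vspace_def)
  interpret UK: vector_space_pair "scal U" "(*) :: 'k \<Rightarrow> 'k \<Rightarrow> 'k"
    by unfold_locales (auto simp: algebra_simps)
  have *: "?s qs = ?s ps" if qs: "set qs \<subseteq> carrier V \<times> carrier W" "?t ps = ?t qs" for qs
  proof (rule ccontr)
    assume neq: "?s qs \<noteq> ?s ps"
    then have "U.independent {?s qs - ?s ps}" by simp
    then obtain g where g: "Vector_Spaces.linear (scal U) (*) g" "g (?s qs - ?s ps) = (1::'k)"
      using UK.linear_independent_extend[of "{?s qs - ?s ps}" "\<lambda>_. 1"] by auto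
    interpret g: Vector_Spaces.linear "scal U" "(*)" g by fact
    have bil: "bilinear_map V W base_space (\<lambda>v w. g (f v w))"
      using f by (auto simp: bilinear_map_def linear_map_def base_space_def g.add g.scale)
    have "g (?s rs) = ?t rs (\<lambda>v w. g (f v w))" for rs
      by (induction rs) (auto simp: g.add sum_list_apply tensor_def bil g.zero)
    then have "g (?s qs) = g (?s ps)" using qs(2) by simp
    then show False using g(2) by (simp add: g.diff)
  qed
  show ?thesis
    unfolding tensor_lift_def Let_def
    by (rule someI2[where a = ps], use ps in simp, rule *, auto)
qed

section \<open>Coalgebras\<close>

record ('k, 'v) coalg = "('k, 'v) vspace" +
  comul :: "'v \<Rightarrow> ('k, 'v, 'v) tensor"
  counit :: "'v \<Rightarrow> 'k"

text \<open>\<open>sweedler C (\<lambda>c1 c2. f c1 c2) c\<close> is what Sweedler notation writes as \<open>f(c\<^sub>1, c\<^sub>2)\<close>.\<close>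

definition sweedler ::
  "('k::field, 'v::ab_group_add, 'z) coalg_scheme \<Rightarrow> ('v \<Rightarrow> 'v \<Rightarrow> 'u::ab_group_add) \<Rightarrow> 'v \<Rightarrow> 'u" where
  "sweedler C f c = tensor_lift C C f (comul C c)"

definition coalgebra :: "('k::field, 'v::ab_group_add, 'z) coalg_scheme \<Rightarrow> bool" where
  "coalgebra C \<longleftrightarrow>
     is_vspace C \<and>
     linear_map C (tensor_space C C) (comul C) \<and>
     linear_map C base_space (counit C) \<and>
     (\<forall>c\<in>carrier C.
        sweedler C (\<lambda>a b. sweedler C (\<lambda>b1 b2. tensor C (tensor_space C C) a (tensor C C b1 b2)) b) c =
        sweedler C (\<lambda>a b. sweedler C (\<lambda>a1 a2. tensor C (tensor_space C C) a1 (tensor C C a2 b)) a) c) \<and>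
     (\<forall>c\<in>carrier C. sweedler C (\<lambda>a b. scal C (counit C a) b) c = c) \<and>
     (\<forall>c\<in>carrier C. sweedler C (\<lambda>a b. scal C (counit C b) a) c = c)"

definition cocommutative_coalgebra :: "('k::field, 'v::ab_group_add, 'z) coalg_scheme \<Rightarrow> bool" where
  "cocommutative_coalgebra C \<longleftrightarrow>
     coalgebra C \<and> (\<forall>c\<in>carrier C. sweedler C (\<lambda>a b. tensor C C b a) c = comul C c)"

definition coalgebra_map ::
  "('k::field, 'v::ab_group_add, 'y) coalg_scheme \<Rightarrow> ('k, 'w::ab_group_add, 'z) coalg_scheme \<Rightarrow>
   ('v \<Rightarrow> 'w) \<Rightarrow> bool" where
  "coalgebra_map C D f \<longleftrightarrow>
     linear_map C D f \<and>
     (\<forall>c\<in>carrier C. comul D (f c) = sweedler C (\<lambda>a b. tensor D D (f a) (f b)) c) \<and>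
     (\<forall>c\<in>carrier C. counit D (f c) = counit C c)"

text \<open>Extensionality makes coalgebra maps with equal values on the carrier equal.\<close>

definition coalgebra_maps ::
  "('k::field, 'v::ab_group_add, 'y) coalg_scheme \<Rightarrow> ('k, 'w::ab_group_add, 'z) coalg_scheme \<Rightarrow>
   ('v \<Rightarrow> 'w) set" where
  "coalgebra_maps C D = {f \<in> extensional (carrier C). coalgebra_map C D f}"

definition base_coalg :: "('k::field, 'k) coalg" where
  "base_coalg =
     \<lparr>carrier = carrier base_space, scal = scal base_space,
      comul = (\<lambda>a. tensor base_space base_space a 1), counit = (\<lambda>a. a)\<rparr>"

definition tensor_coalg ::
  "('k::field, 'v::ab_group_add, 'y) coalg_scheme \<Rightarrow> ('k, 'w::ab_group_add, 'z) coalg_scheme \<Rightarrow>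
   ('k, ('k, 'v, 'w) tensor) coalg" where
  "tensor_coalg C D =
     \<lparr>carrier = carrier (tensor_space C D), scal = scal (tensor_space C D),
      comul = tensor_lift C D (\<lambda>c d. sweedler C (\<lambda>c1 c2. sweedler D (\<lambda>d1 d2.
        tensor (tensor_space C D) (tensor_space C D) (tensor C D c1 d1) (tensor C D c2 d2)) d) c),
      counit = tensor_lift C D (\<lambda>c d. counit C c * counit D d)\<rparr>"

section \<open>Hopf algebras\<close>

record ('k, 'v) hopf = "('k, 'v) coalg" +
  hmult :: "'v \<Rightarrow> 'v \<Rightarrow> 'v"
  hone :: 'v
  antipode :: "'v \<Rightarrow> 'v"

definition hopf_algebra :: "('k::field, 'v::ab_group_add, 'z) hopf_scheme \<Rightarrow> bool" where
  "hopf_algebra H \<longleftrightarrow>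
     coalgebra H \<and>
     bilinear_map H H H (hmult H) \<and>
     hone H \<in> carrier H \<and>
     (\<forall>x\<in>carrier H. \<forall>y\<in>carrier H. \<forall>z\<in>carrier H.
        hmult H (hmult H x y) z = hmult H x (hmult H y z)) \<and>
     (\<forall>x\<in>carrier H. hmult H (hone H) x = x \<and> hmult H x (hone H) = x) \<and>
     (\<forall>x\<in>carrier H. \<forall>y\<in>carrier H.
        comul H (hmult H x y) =
          sweedler H (\<lambda>x1 x2. sweedler H (\<lambda>y1 y2. tensor H H (hmult H x1 y1) (hmult H x2 y2)) y) x \<and>
        counit H (hmult H x y) = counit H x * counit H y) \<and>
     comul H (hone H) = tensor H H (hone H) (hone H) \<and> counit H (hone H) = 1 \<and>
     linear_map H H (antipode H) \<and>
     (\<forall>x\<in>carrier H.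
        sweedler H (\<lambda>x1 x2. hmult H (antipode H x1) x2) x = scal H (counit H x) (hone H) \<and>
        sweedler H (\<lambda>x1 x2. hmult H x1 (antipode H x2)) x = scal H (counit H x) (hone H))"

definition hopf_map ::
  "('k::field, 'v::ab_group_add, 'y) hopf_scheme \<Rightarrow> ('k, 'w::ab_group_add, 'z) hopf_scheme \<Rightarrow>
   ('v \<Rightarrow> 'w) \<Rightarrow> bool" where
  "hopf_map H K f \<longleftrightarrow>
     coalgebra_map H K f \<and>
     (\<forall>x\<in>carrier H. \<forall>y\<in>carrier H. f (hmult H x y) = hmult K (f x) (f y)) \<and>
     f (hone H) = hone K \<and>
     (\<forall>x\<in>carrier H. f (antipode H x) = antipode K (f x))"

definition hopf_isomorphic ::
  "('k::field, 'v::ab_group_add, 'y) hopf_scheme \<Rightarrow> ('k, 'w::ab_group_add, 'z) hopf_scheme \<Rightarrow> bool" where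
  "hopf_isomorphic H K \<longleftrightarrow>
     hopf_algebra H \<and> hopf_algebra K \<and> (\<exists>f. hopf_map H K f \<and> bij_betw f (carrier H) (carrier K))"

section \<open>Group algebras\<close>

definition pm_scale :: "'k::field \<Rightarrow> ('g \<Rightarrow>\<^sub>0 'k) \<Rightarrow> ('g \<Rightarrow>\<^sub>0 'k)" where
  "pm_scale c = Poly_Mapping.map ((*) c)"

definition group_space :: "('g, 'z) monoid_scheme \<Rightarrow> ('k::field, 'g \<Rightarrow>\<^sub>0 'k) vspace" where
  "group_space G = \<lparr>carrier = {x. Poly_Mapping.keys x \<subseteq> carrier G}, scal = pm_scale\<rparr>"

definition group_algebra :: "('g, 'z) monoid_scheme \<Rightarrow> ('k::field, 'g \<Rightarrow>\<^sub>0 'k) hopf" where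
  "group_algebra G =
     (let V = group_space G; \<delta> = (\<lambda>g. Poly_Mapping.single g (1::'k)) in
      \<lparr>carrier = carrier V, scal = scal V,
       comul = (\<lambda>x. \<Sum>g\<in>Poly_Mapping.keys x.
         scal (tensor_space V V) (Poly_Mapping.lookup x g) (tensor V V (\<delta> g) (\<delta> g))),
       counit = (\<lambda>x. \<Sum>g\<in>Poly_Mapping.keys x. Poly_Mapping.lookup x g),
       hmult = (\<lambda>x y. \<Sum>g\<in>Poly_Mapping.keys x. \<Sum>h\<in>Poly_Mapping.keys y.
         pm_scale (Poly_Mapping.lookup x g * Poly_Mapping.lookup y h) (\<delta> (g \<otimes>\<^bsub>G\<^esub> h))),
       hone = \<delta> \<one>\<^bsub>G\<^esub>,
       antipode = (\<lambda>x. \<Sum>g\<in>Poly_Mapping.keys x. pm_scale (Poly_Mapping.lookup x g) (\<delta> (inv\<^bsub>G\<^esub> g)))\<rparr>)"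

section \<open>Wreath products of groups\<close>

definition wreath_group ::
  "('a, 'y) monoid_scheme \<Rightarrow> ('q, 'z) monoid_scheme \<Rightarrow> (('q \<Rightarrow> 'a) \<times> 'q) monoid" where
  "wreath_group A Q =
     (let P = product_group (carrier Q) (\<lambda>_. A);
          act = (\<lambda>q f. \<lambda>r\<in>carrier Q. f (r \<otimes>\<^bsub>Q\<^esub> q)) in
      \<lparr>carrier = carrier P \<times> carrier Q,
       monoid.mult = (\<lambda>(f, q) (g, r). (f \<otimes>\<^bsub>P\<^esub> act q g, q \<otimes>\<^bsub>Q\<^esub> r)),
       one = (\<one>\<^bsub>P\<^esub>, \<one>\<^bsub>Q\<^esub>)\<rparr>)"

section \<open>Exponentials of cocommutative coalgebras\<close>

text \<open>\<open>is_exponential TYPE('r) C D E ev\<close>: the cocommutative coalgebra \<open>E\<close> with evaluation \<open>ev\<close>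
  has the universal property of the exponential \<open>D\<^sup>C\<close> for maps from all cocommutative
  coalgebras \<open>R\<close> whose vectors have type \<open>'r\<close>. The quantifier over \<open>R\<close> cannot range over types as
  well, which is why \<open>'r\<close> is a parameter.\<close>

definition is_exponential ::
  "'r::ab_group_add itself \<Rightarrow> ('k::field, 'c::ab_group_add, 'y) coalg_scheme \<Rightarrow>
   ('k, 'd::ab_group_add, 'z) coalg_scheme \<Rightarrow> ('k, 'e::ab_group_add) coalg \<Rightarrow>
   (('k, 'e, 'c) tensor \<Rightarrow> 'd) \<Rightarrow> bool" where
  "is_exponential (_ :: 'r itself) C D E ev \<longleftrightarrow>
     cocommutative_coalgebra E \<and> coalgebra_map (tensor_coalg E C) D ev \<and>
     (\<forall>R :: ('k, 'r) coalg. cocommutative_coalgebra R \<longrightarrow>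
        bij_betw
          (\<lambda>\<phi>. \<lambda>t\<in>carrier (tensor_coalg R C). ev (tensor_map R C E C \<phi> (\<lambda>c. c) t))
          (coalgebra_maps R E) (coalgebra_maps (tensor_coalg R C) D))"

text \<open>In the following, \<open>E\<close> with evaluation \<open>ev\<close> is the exponential \<open>A\<^sup>Q\<close> of Hopf algebras, and
  \<open>ev (tensor E Q x c)\<close> is \<open>x@c\<close>.\<close>

definition exp_mult ::
  "('k::field, 'a::ab_group_add, 'y) hopf_scheme \<Rightarrow> ('k, 'q::ab_group_add, 'z) hopf_scheme \<Rightarrow>
   ('k, 'e::ab_group_add) coalg \<Rightarrow> (('k, 'e, 'q) tensor \<Rightarrow> 'a) \<Rightarrow> ('k, 'e, 'e) tensor \<Rightarrow> 'e" where
  "exp_mult A Q E ev = (THE m. m \<in> coalgebra_maps (tensor_coalg E E) E \<and>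
     (\<forall>x\<in>carrier E. \<forall>y\<in>carrier E. \<forall>c\<in>carrier Q.
        ev (tensor E Q (m (tensor E E x y)) c) =
        sweedler Q (\<lambda>c1 c2. hmult A (ev (tensor E Q x c1)) (ev (tensor E Q y c2))) c))"

definition exp_unit ::
  "('k::field, 'a::ab_group_add, 'y) hopf_scheme \<Rightarrow> ('k, 'q::ab_group_add, 'z) hopf_scheme \<Rightarrow>
   ('k, 'e::ab_group_add) coalg \<Rightarrow> (('k, 'e, 'q) tensor \<Rightarrow> 'a) \<Rightarrow> 'k \<Rightarrow> 'e" where
  "exp_unit A Q E ev = (THE u. u \<in> coalgebra_maps base_coalg E \<and>
     (\<forall>c\<in>carrier Q. ev (tensor E Q (u 1) c) = scal A (counit Q c) (hone A)))"

definition exp_antipode ::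
  "('k::field, 'a::ab_group_add, 'y) hopf_scheme \<Rightarrow> ('k, 'q::ab_group_add, 'z) hopf_scheme \<Rightarrow>
   ('k, 'e::ab_group_add) coalg \<Rightarrow> (('k, 'e, 'q) tensor \<Rightarrow> 'a) \<Rightarrow> 'e \<Rightarrow> 'e" where
  "exp_antipode A Q E ev = (THE s. s \<in> coalgebra_maps E E \<and>
     (\<forall>x\<in>carrier E. \<forall>c\<in>carrier Q.
        ev (tensor E Q (s x) c) = antipode A (ev (tensor E Q x c))))"

definition exp_hopf ::
  "('k::field, 'a::ab_group_add, 'y) hopf_scheme \<Rightarrow> ('k, 'q::ab_group_add, 'z) hopf_scheme \<Rightarrow>
   ('k, 'e::ab_group_add) coalg \<Rightarrow> (('k, 'e, 'q) tensor \<Rightarrow> 'a) \<Rightarrow> ('k, 'e) hopf" where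
  "exp_hopf A Q E ev =
     \<lparr>carrier = carrier E, scal = scal E, comul = comul E, counit = counit E,
      hmult = (\<lambda>x y. exp_mult A Q E ev (tensor E E x y)),
      hone = exp_unit A Q E ev 1,
      antipode = exp_antipode A Q E ev\<rparr>"

definition exp_action ::
  "('k::field, 'q::ab_group_add, 'z) hopf_scheme \<Rightarrow>
   ('k, 'e::ab_group_add) coalg \<Rightarrow> (('k, 'e, 'q) tensor \<Rightarrow> 'a) \<Rightarrow> ('k, 'q, 'e) tensor \<Rightarrow> 'e" where
  "exp_action Q E ev = (THE a. a \<in> coalgebra_maps (tensor_coalg Q E) E \<and>
     (\<forall>q\<in>carrier Q. \<forall>x\<in>carrier E. \<forall>r\<in>carrier Q.
        ev (tensor E Q (a (tensor Q E q x)) r) = ev (tensor E Q x (hmult Q r q))))"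

section \<open>Smash and wreath products of Hopf algebras\<close>

definition smash_product ::
  "('k::field, 'h::ab_group_add, 'y) hopf_scheme \<Rightarrow> ('k, 'q::ab_group_add, 'z) hopf_scheme \<Rightarrow>
   (('k, 'q, 'h) tensor \<Rightarrow> 'h) \<Rightarrow> ('k, ('k, 'h, 'q) tensor) hopf" where
  "smash_product H Q act =
     (let C = tensor_coalg H Q in
      \<lparr>carrier = carrier C, scal = scal C, comul = comul C, counit = counit C,
       hmult = (\<lambda>s t. tensor_lift H Q (\<lambda>h q. tensor_lift H Q (\<lambda>k r.
         sweedler Q (\<lambda>q1 q2. tensor H Q (hmult H h (act (tensor Q H q1 k))) (hmult Q q2 r)) q) t) s),
       hone = tensor H Q (hone H) (hone Q),
       antipode = tensor_lift H Q (\<lambda>h q.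
         sweedler Q (\<lambda>q1 q2.
           tensor H Q (act (tensor Q H (antipode Q q1) (antipode H h))) (antipode Q q2)) q)\<rparr>)"

definition wreath_hopf ::
  "('k::field, 'a::ab_group_add, 'y) hopf_scheme \<Rightarrow> ('k, 'q::ab_group_add, 'z) hopf_scheme \<Rightarrow>
   ('k, 'e::ab_group_add) coalg \<Rightarrow> (('k, 'e, 'q) tensor \<Rightarrow> 'a) \<Rightarrow>
   ('k, ('k, 'e, 'q) tensor) hopf" where
  "wreath_hopf A Q E ev = smash_product (exp_hopf A Q E ev) Q (exp_action Q E ev)"

end

theory Submission
  imports Defs
begin

text \<open>
  Coalgebra maps from a cocommutative coalgebra \<open>R\<close> to \<open>kS\<close> are the same as complete families
  of orthogonal idempotents in the dual algebra of \<open>R\<close>, indexed by \<open>S\<close> and locally finite on \<open>R\<close>.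
  A map \<open>R \<otimes> kQ \<rightarrow> kA\<close> is therefore one such family for each \<open>q \<in> Q\<close>. The idempotents act on
  \<open>R\<close> by commuting projections, every element of \<open>R\<close> lies in a finite-dimensional subspace stable
  under them, and so \<open>R\<close> is the direct sum of the joint eigenspaces, which are indexed by the
  functions \<open>Q \<rightarrow> A\<close>. This decomposition is a coalgebra map from \<open>R\<close> to the group algebra of the
  full power \<open>A\<^sup>Q\<close>, which is thus the exponential. Any other exponential is isomorphic to it, hence
  has a basis of grouplike elements indexed by \<open>A\<^sup>Q\<close>, and a coalgebra map is determined by what it
  does to grouplike elements. So all structure maps of the wreath product can be read off on the
  grouplike basis, where they are those of the wreath product of groups.
\<close>

text \<open>For an infinite group \<open>Q\<close> the projection onto a joint eigenspace would be
  an infinite product of idempotents, which cannot be written down. That the eigenspaces span is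
  therefore shown without projections: if some idempotent moves a vector, the resulting pieces
  generate strictly smaller finite-dimensional spaces under the dual algebra, and induction on that
  dimension ends at joint eigenvectors. The coefficient functionals are defined from the
  decomposition so obtained, and only afterwards recognised as idempotents that act as the missing
  projections.

  A second obstacle is that HOL has no quantifier over types, so a universal property is available
  only at chosen types of test coalgebras. Uniqueness of the exponential involves just two of them,
  the exponential itself and the group algebra of the full power, and these are the two instances
  that the theorem assumes of \<open>E\<close>.\<close>

abbreviation (input) "lookup \<equiv> Poly_Mapping.lookup"
abbreviation (input) "keys \<equiv> Poly_Mapping.keys"

section \<open>Linear maps and tensor products\<close>

context
  fixes V :: "('k::field, 'v::ab_group_add, 'z) vspace_scheme"
  assumes V: "is_vspace V"
begin

interpretation vector_space "scal V"
  using V by (simp add: is_vspace_def)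

private lemma subspace_carrier: "subspace (carrier V)"
  using V by (simp add: is_vspace_def)

lemmas vspace_zero = subspace_0[OF subspace_carrier]
  and vspace_add = subspace_add[OF subspace_carrier]
  and vspace_scal = subspace_scale[OF subspace_carrier]
  and vspace_sum = subspace_sum[OF subspace_carrier]

lemma vspace_sum_list: "(\<And>i. i \<in> set is \<Longrightarrow> F i \<in> carrier V) \<Longrightarrow> (\<Sum>i\<leftarrow>is. F i) \<in> carrier V"
  by (induction "is") (auto intro: vspace_zero vspace_add)

lemmas scal_add_right = scale_right_distrib
  and scal_add_left = scale_left_distrib
  and scal_scal = scale_scale
  and scal_one = scale_one
  and scal_zero = scale_zero_left
  and scal_zero_right = scale_zero_right
  and scal_sum = scale_sum_right
  and scal_sum_left = scale_sum_left

lemma scal_sum_list: "scal V c (\<Sum>i\<leftarrow>is. F i) = (\<Sum>i\<leftarrow>is. scal V c (F i))"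
  and scal_sum_list_left: "scal V (\<Sum>i\<leftarrow>is. h i) x = (\<Sum>i\<leftarrow>is. scal V (h i) x)"
  by (induction "is") (simp_all add: scale_right_distrib scale_left_distrib)

end

lemma base_space_simps [simp]: "carrier base_space = UNIV" "scal base_space = (*)"
  by (simp_all add: base_space_def)

lemma vspace_base_space: "is_vspace base_space"
proof -
  interpret vector_space "(*) :: 'k::field \<Rightarrow> 'k \<Rightarrow> 'k"
    by unfold_locales (auto simp: algebra_simps)
  show "is_vspace (base_space :: ('k, 'k) vspace)"
    by (simp add: is_vspace_def vector_space_axioms)
qed

lemma linear_mapI:
  assumes "\<And>x. x \<in> carrier V \<Longrightarrow> f x \<in> carrier W"
    and "\<And>x y. x \<in> carrier V \<Longrightarrow> y \<in> carrier V \<Longrightarrow> f (x + y) = f x + f y"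
    and "\<And>c x. x \<in> carrier V \<Longrightarrow> f (scal V c x) = scal W c (f x)"
  shows "linear_map V W f"
  using assms by (auto simp: linear_map_def)

lemma linear_map_closed: "linear_map V W f \<Longrightarrow> x \<in> carrier V \<Longrightarrow> f x \<in> carrier W"
  and linear_map_add:
    "linear_map V W f \<Longrightarrow> x \<in> carrier V \<Longrightarrow> y \<in> carrier V \<Longrightarrow> f (x + y) = f x + f y"
  and linear_map_scal: "linear_map V W f \<Longrightarrow> x \<in> carrier V \<Longrightarrow> f (scal V c x) = scal W c (f x)"
  by (auto simp: linear_map_def)

lemma linear_map_zero:
  fixes W :: "('k::field, 'w::ab_group_add, 'z) vspace_scheme"
  assumes "is_vspace V" "linear_map V W f"
  shows "f 0 = 0"
  using linear_map_add[OF assms(2), of 0 0] vspace_zero[OF assms(1)] by simp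

lemma linear_map_sum:
  fixes W :: "('k::field, 'w::ab_group_add, 'z) vspace_scheme"
  assumes V: "is_vspace V" and f: "linear_map V W f" and F: "\<And>i. i \<in> I \<Longrightarrow> F i \<in> carrier V"
  shows "f (sum F I) = (\<Sum>i\<in>I. f (F i))"
proof (cases "finite I")
  case True
  then show ?thesis using F
    by (induction I)
      (auto simp: linear_map_zero[OF V f] linear_map_add[OF f] vspace_sum[OF V])
qed (simp add: linear_map_zero[OF V f])

lemma linear_map_sum_list:
  fixes W :: "('k::field, 'w::ab_group_add, 'z) vspace_scheme"
  assumes V: "is_vspace V" and f: "linear_map V W f" and F: "\<And>i. i \<in> set is \<Longrightarrow> F i \<in> carrier V"
  shows "f (\<Sum>i\<leftarrow>is. F i) = (\<Sum>i\<leftarrow>is. f (F i))"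
  using F by (induction "is")
    (auto simp: linear_map_zero[OF V f] linear_map_add[OF f] vspace_sum_list[OF V])

lemma linear_map_ident: "linear_map V V (\<lambda>x. x)"
  by (simp add: linear_map_def)

lemma linear_map_compose:
  "linear_map V W f \<Longrightarrow> linear_map W U g \<Longrightarrow> linear_map V U (\<lambda>x. g (f x))"
  by (simp add: linear_map_def)

lemma linear_map_const_zero:
  assumes "is_vspace U" shows "linear_map V U (\<lambda>_. 0)"
  using vspace_zero[OF assms] scal_zero_right[OF assms] by (simp add: linear_map_def)

lemma linear_map_plus:
  assumes U: "is_vspace U" and "linear_map V U f" "linear_map V U g"
  shows "linear_map V U (\<lambda>x. f x + g x)"
  using assms(2,3) by (simp add: linear_map_def vspace_add[OF U] scal_add_right[OF U])

lemma linear_map_sum_fun: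
  assumes U: "is_vspace U" and "\<And>i. i \<in> I \<Longrightarrow> linear_map V U (F i)"
  shows "linear_map V U (\<lambda>x. \<Sum>i\<in>I. F i x)"
proof (cases "finite I")
  case True
  then show ?thesis using assms(2)
    by (induction I) (auto intro: linear_map_const_zero[OF U] linear_map_plus[OF U])
qed (simp add: linear_map_const_zero[OF U])

lemma linear_map_sum_list_fun:
  assumes U: "is_vspace U" and "\<And>i. i \<in> set is \<Longrightarrow> linear_map V U (F i)"
  shows "linear_map V U (\<lambda>x. \<Sum>i\<leftarrow>is. F i x)"
  using assms(2)
  by (induction "is") (auto intro: linear_map_const_zero[OF U] linear_map_plus[OF U])

lemma linear_map_scal_fun:
  assumes U: "is_vspace U" and "linear_map V U f"
  shows "linear_map V U (\<lambda>x. scal U c (f x))"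
  using assms(2)
  by (simp add: linear_map_def vspace_scal[OF U] scal_add_right[OF U] scal_scal[OF U] mult.commute)

lemma linear_map_scal_left:
  assumes U: "is_vspace U" and "linear_map V base_space e" "u \<in> carrier U"
  shows "linear_map V U (\<lambda>x. scal U (e x) u)"
  using assms(2,3)
  by (simp add: linear_map_def vspace_scal[OF U] scal_add_left[OF U] scal_scal[OF U])

lemma linear_map_mult_left:
  "linear_map V base_space e \<Longrightarrow> linear_map V base_space (\<lambda>x. c * e x)"
  for e :: "'v::plus \<Rightarrow> 'k::field"
  by (simp add: linear_map_def algebra_simps)

lemma bilinear_mapI:
  assumes "\<And>v. v \<in> carrier V \<Longrightarrow> linear_map W U (f v)"
    and "\<And>w. w \<in> carrier W \<Longrightarrow> linear_map V U (\<lambda>v. f v w)"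
  shows "bilinear_map V W U f"
  using assms by (simp add: bilinear_map_def)

lemma bilinear_map_left: "bilinear_map V W U f \<Longrightarrow> w \<in> carrier W \<Longrightarrow> linear_map V U (\<lambda>v. f v w)"
  and bilinear_map_right: "bilinear_map V W U f \<Longrightarrow> v \<in> carrier V \<Longrightarrow> linear_map W U (f v)"
  by (simp_all add: bilinear_map_def)

lemma bilinear_map_closed:
  "bilinear_map V W U f \<Longrightarrow> v \<in> carrier V \<Longrightarrow> w \<in> carrier W \<Longrightarrow> f v w \<in> carrier U"
  by (simp add: bilinear_map_def linear_map_def)

lemma bilinear_map_compose:
  assumes "bilinear_map V W U f" "linear_map V' V g" "linear_map W' W h"
  shows "bilinear_map V' W' U (\<lambda>x y. f (g x) (h y))"
  using assms by (simp add: bilinear_map_def linear_map_def)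

lemma linear_map_comp_bilinear:
  assumes "bilinear_map V W U f" "linear_map U U' g"
  shows "bilinear_map V W U' (\<lambda>x y. g (f x y))"
  using assms by (simp add: bilinear_map_def linear_map_def)

lemma bilinear_map_mult:
  assumes "linear_map V base_space e" "linear_map W base_space e'"
  shows "bilinear_map V W base_space (\<lambda>x y. e x * e' y)"
  using assms by (simp add: bilinear_map_def linear_map_def algebra_simps)

section \<open>Spanning sets and equality of linear maps\<close>

text \<open>Adding a multiple of one generator per step makes reasoning about linear combinations
  plain rule induction, with no coefficients or supports to choose. For a vector space this is the
  linear span of \<open>B\<close>.\<close>

inductive_set lspan :: "('k, 'v::ab_group_add, 'z) vspace_scheme \<Rightarrow> 'v set \<Rightarrow> 'v set" for V B where
  zero: "0 \<in> lspan V B"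
| step: "b \<in> B \<Longrightarrow> x \<in> lspan V B \<Longrightarrow> scal V c b + x \<in> lspan V B"

definition spanned_by :: "('k, 'v::ab_group_add, 'z) vspace_scheme \<Rightarrow> 'v set \<Rightarrow> bool" where
  "spanned_by V B \<longleftrightarrow> B \<subseteq> carrier V \<and> carrier V \<subseteq> lspan V B"

lemma spanned_by_subset: "spanned_by V B \<Longrightarrow> b \<in> B \<Longrightarrow> b \<in> carrier V"
  by (auto simp: spanned_by_def)

lemma lspan_closed:
  assumes "is_vspace V" "B \<subseteq> carrier V" "x \<in> lspan V B"
  shows "x \<in> carrier V"
  using assms(3,2)
  by induction (auto intro: vspace_zero[OF assms(1)] vspace_add[OF assms(1)] vspace_scal[OF assms(1)])

text \<open>The set where two linear maps agree is closed under the steps that generate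
  \<open>lspan\<close>. This is the main proof rule of what follows: coalgebra and Hopf identities
  are written as equalities of linear maps and checked on grouplike vectors only.\<close>

lemma linear_map_eq_on_spanning:
  fixes V :: "('k::field, 'v::ab_group_add, 'y) vspace_scheme"
    and U :: "('k, 'u::ab_group_add, 'z) vspace_scheme"
  assumes V: "is_vspace V" and B: "spanned_by V B"
    and f: "linear_map V U f" and g: "linear_map V U g"
    and eq: "\<And>b. b \<in> B \<Longrightarrow> f b = g b" and x: "x \<in> carrier V"
  shows "f x = g x"
proof -
  have BV: "B \<subseteq> carrier V" and "x \<in> lspan V B" using B x by (auto simp: spanned_by_def)
  from this(2) show ?thesis
  proof induction
    case (step b x c)
    then have "b \<in> carrier V" "x \<in> carrier V" using BV lspan_closed[OF V BV] by auto
    then show ?case using step eq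
      by (simp add: linear_map_add[OF f] linear_map_add[OF g] linear_map_scal[OF f]
          linear_map_scal[OF g] vspace_scal[OF V])
  qed (simp add: linear_map_zero[OF V f] linear_map_zero[OF V g])
qed

lemma spanned_by_carrier:
  assumes "is_vspace V" shows "spanned_by V (carrier V)"
proof -
  have "x \<in> lspan V (carrier V)" if "x \<in> carrier V" for x
    using lspan.step[OF that lspan.zero, of V 1] by (simp add: scal_one[OF assms])
  then show ?thesis by (auto simp: spanned_by_def)
qed

lemma lspan_add:
  assumes "x \<in> lspan V B" "y \<in> lspan V B" shows "x + y \<in> lspan V B"
  using assms by (induction) (auto simp: add.assoc intro: lspan.step)

lemma lspan_scal:
  assumes V: "is_vspace V" and "x \<in> lspan V B" shows "scal V c x \<in> lspan V B"
  using assms(2) by (induction)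
    (auto simp: scal_add_right[OF V] scal_scal[OF V] scal_zero_right[OF V] intro: lspan.intros)

lemma lspan_sum:
  assumes "\<And>i. i \<in> I \<Longrightarrow> F i \<in> lspan V B" shows "sum F I \<in> lspan V B"
  using assms by (induction I rule: infinite_finite_induct) (auto intro: lspan_add lspan.zero)

lemma linear_map_lspan:
  assumes V: "is_vspace V" and U: "is_vspace U" and f: "linear_map V U f"
    and BV: "B \<subseteq> carrier V" and x: "x \<in> lspan V B" and B': "\<And>b. b \<in> B \<Longrightarrow> f b \<in> lspan U B'"
  shows "f x \<in> lspan U B'"
  using x
proof induction
  case (step b x c)
  then have "b \<in> carrier V" "x \<in> carrier V" using BV lspan_closed[OF V BV] by auto
  then show ?case using step B'
    by (simp add: linear_map_add[OF f] linear_map_scal[OF f] vspace_scal[OF V] lspan_add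
        lspan_scal[OF U])
qed (simp add: linear_map_zero[OF V f] lspan.zero)

lemma bilinear_map_add_left:
  "bilinear_map V W U f \<Longrightarrow> x \<in> carrier V \<Longrightarrow> y \<in> carrier V \<Longrightarrow> w \<in> carrier W \<Longrightarrow>
    f (x + y) w = f x w + f y w"
  and bilinear_map_add_right:
  "bilinear_map V W U f \<Longrightarrow> v \<in> carrier V \<Longrightarrow> x' \<in> carrier W \<Longrightarrow> y' \<in> carrier W \<Longrightarrow>
    f v (x' + y') = f v x' + f v y'"
  and bilinear_map_scal_left:
  "bilinear_map V W U f \<Longrightarrow> x \<in> carrier V \<Longrightarrow> w \<in> carrier W \<Longrightarrow>
    f (scal V c x) w = scal U c (f x w)"
  and bilinear_map_scal_right:
  "bilinear_map V W U f \<Longrightarrow> v \<in> carrier V \<Longrightarrow> x' \<in> carrier W \<Longrightarrow>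
    f v (scal W c x') = scal U c (f v x')"
  by (simp_all add: bilinear_map_def linear_map_def)

section \<open>Tensor spaces and lifts of bilinear maps\<close>

lemma scal_tensor_space [simp]: "scal (tensor_space V W) c t = (\<lambda>\<beta>. c * t \<beta>)"
  by (simp add: tensor_space_def)

lemma tensor_spaceE:
  assumes "t \<in> carrier (tensor_space V W)"
  obtains ps where "set ps \<subseteq> carrier V \<times> carrier W" "t = (\<Sum>(v, w)\<leftarrow>ps. tensor V W v w)"
  using assms by (auto simp: tensor_space_def)

lemma tensor_sum_list_in_space:
  "set ps \<subseteq> carrier V \<times> carrier W \<Longrightarrow> (\<Sum>(v, w)\<leftarrow>ps. tensor V W v w) \<in> carrier (tensor_space V W)"
  by (auto simp: tensor_space_def)

lemma tensor_in_space:
  assumes "v \<in> carrier V" "w \<in> carrier W"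
  shows "tensor V W v w \<in> carrier (tensor_space V W)"
  using tensor_sum_list_in_space[of "[(v, w)]" V W] assms by simp

lemma tensor_scal_left:
  "v \<in> carrier V \<Longrightarrow> w \<in> carrier W \<Longrightarrow>
    tensor V W (scal V c v) w = scal (tensor_space V W) c (tensor V W v w)"
  by (auto simp: tensor_def fun_eq_iff bilinear_map_scal_left)

lemma vspace_tensor_space:
  assumes V: "is_vspace V" shows "is_vspace (tensor_space V W)"
proof -
  let ?T = "tensor_space V W"
  interpret vector_space "scal ?T"
    by unfold_locales (auto simp: fun_eq_iff algebra_simps)
  have "subspace (carrier ?T)"
  proof (rule subspaceI)
    show "0 \<in> carrier ?T" using tensor_sum_list_in_space[of "[]" V W] by simp
    show "x + y \<in> carrier ?T" if "x \<in> carrier ?T" "y \<in> carrier ?T" for x y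
    proof -
      from that obtain ps qs where "set ps \<subseteq> carrier V \<times> carrier W" "x = (\<Sum>(v, w)\<leftarrow>ps. tensor V W v w)"
        "set qs \<subseteq> carrier V \<times> carrier W" "y = (\<Sum>(v, w)\<leftarrow>qs. tensor V W v w)"
        by (elim tensor_spaceE)
      then show ?thesis using tensor_sum_list_in_space[of "ps @ qs" V W] by simp
    qed
    show "scal ?T c x \<in> carrier ?T" if "x \<in> carrier ?T" for c x
    proof -
      from that obtain ps where ps: "set ps \<subseteq> carrier V \<times> carrier W"
        and x: "x = (\<Sum>(v, w)\<leftarrow>ps. tensor V W v w)" by (elim tensor_spaceE)
      \<comment> \<open>The scalar is absorbed into the left factor of every pure tensor, which
        keeps the sum in the required shape.\<close>
      have "scal ?T c x = (\<Sum>(v, w)\<leftarrow>map (\<lambda>(v, w). (scal V c v, w)) ps. tensor V W v w)"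
        using ps unfolding x
      proof (induction ps)
        case (Cons p ps)
        then show ?case
          by (cases p) (auto simp: fun_eq_iff algebra_simps tensor_scal_left)
      qed (simp add: fun_eq_iff)
      moreover have "set (map (\<lambda>(v, w). (scal V c v, w)) ps) \<subseteq> carrier V \<times> carrier W"
        using ps vspace_scal[OF V] by auto
      ultimately show ?thesis using tensor_sum_list_in_space by metis
    qed
  qed
  then show ?thesis by (simp add: is_vspace_def vector_space_axioms)
qed

lemma bilinear_map_tensor: "bilinear_map V W (tensor_space V W) (tensor V W)"
  by (intro bilinear_mapI linear_mapI tensor_in_space)
    (auto simp: tensor_def fun_eq_iff bilinear_map_scal_left bilinear_map_scal_right
      bilinear_map_add_left bilinear_map_add_right)

lemmas linear_map_tensor_left = bilinear_map_left[OF bilinear_map_tensor]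
lemmas linear_map_tensor_right = bilinear_map_right[OF bilinear_map_tensor]

lemma linear_map_tensor_fun_left:
  "linear_map U V f \<Longrightarrow> w \<in> carrier W \<Longrightarrow> linear_map U (tensor_space V W) (\<lambda>x. tensor V W (f x) w)"
  by (rule linear_map_compose[OF _ linear_map_tensor_left])

lemma linear_map_tensor_fun_right:
  "linear_map U W f \<Longrightarrow> v \<in> carrier V \<Longrightarrow> linear_map U (tensor_space V W) (\<lambda>x. tensor V W v (f x))"
  by (rule linear_map_compose[OF _ linear_map_tensor_right])

lemma spanned_by_tensor_space:
  assumes V: "is_vspace V" and W: "is_vspace W" and B: "spanned_by V B" and C: "spanned_by W C"
  shows "spanned_by (tensor_space V W) {tensor V W b c | b c. b \<in> B \<and> c \<in> C}"
proof -
  let ?T = "tensor_space V W" and ?D = "{tensor V W b c | b c. b \<in> B \<and> c \<in> C}"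
  have T: "is_vspace ?T" by (rule vspace_tensor_space[OF V])
  have BV: "B \<subseteq> carrier V" "carrier V \<subseteq> lspan V B" and CW: "C \<subseteq> carrier W" "carrier W \<subseteq> lspan W C"
    using B C by (auto simp: spanned_by_def)
  have D: "?D \<subseteq> carrier ?T" using BV CW by (auto intro!: tensor_in_space)
  have base: "x \<in> lspan ?T ?D" if "x \<in> ?D" for x
    using lspan.step[OF that lspan.zero, of ?T 1] by (simp add: scal_one[OF T] del: scal_tensor_space)
  \<comment> \<open>Spanning is extended one slot at a time: \<open>1\<close> frees the right factor
    while the left one is a generator, \<open>2\<close> then frees the left one.\<close>
  have 1: "tensor V W v w \<in> lspan ?T ?D" if "v \<in> B" "w \<in> carrier W" for v w
    by (rule linear_map_lspan[OF W T linear_map_tensor_right CW(1)]) (use that BV CW base in blast)+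
  have 2: "tensor V W v w \<in> lspan ?T ?D" if "v \<in> carrier V" "w \<in> carrier W" for v w
    by (rule linear_map_lspan[OF V T linear_map_tensor_left[OF that(2)] BV(1)]) (use that BV 1 in blast)+
  have "t \<in> lspan ?T ?D" if "t \<in> carrier ?T" for t
  proof -
    from that obtain ps where "set ps \<subseteq> carrier V \<times> carrier W" "t = (\<Sum>(v, w)\<leftarrow>ps. tensor V W v w)"
      by (elim tensor_spaceE)
    then show ?thesis
      by (induction ps arbitrary: t) (auto intro!: lspan_add 2 intro: lspan.zero)
  qed
  then show ?thesis using D by (auto simp: spanned_by_def)
qed

lemma tensor_lift_tensor:
  assumes "is_vspace V" "is_vspace W" "is_vspace U" "bilinear_map V W U f"
    "v \<in> carrier V" "w \<in> carrier W"
  shows "tensor_lift V W f (tensor V W v w) = f v w"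
  using tensor_lift_sum_list[OF assms(1-4), of "[(v, w)]"] assms(5,6) by simp

text \<open>By \<open>tensor_lift_sum_list\<close> the lift can be computed from any list of pure
  tensors, so addition becomes concatenation of lists and scaling acts on the left entries.\<close>

lemma linear_map_tensor_lift:
  assumes V: "is_vspace V" and W: "is_vspace W" and U: "is_vspace U" and f: "bilinear_map V W U f"
  shows "linear_map (tensor_space V W) U (tensor_lift V W f)"
proof -
  let ?t = "\<lambda>ps. \<Sum>(v, w)\<leftarrow>ps. tensor V W v w" and ?s = "\<lambda>ps. \<Sum>(v, w)\<leftarrow>ps. f v w"
  have lift: "tensor_lift V W f (?t ps) = ?s ps" if "set ps \<subseteq> carrier V \<times> carrier W" for ps
    by (rule tensor_lift_sum_list[OF V W U f that])
  show ?thesis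
  proof (rule linear_mapI)
    fix t assume "t \<in> carrier (tensor_space V W)"
    then obtain ps where ps: "set ps \<subseteq> carrier V \<times> carrier W" and t: "t = ?t ps"
      by (elim tensor_spaceE)
    show "tensor_lift V W f t \<in> carrier U"
      using ps by (auto simp: t lift intro!: vspace_sum_list[OF U] bilinear_map_closed[OF f])
    fix c
    have eq: "scal (tensor_space V W) c t = ?t (map (\<lambda>(v, w). (scal V c v, w)) ps)"
      unfolding t scal_sum_list[OF vspace_tensor_space[OF V]] using ps
      by (induction ps) (auto simp: tensor_scal_left)
    have "tensor_lift V W f (scal (tensor_space V W) c t) = ?s (map (\<lambda>(v, w). (scal V c v, w)) ps)"
      unfolding eq by (rule lift) (use ps vspace_scal[OF V] in auto)
    also have "\<dots> = scal U c (?s ps)"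
      unfolding scal_sum_list[OF U] using ps
      by (induction ps) (auto simp: bilinear_map_scal_left[OF f])
    finally show "tensor_lift V W f (scal (tensor_space V W) c t) = scal U c (tensor_lift V W f t)"
      by (simp add: t lift[OF ps] del: scal_tensor_space)
  next
    fix s t assume "s \<in> carrier (tensor_space V W)" "t \<in> carrier (tensor_space V W)"
    then obtain ps qs where ps: "set ps \<subseteq> carrier V \<times> carrier W" "s = ?t ps"
      and qs: "set qs \<subseteq> carrier V \<times> carrier W" "t = ?t qs"
      by (elim tensor_spaceE)
    then show "tensor_lift V W f (s + t) = tensor_lift V W f s + tensor_lift V W f t"
      using lift[of "ps @ qs"] by (simp add: lift)
  qed
qed

text \<open>The list of pairs chosen inside \<^const>\<open>tensor_lift\<close>; it does not depend on the bilinear map.\<close>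

definition tensor_terms ::
  "('k::field, 'v::ab_group_add, 'y) vspace_scheme \<Rightarrow> ('k, 'w::ab_group_add, 'z) vspace_scheme \<Rightarrow>
   ('k, 'v, 'w) tensor \<Rightarrow> ('v \<times> 'w) list" where
  "tensor_terms V W t =
     (SOME ps. set ps \<subseteq> carrier V \<times> carrier W \<and> t = (\<Sum>(v, w)\<leftarrow>ps. tensor V W v w))"

lemma tensor_lift_terms: "tensor_lift V W f t = (\<Sum>(v, w)\<leftarrow>tensor_terms V W t. f v w)"
  by (simp add: tensor_lift_def tensor_terms_def Let_def)

lemma tensor_terms:
  assumes "t \<in> carrier (tensor_space V W)"
  shows "set (tensor_terms V W t) \<subseteq> carrier V \<times> carrier W"
    and "t = (\<Sum>(v, w)\<leftarrow>tensor_terms V W t. tensor V W v w)"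
proof -
  have "set (tensor_terms V W t) \<subseteq> carrier V \<times> carrier W \<and>
      t = (\<Sum>(v, w)\<leftarrow>tensor_terms V W t. tensor V W v w)"
    unfolding tensor_terms_def by (rule someI_ex) (use assms in \<open>auto simp: tensor_space_def\<close>)
  then show "set (tensor_terms V W t) \<subseteq> carrier V \<times> carrier W"
    and "t = (\<Sum>(v, w)\<leftarrow>tensor_terms V W t. tensor V W v w)" by blast+
qed

lemma tensor_lift_cong:
  assumes "t \<in> carrier (tensor_space V W)"
    and "\<And>v w. v \<in> carrier V \<Longrightarrow> w \<in> carrier W \<Longrightarrow> f v w = g v w"
  shows "tensor_lift V W f t = tensor_lift V W g t"
  unfolding tensor_lift_terms using tensor_terms(1)[OF assms(1)] assms(2)
  by (intro arg_cong[where f = sum_list] map_cong) auto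

text \<open>Both sides are sums over the same list \<open>tensor_terms V W t\<close>, which depends
  on \<open>t\<close> alone, so \<open>L\<close> is pushed through one finite sum.\<close>

lemma tensor_lift_compose:
  assumes U: "is_vspace U" and t: "t \<in> carrier (tensor_space V W)" and L: "linear_map U U' L"
    and f: "\<And>v w. v \<in> carrier V \<Longrightarrow> w \<in> carrier W \<Longrightarrow> f v w \<in> carrier U"
  shows "L (tensor_lift V W f t) = tensor_lift V W (\<lambda>v w. L (f v w)) t"
  using tensor_terms(1)[OF t] unfolding tensor_lift_terms
  by (subst linear_map_sum_list[OF U L]) (auto simp: f case_prod_unfold)

lemma linear_map_tensor_lift_fun:
  assumes U: "is_vspace U" and t: "t \<in> carrier (tensor_space V W)"
    and f: "\<And>v w. v \<in> carrier V \<Longrightarrow> w \<in> carrier W \<Longrightarrow> linear_map X U (\<lambda>x. f x v w)"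
  shows "linear_map X U (\<lambda>x. tensor_lift V W (f x) t)"
  unfolding tensor_lift_terms
  by (rule linear_map_sum_list_fun[OF U]) (use tensor_terms(1)[OF t] f in auto)

subsection \<open>Independence of the record type\<close>

text \<open>Coalgebra and Hopf records extend the vector space record, and a tensor coalgebra has
  the carrier and scalars of the tensor space. These congruences exchange such records wherever only
  the two fields are read.\<close>

lemma bilinear_map_cong:
  assumes "carrier V = carrier V'" "scal V = scal V'" "carrier W = carrier W'" "scal W = scal W'"
    "carrier U = carrier U'" "scal U = scal U'"
  shows "bilinear_map V W U = bilinear_map V' W' U'"
  using assms by (auto simp: fun_eq_iff bilinear_map_def linear_map_def)

lemma vspace_cong:
  assumes "carrier V = carrier V'" "scal V = scal V'"
  shows "is_vspace V = is_vspace V'"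
  using assms by (simp add: is_vspace_def)

lemma linear_map_cong:
  assumes "carrier V = carrier V'" "scal V = scal V'" "carrier W = carrier W'" "scal W = scal W'"
  shows "linear_map V W = linear_map V' W'"
  using assms by (auto simp: fun_eq_iff linear_map_def)

lemma tensor_cong:
  assumes "carrier V = carrier V'" "scal V = scal V'" "carrier W = carrier W'" "scal W = scal W'"
  shows "tensor V W = tensor V' W'"
  using bilinear_map_cong[OF assms, of base_space base_space] by (simp add: fun_eq_iff tensor_def)

lemma tensor_space_cong:
  assumes "carrier V = carrier V'" "scal V = scal V'" "carrier W = carrier W'" "scal W = scal W'"
  shows "tensor_space V W = tensor_space V' W'"
  using assms by (simp add: tensor_space_def tensor_cong[OF assms])

lemma tensor_lift_space_cong:
  assumes "carrier V = carrier V'" "scal V = scal V'" "carrier W = carrier W'" "scal W = scal W'"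
  shows "tensor_lift V W = tensor_lift V' W'"
  using assms by (simp add: fun_eq_iff tensor_lift_def tensor_cong[OF assms])

section \<open>Coalgebras\<close>

lemma sweedler_terms: "sweedler C f c = (\<Sum>(a, b)\<leftarrow>tensor_terms C C (comul C c). f a b)"
  by (simp add: sweedler_def tensor_lift_terms)

lemma sweedler_sum: "sweedler C (\<lambda>a b. \<Sum>i\<in>I. f i a b) c = (\<Sum>i\<in>I. sweedler C (f i) c)"
proof -
  have "(\<Sum>(a, b)\<leftarrow>ps. \<Sum>i\<in>I. f i a b) = (\<Sum>i\<in>I. \<Sum>(a, b)\<leftarrow>ps. f i a b)" for ps
    by (induction ps) (auto simp: sum.distrib)
  then show ?thesis by (simp add: sweedler_terms)
qed

lemma sweedler_cong:
  assumes "linear_map C (tensor_space C C) (comul C)" "c \<in> carrier C"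
    and "\<And>a b. a \<in> carrier C \<Longrightarrow> b \<in> carrier C \<Longrightarrow> f a b = g a b"
  shows "sweedler C f c = sweedler C g c"
  unfolding sweedler_def by (intro tensor_lift_cong assms linear_map_closed[OF assms(1)])

lemma sweedler_compose:
  assumes C: "linear_map C (tensor_space C C) (comul C)" "c \<in> carrier C" and U: "is_vspace U"
    and L: "linear_map U U' L" and "\<And>a b. a \<in> carrier C \<Longrightarrow> b \<in> carrier C \<Longrightarrow> f a b \<in> carrier U"
  shows "L (sweedler C f c) = sweedler C (\<lambda>a b. L (f a b)) c"
  unfolding sweedler_def by (intro tensor_lift_compose[OF U _ L] assms linear_map_closed[OF C(1)])

lemma linear_map_sweedler:
  assumes C: "is_vspace C" "linear_map C (tensor_space C C) (comul C)" and U: "is_vspace U"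
    and f: "bilinear_map C C U f"
  shows "linear_map C U (sweedler C f)"
  unfolding sweedler_def using linear_map_compose[OF C(2) linear_map_tensor_lift[OF C(1) C(1) U f]] .

text \<open>Linearity in a parameter of the summand while \<open>c\<close> stays fixed, as opposed
  to linearity in \<open>c\<close> itself, which is \<open>linear_map_sweedler\<close>. Nested
  Sweedler expressions need the two together.\<close>

lemma linear_map_sweedler_fun:
  assumes C: "linear_map C (tensor_space C C) (comul C)" "c \<in> carrier C" and U: "is_vspace U"
    and f: "\<And>a b. a \<in> carrier C \<Longrightarrow> b \<in> carrier C \<Longrightarrow> linear_map X U (\<lambda>x. f x a b)"
  shows "linear_map X U (\<lambda>x. sweedler C (f x) c)"
  unfolding sweedler_def by (intro linear_map_tensor_lift_fun[OF U] linear_map_closed[OF C(1)] C(2) f)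

lemma bilinear_map_sweedler_right:
  assumes C: "is_vspace C" "linear_map C (tensor_space C C) (comul C)" and U: "is_vspace U"
    and f1: "\<And>a. a \<in> carrier X \<Longrightarrow> bilinear_map C C U (f a)"
    and f2: "\<And>b c. b \<in> carrier C \<Longrightarrow> c \<in> carrier C \<Longrightarrow> linear_map X U (\<lambda>a. f a b c)"
  shows "bilinear_map X C U (\<lambda>a. sweedler C (f a))"
  by (intro bilinear_mapI linear_map_sweedler[OF C U] linear_map_sweedler_fun[OF C(2) _ U] f1 f2)

lemma bilinear_map_sweedler_left:
  assumes C: "is_vspace C" "linear_map C (tensor_space C C) (comul C)" and U: "is_vspace U"
    and f1: "\<And>a. a \<in> carrier X \<Longrightarrow> bilinear_map C C U (\<lambda>b c. f b c a)"
    and f2: "\<And>b c. b \<in> carrier C \<Longrightarrow> c \<in> carrier C \<Longrightarrow> linear_map X U (f b c)"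
  shows "bilinear_map C X U (\<lambda>b a. sweedler C (\<lambda>b1 b2. f b1 b2 a) b)"
  by (intro bilinear_mapI linear_map_sweedler[OF C U] linear_map_sweedler_fun[OF C(2) _ U] f1 f2)

section \<open>Grouplike elements and Sweedler calculus\<close>

text \<open>The counit condition excludes the zero vector, which satisfies the comultiplication
  equation of any linear \<open>comul C\<close>.\<close>

definition grouplike :: "('k::field, 'v::ab_group_add, 'z) coalg_scheme \<Rightarrow> 'v \<Rightarrow> bool" where
  "grouplike C g \<longleftrightarrow> g \<in> carrier C \<and> comul C g = tensor C C g g \<and> counit C g = 1"

lemma grouplike_closed: "grouplike C g \<Longrightarrow> g \<in> carrier C"
  by (simp add: grouplike_def)

text \<open>The comultiplication of \<open>g\<close> is the single pure tensor of \<open>g\<close>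
  with itself, so the Sweedler sum has one term. All later computations on grouplike elements rest
  on this collapse.\<close>

lemma sweedler_grouplike:
  assumes "is_vspace C" "is_vspace U" "bilinear_map C C U f" "grouplike C g"
  shows "sweedler C f g = f g g"
  using assms tensor_lift_tensor[OF assms(1) assms(1-3)] by (simp add: sweedler_def grouplike_def)

lemma coalgebraD:
  assumes "coalgebra C"
  shows "is_vspace C" "linear_map C (tensor_space C C) (comul C)"
    "linear_map C base_space (counit C)"
  using assms by (simp_all add: coalgebra_def)

text \<open>The coalgebra axiom is the case of the universal trilinear map into C \<otimes> (C
  \<otimes> C). A general trilinear \<open>f\<close> factors through it, and the induced linear map
  \<open>?L\<close> carries the axiom to the claim.\<close>

lemma sweedler_assoc:
  assumes C: "coalgebra C" and U: "is_vspace U" and c: "c \<in> carrier C"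
    and f1: "\<And>a. a \<in> carrier C \<Longrightarrow> bilinear_map C C U (f a)"
    and f2: "\<And>a b. a \<in> carrier C \<Longrightarrow> b \<in> carrier C \<Longrightarrow> linear_map C U (\<lambda>x. f x a b)"
  shows "sweedler C (\<lambda>a b. sweedler C (\<lambda>b1 b2. f a b1 b2) b) c =
    sweedler C (\<lambda>a b. sweedler C (\<lambda>a1 a2. f a1 a2 b) a) c"
proof -
  note C' = coalgebraD[OF C]
  let ?T = "tensor_space C C"
  note T = vspace_tensor_space[OF C'(1)]
  let ?L = "tensor_lift C ?T (\<lambda>a t. tensor_lift C C (f a) t)"
  have bil: "bilinear_map C ?T U (\<lambda>a t. tensor_lift C C (f a) t)"
    by (intro bilinear_mapI linear_map_tensor_lift[OF C'(1) C'(1) U] linear_map_tensor_lift_fun[OF U] f1 f2)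
  have L: "linear_map (tensor_space C ?T) U ?L"
    by (rule linear_map_tensor_lift[OF C'(1) T U bil])
  have LT: "?L (tensor C ?T a (tensor C C x y)) = f a x y"
    if "a \<in> carrier C" "x \<in> carrier C" "y \<in> carrier C" for a x y
    using that by (simp add: tensor_lift_tensor[OF C'(1) T U bil] tensor_in_space
        tensor_lift_tensor[OF C'(1) C'(1) U f1])
  have in1: "sweedler C (\<lambda>b1 b2. tensor C ?T a (tensor C C b1 b2)) b \<in> carrier (tensor_space C ?T)"
    if "a \<in> carrier C" "b \<in> carrier C" for a b
    by (intro linear_map_closed[OF linear_map_sweedler] C' vspace_tensor_space that
        linear_map_comp_bilinear[OF bilinear_map_tensor] linear_map_tensor_right)
  have in2: "sweedler C (\<lambda>a1 a2. tensor C ?T a1 (tensor C C a2 b)) a \<in> carrier (tensor_space C ?T)"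
    if "a \<in> carrier C" "b \<in> carrier C" for a b
    by (intro linear_map_closed[OF linear_map_sweedler] C' vspace_tensor_space that
        bilinear_map_compose[OF bilinear_map_tensor] linear_map_ident linear_map_tensor_left)
  have "?L (sweedler C (\<lambda>a b. sweedler C (\<lambda>b1 b2. tensor C ?T a (tensor C C b1 b2)) b) c) =
      sweedler C (\<lambda>a b. sweedler C (\<lambda>b1 b2. f a b1 b2) b) c"
    and "?L (sweedler C (\<lambda>a b. sweedler C (\<lambda>a1 a2. tensor C ?T a1 (tensor C C a2 b)) a) c) =
      sweedler C (\<lambda>a b. sweedler C (\<lambda>a1 a2. f a1 a2 b) a) c"
    using c by (simp_all add: sweedler_compose[OF C'(2) _ vspace_tensor_space[OF C'(1)] L]
        in1 in2 tensor_in_space LT cong: sweedler_cong[OF C'(2)])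
  then show ?thesis using C c by (simp add: coalgebra_def)
qed

lemma
  assumes C: "coalgebra C" and c: "c \<in> carrier C" and f: "linear_map C U f"
  shows sweedler_counit_left: "sweedler C (\<lambda>a b. scal U (counit C a) (f b)) c = f c"
    and sweedler_counit_right: "sweedler C (\<lambda>a b. scal U (counit C b) (f a)) c = f c"
proof -
  note C' = coalgebraD[OF C]
  have "f (sweedler C (\<lambda>a b. scal C (counit C a) b) c) = f c"
    "f (sweedler C (\<lambda>a b. scal C (counit C b) a) c) = f c"
    using C c by (simp_all add: coalgebra_def)
  then show "sweedler C (\<lambda>a b. scal U (counit C a) (f b)) c = f c"
    "sweedler C (\<lambda>a b. scal U (counit C b) (f a)) c = f c"
    using c by (simp_all add: sweedler_compose[OF C'(2) _ C'(1) f] vspace_scal[OF C'(1)]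
        linear_map_scal[OF f] cong: sweedler_cong[OF C'(2)])
qed

text \<open>The linear map that \<open>f\<close> induces on the tensor product is applied to the
  cocommutativity equation.\<close>

lemma sweedler_commute:
  assumes C: "cocommutative_coalgebra C" and U: "is_vspace U" and c: "c \<in> carrier C"
    and f: "bilinear_map C C U f"
  shows "sweedler C (\<lambda>a b. f b a) c = sweedler C f c"
proof -
  have "coalgebra C" using C by (simp add: cocommutative_coalgebra_def)
  note C' = coalgebraD[OF this]
  note L = linear_map_tensor_lift[OF C'(1) C'(1) U f]
  have "sweedler C f c = tensor_lift C C f (sweedler C (\<lambda>a b. tensor C C b a) c)"
    using C c by (simp add: cocommutative_coalgebra_def sweedler_def)
  also have "\<dots> = sweedler C (\<lambda>a b. f b a) c"
    using c by (simp add: sweedler_compose[OF C'(2) _ vspace_tensor_space[OF C'(1)] L] tensor_in_space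
        tensor_lift_tensor[OF C'(1) C'(1) U f] cong: sweedler_cong[OF C'(2)])
  finally show ?thesis by simp
qed

text \<open>Every axiom equates two linear maps, so it need only be seen on \<open>B\<close>. There
  both sides collapse; coassociativity, for instance, has the threefold tensor of \<open>b\<close>
  with itself on either side.\<close>

lemma cocommutative_coalgebra_of_grouplike:
  assumes C: "is_vspace C" "linear_map C (tensor_space C C) (comul C)"
    and e: "linear_map C base_space (counit C)"
    and B: "spanned_by C B" "\<And>b. b \<in> B \<Longrightarrow> grouplike C b"
  shows "cocommutative_coalgebra C"
proof -
  let ?T = "tensor_space C C"
  note T = vspace_tensor_space[OF C(1)]
  note eqI = linear_map_eq_on_spanning[OF C(1) B(1)]
  note sg = sweedler_grouplike[OF C(1) _ _ B(2)]
  have t1: "bilinear_map C C (tensor_space C ?T) (\<lambda>b1 b2. tensor C ?T a (tensor C C b1 b2))"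
    if "a \<in> carrier C" for a
    by (rule linear_map_comp_bilinear[OF bilinear_map_tensor linear_map_tensor_right[OF that]])
  have t2: "bilinear_map C C (tensor_space C ?T) (\<lambda>a1 a2. tensor C ?T a1 (tensor C C a2 b))"
    if "b \<in> carrier C" for b
    by (rule bilinear_map_compose[OF bilinear_map_tensor linear_map_ident linear_map_tensor_left[OF that]])
  have b1: "bilinear_map C C (tensor_space C ?T)
      (\<lambda>a b. sweedler C (\<lambda>b1 b2. tensor C ?T a (tensor C C b1 b2)) b)"
    by (intro bilinear_map_sweedler_right C T t1 vspace_tensor_space linear_map_tensor_left tensor_in_space)
  have b2: "bilinear_map C C (tensor_space C ?T)
      (\<lambda>a b. sweedler C (\<lambda>a1 a2. tensor C ?T a1 (tensor C C a2 b)) a)"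
    by (intro bilinear_map_sweedler_left C T t2 vspace_tensor_space linear_map_tensor_fun_right
        linear_map_tensor_right)
  have assoc: "sweedler C (\<lambda>a b. sweedler C (\<lambda>b1 b2. tensor C ?T a (tensor C C b1 b2)) b) c =
        sweedler C (\<lambda>a b. sweedler C (\<lambda>a1 a2. tensor C ?T a1 (tensor C C a2 b)) a) c"
    if "c \<in> carrier C" for c
  proof (rule eqI[OF linear_map_sweedler[OF C _ b1] linear_map_sweedler[OF C _ b2] _ that])
    fix b assume b: "b \<in> B"
    have b': "b \<in> carrier C" by (rule spanned_by_subset[OF B(1) b])
    show "sweedler C (\<lambda>a b. sweedler C (\<lambda>b1 b2. tensor C ?T a (tensor C C b1 b2)) b) b =
        sweedler C (\<lambda>a b. sweedler C (\<lambda>a1 a2. tensor C ?T a1 (tensor C C a2 b)) a) b"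
      by (simp only: sg[OF vspace_tensor_space[OF C(1)] b1 b] sg[OF vspace_tensor_space[OF C(1)] b2 b]
          sg[OF vspace_tensor_space[OF C(1)] t1[OF b'] b] sg[OF vspace_tensor_space[OF C(1)] t2[OF b'] b])
  qed (rule vspace_tensor_space[OF C(1)])+
  have c1: "bilinear_map C C C (\<lambda>a b. scal C (counit C a) b)"
    by (intro bilinear_mapI linear_map_scal_fun linear_map_scal_left linear_map_ident C e)
  have c2: "bilinear_map C C C (\<lambda>a b. scal C (counit C b) a)"
    by (intro bilinear_mapI linear_map_scal_fun linear_map_scal_left linear_map_ident C e)
  have counit: "sweedler C (\<lambda>a b. scal C (counit C a) b) c = c"
    "sweedler C (\<lambda>a b. scal C (counit C b) a) c = c"
    if "c \<in> carrier C" for c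
    by (rule eqI[OF linear_map_sweedler[OF C C(1) c1] linear_map_ident _ that],
        use B(2) in \<open>simp add: sg[OF C(1) c1] grouplike_def scal_one[OF C(1)]\<close>)
      (rule eqI[OF linear_map_sweedler[OF C C(1) c2] linear_map_ident _ that],
        use B(2) in \<open>simp add: sg[OF C(1) c2] grouplike_def scal_one[OF C(1)]\<close>)
  have c3: "bilinear_map C C (tensor_space C C) (\<lambda>a b. tensor C C b a)"
    by (intro bilinear_mapI linear_map_tensor_left linear_map_tensor_right)
  have "sweedler C (\<lambda>a b. tensor C C b a) c = comul C c" if "c \<in> carrier C" for c
    by (rule eqI[OF linear_map_sweedler[OF C T c3] C(2) _ that])
      (use B(2) in \<open>simp add: sg[OF T c3] grouplike_def\<close>)
  then show ?thesis
    using C e assoc counit by (simp add: cocommutative_coalgebra_def coalgebra_def)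
qed

lemma coalgebra_mapD:
  assumes "coalgebra_map C D h"
  shows "linear_map C D h"
    and "c \<in> carrier C \<Longrightarrow> comul D (h c) = sweedler C (\<lambda>a b. tensor D D (h a) (h b)) c"
    and "c \<in> carrier C \<Longrightarrow> counit D (h c) = counit C c"
  using assms by (simp_all add: coalgebra_map_def)

text \<open>Naturality of Sweedler notation: the comultiplication of \<open>h c\<close> is
  represented by the images of the terms of \<open>c\<close>.\<close>

lemma sweedler_coalgebra_map:
  assumes C: "linear_map C (tensor_space C C) (comul C)" "c \<in> carrier C" and D: "is_vspace D"
    and U: "is_vspace U" and h: "coalgebra_map C D h" and f: "bilinear_map D D U f"
  shows "sweedler D f (h c) = sweedler C (\<lambda>a b. f (h a) (h b)) c"
proof -
  note L = linear_map_tensor_lift[OF D D U f]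
  have "sweedler D f (h c) = tensor_lift D D f (sweedler C (\<lambda>a b. tensor D D (h a) (h b)) c)"
    using coalgebra_mapD(2)[OF h C(2)] by (simp add: sweedler_def)
  also have "\<dots> = sweedler C (\<lambda>a b. f (h a) (h b)) c"
    using C(2) by (simp add: sweedler_compose[OF C(1) _ vspace_tensor_space[OF D] L] tensor_in_space
        tensor_lift_tensor[OF D D U f] linear_map_closed[OF coalgebra_mapD(1)[OF h]]
        cong: sweedler_cong[OF C(1)])
  finally show ?thesis .
qed

lemma coalgebra_map_cong:
  assumes "linear_map C (tensor_space C C) (comul C)" "is_vspace C"
    and eq: "\<And>c. c \<in> carrier C \<Longrightarrow> f c = g c"
  shows "coalgebra_map C D f \<longleftrightarrow> coalgebra_map C D g"
proof -
  have "linear_map C D f \<longleftrightarrow> linear_map C D g"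
    using eq vspace_add[OF assms(2)] vspace_scal[OF assms(2)] by (simp add: linear_map_def)
  then show ?thesis
    using eq by (simp add: coalgebra_map_def cong: sweedler_cong[OF assms(1)])
qed

lemma coalgebra_map_compose:
  assumes C: "linear_map C (tensor_space C C) (comul C)" and D: "is_vspace D" and E: "is_vspace E"
    and f: "coalgebra_map C D f" and g: "coalgebra_map D E g"
  shows "coalgebra_map C E (\<lambda>x. g (f x))"
proof -
  note f' = coalgebra_mapD[OF f] and g' = coalgebra_mapD[OF g]
  have "bilinear_map D D (tensor_space E E) (\<lambda>a b. tensor E E (g a) (g b))"
    by (rule bilinear_map_compose[OF bilinear_map_tensor g'(1) g'(1)])
  then show ?thesis
    using linear_map_compose[OF f'(1) g'(1)] linear_map_closed[OF f'(1)]
    by (simp add: coalgebra_map_def f'(3) g'(2,3)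
        sweedler_coalgebra_map[OF C _ D vspace_tensor_space[OF E] f])
qed

lemma grouplike_coalgebra_map:
  assumes C: "is_vspace C" and D: "is_vspace D" and h: "coalgebra_map C D h" and g: "grouplike C g"
  shows "grouplike D (h g)"
proof -
  note h' = coalgebra_mapD[OF h]
  have "bilinear_map C C (tensor_space D D) (\<lambda>a b. tensor D D (h a) (h b))"
    by (rule bilinear_map_compose[OF bilinear_map_tensor h'(1) h'(1)])
  then show ?thesis
    using g linear_map_closed[OF h'(1)]
    by (simp add: grouplike_def h'(2,3) sweedler_grouplike[OF C vspace_tensor_space[OF D] _ g])
qed

text \<open>Both coalgebra map equations are linear in the argument, and on \<open>B\<close> they
  say that \<open>h b\<close> is again grouplike.\<close>

lemma coalgebra_map_of_grouplike:
  assumes C: "is_vspace C" "linear_map C (tensor_space C C) (comul C)"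
      "linear_map C base_space (counit C)"
    and D: "is_vspace D" "linear_map D (tensor_space D D) (comul D)"
      "linear_map D base_space (counit D)"
    and B: "spanned_by C B" "\<And>b. b \<in> B \<Longrightarrow> grouplike C b"
    and h: "linear_map C D h" "\<And>b. b \<in> B \<Longrightarrow> grouplike D (h b)"
  shows "coalgebra_map C D h"
proof -
  note eqI = linear_map_eq_on_spanning[OF C(1) B(1)]
  note T = vspace_tensor_space[OF D(1)]
  have bil: "bilinear_map C C (tensor_space D D) (\<lambda>a b. tensor D D (h a) (h b))"
    by (rule bilinear_map_compose[OF bilinear_map_tensor h(1) h(1)])
  have "comul D (h c) = sweedler C (\<lambda>a b. tensor D D (h a) (h b)) c" if "c \<in> carrier C" for c
    by (rule eqI[OF linear_map_compose[OF h(1) D(2)] linear_map_sweedler[OF C(1,2) T bil] _ that])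
      (use h(2) in \<open>simp add: sweedler_grouplike[OF C(1) T bil B(2)] grouplike_def\<close>)
  moreover have "counit D (h c) = counit C c" if "c \<in> carrier C" for c
    by (rule eqI[OF linear_map_compose[OF h(1) D(3)] C(3) _ that])
      (use h(2) B(2) in \<open>simp add: grouplike_def\<close>)
  ultimately show ?thesis using h(1) by (simp add: coalgebra_map_def)
qed

section \<open>Tensor products of coalgebras\<close>

lemma lspan_mono_scal:
  assumes "scal V = scal V'" "x \<in> lspan V B" shows "x \<in> lspan V' B"
  using assms(2) by induction (auto simp: assms(1) intro: lspan.intros)

lemma spanned_by_cong:
  assumes "carrier V = carrier V'" "scal V = scal V'"
  shows "spanned_by V B \<longleftrightarrow> spanned_by V' B"
  using lspan_mono_scal[OF assms(2)] lspan_mono_scal[OF assms(2)[symmetric]] assms(1)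
  by (auto simp: spanned_by_def)

lemma tensor_coalg_space [simp]:
  "carrier (tensor_coalg C D) = carrier (tensor_space C D)"
  "scal (tensor_coalg C D) = scal (tensor_space C D)"
  by (simp_all add: tensor_coalg_def)

lemma tensor_coalg_simps [simp]:
  "is_vspace (tensor_coalg C D) \<longleftrightarrow> is_vspace (tensor_space C D)"
  "linear_map (tensor_coalg C D) V = linear_map (tensor_space C D) V"
  "linear_map V (tensor_coalg C D) = linear_map V (tensor_space C D)"
  "tensor (tensor_coalg C D) (tensor_coalg C D) = tensor (tensor_space C D) (tensor_space C D)"
  "tensor_space (tensor_coalg C D) (tensor_coalg C D) =
    tensor_space (tensor_space C D) (tensor_space C D)"
  "bilinear_map (tensor_coalg C D) (tensor_coalg C D) V =
    bilinear_map (tensor_space C D) (tensor_space C D) V"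
  "spanned_by (tensor_coalg C D) B \<longleftrightarrow> spanned_by (tensor_space C D) B"
  by (rule vspace_cong linear_map_cong tensor_cong tensor_space_cong bilinear_map_cong
      spanned_by_cong; simp)+

context
  fixes C :: "('k::field, 'v::ab_group_add, 'y) coalg_scheme"
    and D :: "('k, 'w::ab_group_add, 'z) coalg_scheme"
  assumes C: "is_vspace C" "linear_map C (tensor_space C C) (comul C)"
      "linear_map C base_space (counit C)"
    and D: "is_vspace D" "linear_map D (tensor_space D D) (comul D)"
      "linear_map D base_space (counit D)"
begin

private abbreviation (input) "T \<equiv> tensor_space C D"

private lemma TT: "is_vspace (tensor_space T T)"
  by (intro vspace_tensor_space C(1))

text \<open>The comultiplication of \<open>tensor_coalg\<close> is the lift of the instance
  \<open>f = tensor T T\<close>; \<open>tensor_lift\<close> computes it on pure tensors once the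
  lifted expression is known to be bilinear.\<close>

lemma bilinear_map_sweedler_sweedler:
  assumes U: "is_vspace U" and f: "bilinear_map T T U f"
  shows "bilinear_map C D U (\<lambda>c d. sweedler C (\<lambda>c1 c2. sweedler D (\<lambda>d1 d2.
    f (tensor C D c1 d1) (tensor C D c2 d2)) d) c)"
proof -
  have 1: "bilinear_map D D U (\<lambda>d1 d2. f (tensor C D c1 d1) (tensor C D c2 d2))"
    if "c1 \<in> carrier C" "c2 \<in> carrier C" for c1 c2
    by (rule bilinear_map_compose[OF f]; rule linear_map_tensor_right; rule that)
  have 2: "bilinear_map C C U (\<lambda>c1 c2. f (tensor C D c1 d1) (tensor C D c2 d2))"
    if "d1 \<in> carrier D" "d2 \<in> carrier D" for d1 d2
    by (rule bilinear_map_compose[OF f]; rule linear_map_tensor_left; rule that)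
  have 3: "bilinear_map C C U (\<lambda>c1 c2. sweedler D (\<lambda>d1 d2. f (tensor C D c1 d1) (tensor C D c2 d2)) d)"
    if d: "d \<in> carrier D" for d
    by (intro bilinear_mapI linear_map_sweedler_fun[OF D(2) d U];
        (erule (2) bilinear_map_right[OF 2] bilinear_map_left[OF 2])?)
  show ?thesis
    by (intro bilinear_mapI linear_map_sweedler[OF C(1,2) U] linear_map_sweedler_fun[OF C(2) _ U] 3
        linear_map_sweedler[OF D(1,2) U] 1)
qed

lemma bilinear_map_comul_tensor:
  "bilinear_map C D (tensor_space T T) (\<lambda>c d. sweedler C (\<lambda>c1 c2. sweedler D (\<lambda>d1 d2.
    tensor T T (tensor C D c1 d1) (tensor C D c2 d2)) d) c)"
  by (rule bilinear_map_sweedler_sweedler[OF TT bilinear_map_tensor])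

lemma linear_map_comul_tensor_coalg:
  "linear_map T (tensor_space T T) (comul (tensor_coalg C D))"
  using linear_map_tensor_lift[OF C(1) D(1) TT bilinear_map_comul_tensor]
  by (simp add: tensor_coalg_def)

lemma linear_map_counit_tensor_coalg: "linear_map T base_space (counit (tensor_coalg C D))"
  using linear_map_tensor_lift[OF C(1) D(1) vspace_base_space bilinear_map_mult[OF C(3) D(3)]]
  by (simp add: tensor_coalg_def)

lemma comul_tensor_coalg:
  "c \<in> carrier C \<Longrightarrow> d \<in> carrier D \<Longrightarrow> comul (tensor_coalg C D) (tensor C D c d) =
    sweedler C (\<lambda>c1 c2. sweedler D (\<lambda>d1 d2.
      tensor T T (tensor C D c1 d1) (tensor C D c2 d2)) d) c"
  using tensor_lift_tensor[OF C(1) D(1) TT bilinear_map_comul_tensor]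
  by (simp add: tensor_coalg_def)

lemma counit_tensor_coalg:
  "c \<in> carrier C \<Longrightarrow> d \<in> carrier D \<Longrightarrow>
    counit (tensor_coalg C D) (tensor C D c d) = counit C c * counit D d"
  using tensor_lift_tensor[OF C(1) D(1) vspace_base_space bilinear_map_mult[OF C(3) D(3)]]
  by (simp add: tensor_coalg_def)

lemma comul_tensor_coalg_grouplike:
  assumes c: "c \<in> carrier C" and d: "grouplike D d"
  shows "comul (tensor_coalg C D) (tensor C D c d) =
    sweedler C (\<lambda>c1 c2. tensor T T (tensor C D c1 d) (tensor C D c2 d)) c"
proof -
  have "bilinear_map D D (tensor_space T T) (\<lambda>d1 d2. tensor T T (tensor C D c1 d1) (tensor C D c2 d2))"
    if "c1 \<in> carrier C" "c2 \<in> carrier C" for c1 c2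
    by (rule bilinear_map_compose[OF bilinear_map_tensor]; rule linear_map_tensor_right; rule that)
  from sweedler_grouplike[OF D(1) TT this d] show ?thesis
    using c by (simp add: comul_tensor_coalg grouplike_closed[OF d] cong: sweedler_cong[OF C(2)])
qed

lemma coalgebra_map_tensor_point:
  assumes d: "grouplike D d"
  shows "coalgebra_map C (tensor_coalg C D) (\<lambda>c. tensor C D c d)"
  using d linear_map_tensor_left[OF grouplike_closed[OF d]]
  by (simp add: coalgebra_map_def comul_tensor_coalg_grouplike counit_tensor_coalg grouplike_closed)
    (simp add: grouplike_def)

lemma grouplike_tensor:
  assumes c: "grouplike C c" and d: "grouplike D d"
  shows "grouplike (tensor_coalg C D) (tensor C D c d)"
  by (rule grouplike_coalgebra_map[OF C(1) _ coalgebra_map_tensor_point[OF d] c])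
    (simp add: vspace_tensor_space[OF C(1)])

text \<open>Tensors c \<otimes> b with \<open>b\<close> in \<open>B\<close> span, and on them the
  coalgebra map from \<open>c\<close> to c \<otimes> b moves the Sweedler sum from the tensor
  product to \<open>C\<close>. For \<open>D\<close> a group algebra this turns a coalgebra map out
  of C \<otimes> D into a family of coalgebra maps out of \<open>C\<close> indexed by the
  group.\<close>

lemma coalgebra_map_tensor_coalg_iff:
  assumes X: "is_vspace X" "linear_map X (tensor_space X X) (comul X)"
      "linear_map X base_space (counit X)"
    and B: "spanned_by D B" "\<And>b. b \<in> B \<Longrightarrow> grouplike D b"
  shows "coalgebra_map (tensor_coalg C D) X h \<longleftrightarrow>
    linear_map T X h \<and> (\<forall>b\<in>B. coalgebra_map C X (\<lambda>c. h (tensor C D c b)))"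
proof (intro iffI conjI ballI)
  assume h: "coalgebra_map (tensor_coalg C D) X h"
  show "linear_map T X h" using coalgebra_mapD(1)[OF h] by simp
  show "coalgebra_map C X (\<lambda>c. h (tensor C D c b))" if "b \<in> B" for b
    by (rule coalgebra_map_compose[OF C(2) _ X(1) coalgebra_map_tensor_point[OF B(2)[OF that]] h])
      (simp add: vspace_tensor_space[OF C(1)])
next
  assume "linear_map T X h \<and> (\<forall>b\<in>B. coalgebra_map C X (\<lambda>c. h (tensor C D c b)))"
  then have h: "linear_map T X h" and hb: "\<And>b. b \<in> B \<Longrightarrow> coalgebra_map C X (\<lambda>c. h (tensor C D c b))"
    by auto
  note eqI = linear_map_eq_on_spanning[OF vspace_tensor_space[OF C(1)]
      spanned_by_tensor_space[OF C(1) D(1) spanned_by_carrier[OF C(1)] B(1)]]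
  have bil: "bilinear_map T T (tensor_space X X) (\<lambda>a b. tensor X X (h a) (h b))"
    by (rule bilinear_map_compose[OF bilinear_map_tensor h h])
  have TX: "is_vspace (tensor_space X X)" and TC: "is_vspace T"
    by (intro vspace_tensor_space X(1) C(1))+
  let ?S = "sweedler (tensor_coalg C D) (\<lambda>a b. tensor X X (h a) (h b))"
  have S: "linear_map T (tensor_space X X) ?S"
    using linear_map_sweedler[of "tensor_coalg C D", OF _ _ TX] bil TC linear_map_comul_tensor_coalg
    by simp
  have "comul X (h t) = ?S t" if t: "t \<in> carrier T" for t
  proof (rule eqI[OF linear_map_compose[OF h X(2)] S _ t])
    fix u assume "u \<in> {tensor C D c b |c b. c \<in> carrier C \<and> b \<in> B}"
    then obtain c b where u: "u = tensor C D c b" and c: "c \<in> carrier C" and b: "b \<in> B" by auto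
    have "?S u = sweedler C (\<lambda>c1 c2. tensor X X (h (tensor C D c1 b)) (h (tensor C D c2 b))) c"
      unfolding u
      using sweedler_coalgebra_map[OF C(2) c _ TX coalgebra_map_tensor_point[OF B(2)[OF b]]] bil TC
      by simp
    then show "comul X (h u) = ?S u"
      using coalgebra_mapD(2)[OF hb[OF b] c] by (simp add: u)
  qed
  moreover have "counit X (h t) = counit (tensor_coalg C D) t" if t: "t \<in> carrier T" for t
  proof (rule eqI[OF linear_map_compose[OF h X(3)] linear_map_counit_tensor_coalg _ t])
    fix u assume "u \<in> {tensor C D c b |c b. c \<in> carrier C \<and> b \<in> B}"
    then obtain c b where u: "u = tensor C D c b" and c: "c \<in> carrier C" and b: "b \<in> B" by auto
    show "counit X (h u) = counit (tensor_coalg C D) u"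
      using coalgebra_mapD(3)[OF hb[OF b] c] B(2)[OF b] c
      by (simp add: u counit_tensor_coalg grouplike_closed) (simp add: grouplike_def)
  qed
  ultimately show "coalgebra_map (tensor_coalg C D) X h" using h by (simp add: coalgebra_map_def)
qed

end

lemma bilinear_map_eq_on_spanning:
  fixes V :: "('k::field, 'v::ab_group_add, 'x) vspace_scheme"
    and W :: "('k, 'w::ab_group_add, 'y) vspace_scheme"
    and U :: "('k, 'u::ab_group_add, 'z) vspace_scheme"
  assumes V: "is_vspace V" and W: "is_vspace W" and B: "spanned_by V B" and C: "spanned_by W C"
    and f: "bilinear_map V W U f" and g: "bilinear_map V W U g"
    and eq: "\<And>b c. b \<in> B \<Longrightarrow> c \<in> C \<Longrightarrow> f b c = g b c" and x: "x \<in> carrier V" and y: "y \<in> carrier W"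
  shows "f x y = g x y"
proof (rule linear_map_eq_on_spanning[OF V B bilinear_map_left[OF f y] bilinear_map_left[OF g y] _ x])
  fix b assume b: "b \<in> B"
  then have b': "b \<in> carrier V" by (rule spanned_by_subset[OF B])
  show "f b y = g b y"
    by (rule linear_map_eq_on_spanning[OF W C bilinear_map_right[OF f b'] bilinear_map_right[OF g b'] eq[OF b] y])
qed

lemma sweedler_scal_left:
  assumes "is_vspace U"
  shows "sweedler C (\<lambda>a b. scal U (e a b) u) c = scal U (sweedler C e c) u"
  unfolding sweedler_terms scal_sum_list_left[OF assms] by (simp add: case_prod_unfold)

section \<open>Group algebras\<close>

abbreviation (input) point :: "'g \<Rightarrow> ('g \<Rightarrow>\<^sub>0 'k::field)" where
  "point g \<equiv> Poly_Mapping.single g 1"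

lemma lookup_pm_scale [simp]: "lookup (pm_scale c x) g = c * lookup x g"
  by (simp add: pm_scale_def map.rep_eq when_def)

lemma keys_pm_scale: "keys (pm_scale c x) \<subseteq> keys x"
  by (auto simp: in_keys_iff)

lemma group_algebra_simps [simp]:
  "carrier (group_algebra G) = {x. keys x \<subseteq> carrier G}"
  "scal (group_algebra G) = pm_scale"
  by (simp_all add: group_algebra_def group_space_def Let_def)

lemma vspace_group_algebra: "is_vspace (group_algebra G :: ('k::field, 'g \<Rightarrow>\<^sub>0 'k) hopf)"
proof -
  interpret vector_space "pm_scale :: 'k \<Rightarrow> ('g \<Rightarrow>\<^sub>0 'k) \<Rightarrow> _"
    by unfold_locales (auto intro!: poly_mapping_eqI simp: lookup_add algebra_simps)
  have "subspace {x. keys x \<subseteq> carrier G}"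
    by (rule subspaceI)
      (use subset_trans[OF keys_add Un_least] subset_trans[OF keys_pm_scale] in simp_all)
  then show ?thesis by (simp add: is_vspace_def vector_space_axioms)
qed

lemma point_in_group_algebra: "g \<in> carrier G \<Longrightarrow> point g \<in> carrier (group_algebra G)"
  by simp

text \<open>The group algebra is the free vector space on the group. Its comultiplication, counit,
  multiplication and antipode are all rewritten as such extensions, so that their linearity comes
  from one lemma.\<close>

definition lin_ext ::
  "('k::field, 'v::ab_group_add, 'z) vspace_scheme \<Rightarrow> ('g \<Rightarrow> 'v) \<Rightarrow> ('g \<Rightarrow>\<^sub>0 'k) \<Rightarrow> 'v" where
  "lin_ext V b x = (\<Sum>g\<in>keys x. scal V (lookup x g) (b g))"

text \<open>Terms outside the support vanish, so sums over the supports of different vectors can be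
  compared over a common finite set.\<close>

lemma lin_ext_superset:
  assumes "is_vspace V" "finite S" "keys x \<subseteq> S"
  shows "lin_ext V b x = (\<Sum>g\<in>S. scal V (lookup x g) (b g))"
  unfolding lin_ext_def
  by (rule sum.mono_neutral_left[OF assms(2,3)]) (auto simp: in_keys_iff scal_zero[OF assms(1)])

lemma lin_ext_point: "is_vspace V \<Longrightarrow> lin_ext V b (point g) = b g"
  by (simp add: lin_ext_def scal_one)

lemma linear_map_lin_ext:
  assumes V: "is_vspace V" and b: "\<And>g. g \<in> carrier G \<Longrightarrow> b g \<in> carrier V"
  shows "linear_map (group_algebra G) V (lin_ext V b)"
proof (rule linear_mapI)
  show "lin_ext V b x \<in> carrier V" if "x \<in> carrier (group_algebra G)" for x
    unfolding lin_ext_def using that by (intro vspace_sum[OF V] vspace_scal[OF V] b) auto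
  show "lin_ext V b (x + y) = lin_ext V b x + lin_ext V b y" for x y
    using lin_ext_superset[OF V, of "keys x \<union> keys y"] keys_add[of x y]
    by (simp add: lookup_add scal_add_left[OF V] sum.distrib)
  show "lin_ext V b (scal (group_algebra G) c x) = scal V c (lin_ext V b x)" for c x
    using lin_ext_superset[OF V finite_keys keys_pm_scale]
    by (simp add: lin_ext_def scal_sum[OF V] scal_scal[OF V])
qed

lemma lin_ext_points: "lin_ext (group_algebra G) point x = x"
proof -
  have "finite S \<Longrightarrow> lookup (\<Sum>g\<in>S. pm_scale (c g) (point g)) h = (if h \<in> S then c h else 0)"
    for S and c :: "'a \<Rightarrow> 'b" and h
    by (induction S rule: finite_induct) (auto simp: lookup_add lookup_single)
  then show ?thesis
    by (intro poly_mapping_eqI) (auto simp: lin_ext_def in_keys_iff)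
qed

lemma spanned_by_points:
  "spanned_by (group_algebra G :: ('k::field, 'a \<Rightarrow>\<^sub>0 'k) hopf) (point ` carrier G)"
proof -
  let ?H = "group_algebra G :: ('k::field, 'a \<Rightarrow>\<^sub>0 'k) hopf"
  let ?L = "lspan ?H (point ` carrier G)"
  have p: "point g \<in> ?L" if "g \<in> carrier G" for g
    using lspan.step[OF imageI[OF that] lspan.zero, of ?H 1 point]
    by (simp only: scal_one[OF vspace_group_algebra] add_0_right)
  have "x \<in> ?L" if "x \<in> carrier ?H" for x
  proof -
    have "lin_ext ?H point x \<in> ?L"
      unfolding lin_ext_def using that
      by (intro lspan_sum lspan_scal vspace_group_algebra p) auto
    then show ?thesis by (simp only: lin_ext_points)
  qed
  then have "carrier ?H \<subseteq> ?L" by (rule subsetI)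
  then show ?thesis by (simp add: spanned_by_def image_subset_iff)
qed

lemma linear_map_lookup:
  "linear_map (group_algebra G) base_space (\<lambda>x. lookup x g)"
  by (rule linear_mapI) (auto simp: lookup_add)

text \<open>The definition forms its tensors over \<open>group_space G\<close>; the congruences
  exchange it for the group algebra itself, which has the same carrier and scalars.\<close>

lemma comul_group_algebra:
  "comul (group_algebra G) = lin_ext (tensor_space (group_algebra G) (group_algebra G))
    (\<lambda>g. tensor (group_algebra G) (group_algebra G) (point g) (point g))"
proof -
  let ?V = "group_space G" and ?H = "group_algebra G"
  have c: "carrier ?V = carrier ?H" "scal ?V = scal ?H" by (simp_all add: group_space_def)
  show ?thesis
    unfolding tensor_space_cong[OF c c, symmetric] tensor_cong[OF c c, symmetric]
    by (rule ext) (simp only: group_algebra_def lin_ext_def Let_def coalg.simps)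
qed

lemma counit_group_algebra: "counit (group_algebra G) = lin_ext base_space (\<lambda>_. 1)"
  by (rule ext) (simp add: group_algebra_def lin_ext_def Let_def)

lemma linear_map_comul_group_algebra:
  "linear_map (group_algebra G) (tensor_space (group_algebra G) (group_algebra G))
    (comul (group_algebra G))"
  unfolding comul_group_algebra
  by (intro linear_map_lin_ext vspace_tensor_space vspace_group_algebra
      tensor_in_space point_in_group_algebra)

lemma linear_map_counit_group_algebra:
  "linear_map (group_algebra G) base_space (counit (group_algebra G))"
  unfolding counit_group_algebra by (rule linear_map_lin_ext[OF vspace_base_space]) simp

lemmas group_algebra_coalgD = vspace_group_algebra linear_map_comul_group_algebra
  linear_map_counit_group_algebra

lemma grouplike_point: "g \<in> carrier G \<Longrightarrow> grouplike (group_algebra G) (point g)"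
  by (simp add: grouplike_def comul_group_algebra counit_group_algebra
      lin_ext_point vspace_base_space vspace_tensor_space vspace_group_algebra)

lemma cocommutative_group_algebra: "cocommutative_coalgebra (group_algebra G)"
  by (rule cocommutative_coalgebra_of_grouplike[OF group_algebra_coalgD spanned_by_points])
    (auto simp: grouplike_point)

text \<open>The coordinate functionals are orthogonal idempotents of the dual algebra. At the point
  of \<open>g\<close> both sides are 1 if \<open>s\<close> and \<open>t\<close> both equal
  \<open>g\<close>, and 0 otherwise.\<close>

lemma sweedler_lookup_group_algebra:
  fixes x :: "'a \<Rightarrow>\<^sub>0 'b::field"
  assumes "x \<in> carrier (group_algebra G)"
  shows "sweedler (group_algebra G) (\<lambda>u v. lookup u s * lookup v t) x =
    (if s = t then lookup x s else 0)"
proof -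
  let ?f = "\<lambda>u v. lookup u s * lookup v t"
  have bil: "bilinear_map (group_algebra G) (group_algebra G) base_space ?f"
    by (rule bilinear_map_mult[OF linear_map_lookup linear_map_lookup])
  have R: "linear_map (group_algebra G) base_space (\<lambda>x. if s = t then lookup x s else 0)"
    by (cases "s = t")
      (simp_all only: refl if_True if_False linear_map_lookup linear_map_const_zero[OF vspace_base_space])
  show ?thesis
  proof (rule linear_map_eq_on_spanning[OF vspace_group_algebra spanned_by_points
        linear_map_sweedler[OF group_algebra_coalgD(1,2) vspace_base_space bil] R _ assms])
    fix b :: "'a \<Rightarrow>\<^sub>0 'b" assume "b \<in> point ` carrier G"
    then obtain g where g: "g \<in> carrier G" "b = point g" by auto
    show "sweedler (group_algebra G) ?f b = (if s = t then lookup b s else 0)"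
      unfolding g(2)
      by (subst sweedler_grouplike[OF vspace_group_algebra vspace_base_space bil grouplike_point[OF g(1)]])
        (simp add: lookup_single when_def)
  qed
qed

text \<open>For a grouplike \<open>x\<close> the orthogonality relation is an equation between
  scalars: distinct coordinates multiply to 0 and each equals its square. Some coordinate is nonzero
  because the counit is 1; so it is 1 and all others vanish.\<close>

lemma grouplike_group_algebraE:
  assumes "grouplike (group_algebra G) x"
  obtains g where "g \<in> carrier G" "x = point g"
proof -
  let ?l = "lookup x"
  have x: "x \<in> carrier (group_algebra G)" and "counit (group_algebra G) x = 1"
    using assms by (auto simp: grouplike_def)
  have "(\<Sum>g\<in>keys x. ?l g) = 1"
    using \<open>counit _ x = 1\<close> by (simp add: counit_group_algebra lin_ext_def)
  then have "keys x \<noteq> {}" by force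
  then obtain g where g: "g \<in> keys x" by blast
  have mult: "?l s * ?l t = (if s = t then ?l s else 0)" for s t
    using sweedler_lookup_group_algebra[OF x, of s t]
      sweedler_grouplike[OF vspace_group_algebra vspace_base_space
        bilinear_map_mult[OF linear_map_lookup linear_map_lookup] assms, of s t] by simp
  have "?l g \<noteq> 0" using g by (simp add: in_keys_iff)
  then have "?l g = 1" using mult[of g g] by simp
  moreover have "?l t = 0" if "t \<noteq> g" for t
    using mult[of g t] that \<open>?l g \<noteq> 0\<close> by simp
  ultimately have "x = point g" by (intro poly_mapping_eqI) (auto simp: lookup_single when_def)
  then show thesis using that x g by auto
qed

lemma linear_map_eq_lin_ext:
  fixes U :: "('k::field, 'u::ab_group_add, 'z) vspace_scheme"
  assumes U: "is_vspace U" and f: "linear_map (group_algebra G) U f"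
    and S: "finite S" "S \<subseteq> carrier G" "keys x \<subseteq> S"
  shows "f x = (\<Sum>s\<in>S. scal U (lookup x s) (f (point s)))"
proof -
  have x: "x \<in> carrier (group_algebra G)" using S by auto
  have f': "linear_map (group_algebra G) U (lin_ext U (\<lambda>s. f (point s)))"
    by (rule linear_map_lin_ext[OF U linear_map_closed[OF f point_in_group_algebra]])
  have "f x = lin_ext U (\<lambda>s. f (point s)) x"
    by (rule linear_map_eq_on_spanning[OF vspace_group_algebra spanned_by_points f f' _ x])
      (auto simp: lin_ext_point[OF U])
  then show ?thesis by (simp only: lin_ext_superset[OF U S(1,3)])
qed

text \<open>The second condition is the comultiplication equation in coordinates, the third the
  counit equation. In the dual algebra they express orthogonality and completeness of the
  coefficient functionals; local finiteness is built into the finitely supported values of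
  \<open>\<chi>\<close>.\<close>

lemma coalgebra_map_group_algebra_iff:
  assumes R: "is_vspace R" "linear_map R (tensor_space R R) (comul R)"
  shows "coalgebra_map R (group_algebra G) \<chi> \<longleftrightarrow>
    linear_map R (group_algebra G) \<chi> \<and>
    (\<forall>r\<in>carrier R. \<forall>s t.
      sweedler R (\<lambda>a b. lookup (\<chi> a) s * lookup (\<chi> b) t) r =
      (if s = t then lookup (\<chi> r) s else 0)) \<and>
    (\<forall>r\<in>carrier R. (\<Sum>g\<in>keys (\<chi> r). lookup (\<chi> r) g) = counit R r)"
    (is "_ \<longleftrightarrow> _ \<and> ?orth \<and> ?sum")
proof (intro iffI conjI)
  assume \<chi>: "coalgebra_map R (group_algebra G) \<chi>"
  note \<chi>' = coalgebra_mapD[OF \<chi>]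
  show "linear_map R (group_algebra G) \<chi>" by (rule \<chi>')
  show ?orth
  proof (intro ballI allI)
    fix r s t assume r: "r \<in> carrier R"
    show "sweedler R (\<lambda>a b. lookup (\<chi> a) s * lookup (\<chi> b) t) r =
      (if s = t then lookup (\<chi> r) s else 0)"
      using sweedler_coalgebra_map[OF R(2) r vspace_group_algebra vspace_base_space \<chi>
          bilinear_map_mult[OF linear_map_lookup linear_map_lookup], of s t]
        sweedler_lookup_group_algebra[OF linear_map_closed[OF \<chi>'(1) r], of s t] by simp
  qed
  show ?sum using \<chi>'(3) by (simp add: counit_group_algebra lin_ext_def)
next
  assume *: "linear_map R (group_algebra G) \<chi> \<and> ?orth \<and> ?sum"
  then have lin: "linear_map R (group_algebra G) \<chi>" and orth: ?orth and sum: ?sum by blast+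
  let ?H = "group_algebra G" and ?l = lookup
  let ?T = "tensor_space ?H ?H"
  have T: "is_vspace ?T" by (rule vspace_tensor_space[OF vspace_group_algebra])
  have "comul ?H (\<chi> r) = sweedler R (\<lambda>a b. tensor ?H ?H (\<chi> a) (\<chi> b)) r" if r: "r \<in> carrier R" for r
  proof -
    let ?ps = "tensor_terms R R (comul R r)"
    have ps: "set ?ps \<subseteq> carrier R \<times> carrier R"
      by (rule tensor_terms(1)[OF linear_map_closed[OF R(2) r]])
    \<comment> \<open>One Sweedler representation of \<open>r\<close> is finite, hence so is the set
      of group elements that \<open>\<chi>\<close> sees on its terms; all tensors can be expanded
      over a single index set.\<close>
    define S where "S = keys (\<chi> r) \<union>
      (\<Union>(a, b)\<in>set ?ps. keys (\<chi> a) \<union> keys (\<chi> b))"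
    have S: "finite S" "keys (\<chi> r) \<subseteq> S" by (auto simp: S_def)
    \<comment> \<open>Intersecting with \<open>carrier G\<close> loses nothing, as the values of
      \<open>\<chi>\<close> are supported there, and makes every index a legitimate basis
      element.\<close>
    define S' where "S' = S \<inter> carrier G"
    have S': "finite S'" "S' \<subseteq> carrier G" using S by (auto simp: S'_def)
    have closed: "keys (\<chi> a) \<subseteq> carrier G" if "a \<in> carrier R" for a
      using linear_map_closed[OF lin that] by simp
    have key: "tensor ?H ?H (\<chi> a) (\<chi> b) =
      (\<Sum>s\<in>S'. \<Sum>t\<in>S'. scal ?T (?l (\<chi> a) s * ?l (\<chi> b) t) (tensor ?H ?H (point s) (point t)))"
      if "(a, b) \<in> set ?ps" for a b
    proof -
      have ab: "a \<in> carrier R" "b \<in> carrier R" using ps that by auto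
      have k: "keys (\<chi> a) \<subseteq> S'" "keys (\<chi> b) \<subseteq> S'"
        using that closed[OF ab(1)] closed[OF ab(2)] unfolding S'_def S_def by blast+
      note expand = linear_map_eq_lin_ext[OF T _ S']
      have "tensor ?H ?H (\<chi> a) (\<chi> b) =
        (\<Sum>s\<in>S'. scal ?T (?l (\<chi> a) s) (tensor ?H ?H (point s) (\<chi> b)))"
        using closed[OF ab(2)] by (intro expand[OF linear_map_tensor_left k(1)]) simp
      also have "\<dots> = (\<Sum>s\<in>S'. scal ?T (?l (\<chi> a) s)
        (\<Sum>t\<in>S'. scal ?T (?l (\<chi> b) t) (tensor ?H ?H (point s) (point t))))"
        using S'(2) by (intro sum.cong refl arg_cong[where f = "scal ?T _"]
            expand[OF linear_map_tensor_right k(2)] point_in_group_algebra) blast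
      finally show ?thesis by (simp only: scal_sum[OF T] scal_scal[OF T])
    qed
    have "sweedler R (\<lambda>a b. tensor ?H ?H (\<chi> a) (\<chi> b)) r = sweedler R (\<lambda>a b.
      \<Sum>s\<in>S'. \<Sum>t\<in>S'. scal ?T (?l (\<chi> a) s * ?l (\<chi> b) t) (tensor ?H ?H (point s) (point t))) r"
      unfolding sweedler_terms by (intro arg_cong[where f = sum_list] map_cong refl) (simp only: key split_paired_all prod.case)
    also have "\<dots> = (\<Sum>s\<in>S'. \<Sum>t\<in>S'.
      scal ?T (if s = t then ?l (\<chi> r) s else 0) (tensor ?H ?H (point s) (point t)))"
      by (simp only: sweedler_sum sweedler_scal_left[OF T] orth[rule_format, OF r])
    also have "\<dots> = (\<Sum>s\<in>S'. \<Sum>t\<in>S'.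
      if s = t then scal ?T (?l (\<chi> r) s) (tensor ?H ?H (point s) (point s)) else 0)"
      by (intro sum.cong refl) (auto simp: scal_zero[OF T] simp del: scal_tensor_space)
    also have "\<dots> = (\<Sum>s\<in>S'. scal ?T (?l (\<chi> r) s) (tensor ?H ?H (point s) (point s)))"
      using S' by (intro sum.cong refl) (simp del: scal_tensor_space)
    also have "\<dots> = comul ?H (\<chi> r)"
      unfolding comul_group_algebra
      by (rule lin_ext_superset[OF T S'(1), symmetric]) (use S(2) closed[OF r] in \<open>simp add: S'_def\<close>)
    finally show ?thesis by simp
  qed
  moreover have "counit ?H (\<chi> r) = counit R r" if r: "r \<in> carrier R" for r
    using sum r by (simp add: counit_group_algebra lin_ext_def)
  ultimately show "coalgebra_map R (group_algebra G) \<chi>"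
    unfolding coalgebra_map_def using lin by blast
qed

section \<open>Slices in a cocommutative coalgebra\<close>

text \<open>The action of the dual algebra of \<open>R\<close> on \<open>R\<close>: the second
  tensor factor of the comultiplication is contracted with \<open>e\<close>.\<close>

definition slice ::
  "('k::field, 'r::ab_group_add, 'z) coalg_scheme \<Rightarrow> ('r \<Rightarrow> 'k) \<Rightarrow> 'r \<Rightarrow> 'r" where
  "slice R e r = sweedler R (\<lambda>a b. scal R (e b) a) r"

text \<open>The multiplication of the dual algebra, with \<open>counit R\<close> as its
  unit.\<close>

definition convol ::
  "('k::field, 'r::ab_group_add, 'z) coalg_scheme \<Rightarrow> ('r \<Rightarrow> 'k) \<Rightarrow> ('r \<Rightarrow> 'k) \<Rightarrow> 'r \<Rightarrow> 'k" where
  "convol R e f r = sweedler R (\<lambda>a b. e a * f b) r"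

locale cocomm_coalgebra =
  fixes R :: "('k::field, 'r::ab_group_add, 'z) coalg_scheme"
  assumes cocomm: "cocommutative_coalgebra R"
begin

lemma coalg: "coalgebra R"
  using cocomm by (simp add: cocommutative_coalgebra_def)

lemmas R = coalgebraD[OF coalg]

abbreviation (input) functional :: "('r \<Rightarrow> 'k) \<Rightarrow> bool" where
  "functional \<equiv> linear_map R base_space"

lemma bilinear_slice:
  assumes "functional e" shows "bilinear_map R R R (\<lambda>a b. scal R (e b) a)"
  by (intro bilinear_mapI linear_map_scal_left linear_map_scal_fun linear_map_ident R assms)

lemma linear_slice: "functional e \<Longrightarrow> linear_map R R (slice R e)"
  unfolding slice_def by (rule linear_map_sweedler[OF R(1,2) R(1) bilinear_slice])

lemmas slice_closed = linear_map_closed[OF linear_slice]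

lemma functional_convol: "functional e \<Longrightarrow> functional f \<Longrightarrow> functional (convol R e f)"
  unfolding convol_def
  by (rule linear_map_sweedler[OF R(1,2) vspace_base_space bilinear_map_mult])

lemma slice_cong: "r \<in> carrier R \<Longrightarrow> (\<And>x. x \<in> carrier R \<Longrightarrow> e x = f x) \<Longrightarrow> slice R e r = slice R f r"
  unfolding slice_def by (rule sweedler_cong[OF R(2)]) auto

lemma slice_zero: "slice R (\<lambda>_. 0) r = 0"
  unfolding slice_def sweedler_terms by (simp add: scal_zero[OF R(1)] case_prod_unfold)

lemma slice_plus: "slice R (\<lambda>x. e x + f x) r = slice R e r + slice R f r"
  unfolding slice_def sweedler_terms
  by (simp add: scal_add_left[OF R(1)] case_prod_unfold sum_list_addf)

lemma slice_scal: "slice R (\<lambda>x. c * e x) r = scal R c (slice R e r)"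
  unfolding slice_def sweedler_terms scal_sum_list[OF R(1)]
  by (simp add: scal_scal[OF R(1)] case_prod_unfold)

text \<open>Under the pairing of \<open>R\<close> with its dual, the operator
  \<open>slice R e\<close> is the transpose of convolution by \<open>e\<close> on the right.\<close>

lemma functional_slice:
  assumes "functional f" "functional e" "r \<in> carrier R"
  shows "f (slice R e r) = convol R f e r"
proof -
  have "f (slice R e r) = sweedler R (\<lambda>a b. f (scal R (e b) a)) r"
    unfolding slice_def
    by (rule sweedler_compose[OF R(2) assms(3) R(1) assms(1)]) (simp add: vspace_scal[OF R(1)])
  also have "\<dots> = convol R f e r"
    unfolding convol_def
    by (rule sweedler_cong[OF R(2) assms(3)]) (simp add: linear_map_scal[OF assms(1)] mult.commute)
  finally show ?thesis .
qed

lemma convol_commute: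
  assumes "functional e" "functional f" "r \<in> carrier R"
  shows "convol R e f r = convol R f e r"
  using sweedler_commute[OF cocomm vspace_base_space assms(3) bilinear_map_mult[OF assms(1,2)]]
  by (simp add: convol_def mult.commute)

text \<open>The counit is the unit of the dual algebra, so convolving it with \<open>e\<close>
  returns \<open>e\<close>. This recovers a functional from its operator.\<close>

lemma counit_slice:
  assumes e: "functional e" and r: "r \<in> carrier R"
  shows "counit R (slice R e r) = e r"
  using functional_slice[OF R(3) e r] sweedler_counit_left[OF coalg r e] by (simp add: convol_def)

lemma slice_counit: "r \<in> carrier R \<Longrightarrow> slice R (counit R) r = r"
  unfolding slice_def using sweedler_counit_right[OF coalg _ linear_map_ident] .

text \<open>The module law for the action of the dual algebra. Coassociativity moves the second
  splitting from the left to the right factor, where the two functionals combine into their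
  convolution.\<close>

lemma slice_slice:
  assumes e: "functional e" and f: "functional f" and r: "r \<in> carrier R"
  shows "slice R e (slice R f r) = slice R (convol R e f) r"
proof -
  have "slice R e (slice R f r) = sweedler R (\<lambda>a b. slice R e (scal R (f b) a)) r"
    unfolding slice_def[of R f]
    by (rule sweedler_compose[OF R(2) r R(1) linear_slice[OF e]]) (simp add: vspace_scal[OF R(1)])
  also have "\<dots> = sweedler R (\<lambda>a b. sweedler R (\<lambda>a1 a2. scal R (f b) (scal R (e a2) a1)) a) r"
  proof (rule sweedler_cong[OF R(2) r])
    fix a b assume ab: "a \<in> carrier R" "b \<in> carrier R"
    show "slice R e (scal R (f b) a) = sweedler R (\<lambda>a1 a2. scal R (f b) (scal R (e a2) a1)) a"
      unfolding linear_map_scal[OF linear_slice[OF e] ab(1)] unfolding slice_def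
      by (rule sweedler_compose[OF R(2) ab(1) R(1)
            linear_map_scal_fun[OF R(1) linear_map_ident]]) (simp add: vspace_scal[OF R(1)])
  qed
  also have "\<dots> = sweedler R (\<lambda>a b. sweedler R (\<lambda>b1 b2. scal R (f b2) (scal R (e b1) a)) b) r"
    by (rule sweedler_assoc[OF coalg R(1) r, symmetric])
      (intro bilinear_mapI linear_map_scal_left linear_map_scal_fun linear_map_ident e f R
        vspace_scal[OF R(1)]; assumption)+
  also have "\<dots> = slice R (convol R e f) r"
    unfolding slice_def convol_def
    by (simp add: sweedler_scal_left[OF R(1), symmetric] scal_scal[OF R(1)] mult.commute)
  finally show ?thesis .
qed

text \<open>Cocommutativity makes the dual algebra commutative, and with it the operators by which
  it acts.\<close>

lemma slice_commute:
  assumes e: "functional e" and f: "functional f" and r: "r \<in> carrier R"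
  shows "slice R e (slice R f r) = slice R f (slice R e r)"
  unfolding slice_slice[OF e f r] slice_slice[OF f e r]
  by (rule slice_cong[OF r]) (rule convol_commute[OF e f])

section \<open>Finite-dimensional orbits of the dual algebra\<close>

text \<open>The cyclic submodule generated by \<open>r\<close> under the dual algebra; its dimension
  is the measure of the induction that splits \<open>r\<close> into joint eigenvectors.\<close>

definition slices :: "'r \<Rightarrow> 'r set" where
  "slices r = {slice R e r | e. functional e}"

lemma self_in_slices: "r \<in> carrier R \<Longrightarrow> r \<in> slices r"
  unfolding slices_def using slice_counit[of r] R(3) by force

lemma slices_slice_subset:
  assumes "functional e" "r \<in> carrier R"
  shows "slices (slice R e r) \<subseteq> slices r"
  unfolding slices_def using slice_slice[OF _ assms] functional_convol[OF _ assms(1)] by auto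

sublocale vector_space "scal R"
  using R(1) by (simp add: is_vspace_def)

lemma subspace_slices: "subspace (slices r)"
proof (rule subspaceI)
  show "0 \<in> slices r"
    unfolding slices_def using slice_zero[of r] linear_map_const_zero[OF vspace_base_space] by force
  show "x + y \<in> slices r" if "x \<in> slices r" "y \<in> slices r" for x y
  proof -
    from that obtain e f where "functional e" "functional f" "x = slice R e r" "y = slice R f r"
      unfolding slices_def by blast
    then show ?thesis
      unfolding slices_def slice_plus[symmetric]
      by (intro CollectI exI[of _ "\<lambda>x. e x + f x"] conjI)
        (auto simp: slice_plus intro: linear_map_plus[OF vspace_base_space])
  qed
  show "scal R c x \<in> slices r" if x: "x \<in> slices r" for c x
  proof -
    from x obtain e where "functional e" "x = slice R e r" unfolding slices_def by blast
    then show ?thesis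
      unfolding slices_def
      by (intro CollectI exI[of _ "\<lambda>x. c * e x"] conjI) (auto simp: slice_scal intro: linear_map_mult_left)
  qed
qed

text \<open>Every slice is a combination of the left factors in one fixed representation of
  \<open>comul R r\<close>; only the coefficients depend on the functional. This is the local
  finiteness of coalgebras.\<close>

lemma slices_finite_span: "\<exists>T. finite T \<and> slices r \<subseteq> span T"
proof (intro exI conjI)
  let ?T = "fst ` set (tensor_terms R R (comul R r))"
  show "finite ?T" by simp
  have "(\<Sum>(a, b)\<leftarrow>ps. scal R (e b) a) \<in> span ?T"
    if "set ps \<subseteq> set (tensor_terms R R (comul R r))" for e ps
    using that
  proof (induction ps)
    case (Cons p ps)
    then have "fst p \<in> span ?T" by (intro span_base imageI) auto
    then show ?case using Cons by (auto simp: case_prod_unfold intro!: span_add span_scale)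
  qed (simp add: span_zero)
  then show "slices r \<subseteq> span ?T"
    unfolding slices_def slice_def sweedler_terms by blast
qed

text \<open>A basis of the smaller space stays independent when \<open>x\<close> is added. The
  larger space has a finite basis by \<open>slices_finite_span\<close>; otherwise
  \<open>dim\<close>, a cardinality, would carry no information.\<close>

lemma dim_slices_less:
  assumes sub: "slices s \<subseteq> slices r" and x: "x \<in> slices r" "x \<notin> slices s"
  shows "dim (slices s) < dim (slices r)"
proof -
  obtain B' where B': "B' \<subseteq> slices s" "independent B'" "slices s \<subseteq> span B'" "card B' = dim (slices s)"
    by (rule basis_exists)
  obtain B where B: "B \<subseteq> slices r" "independent B" "slices r \<subseteq> span B" "card B = dim (slices r)"
    by (rule basis_exists)
  obtain T where T: "finite T" "slices r \<subseteq> span T" using slices_finite_span by blast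
  have "finite B" using independent_span_bound[OF T(1) B(2)] B(1) T(2) by auto
  have "x \<notin> span B'" using span_minimal[OF B'(1) subspace_slices] x(2) by blast
  then have "independent (insert x B')" "x \<notin> B'" using B'(2) span_base by (auto simp: independent_insert)
  moreover have "insert x B' \<subseteq> span B" using B'(1) sub x(1) B(3) by blast
  ultimately have "finite (insert x B')" "card (insert x B') \<le> card B"
    using independent_span_bound[OF \<open>finite B\<close>, of "insert x B'"] by auto
  then show ?thesis using \<open>x \<notin> B'\<close> B(4) B'(4) by simp
qed

text \<open>The coordinate functionals of \<open>\<chi>\<close> add up to the counit, whose slice of
  \<open>r\<close> is \<open>r\<close>. The sum is finite because only the right factors of one
  representation of \<open>comul R r\<close> matter. The lemma serves both the given maps and,
  later, the constructed map \<open>\<phi>\<close>.\<close>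

lemma slice_sum_decomposition:
  assumes \<chi>: "linear_map R (group_algebra G) \<chi>"
    and sum: "\<And>r. r \<in> carrier R \<Longrightarrow>
      (\<Sum>g\<in>keys (\<chi> r). lookup (\<chi> r) g) = counit R r"
    and r: "r \<in> carrier R"
  obtains T where "finite T" "T \<subseteq> carrier G"
    "\<And>s. s \<notin> T \<Longrightarrow> slice R (\<lambda>x. lookup (\<chi> x) s) r = 0"
    "r = (\<Sum>s\<in>T. slice R (\<lambda>x. lookup (\<chi> x) s) r)"
proof
  let ?ps = "tensor_terms R R (comul R r)"
  let ?T = "\<Union>(a, b)\<in>set ?ps. keys (\<chi> b)"
  have ps: "set ?ps \<subseteq> carrier R \<times> carrier R"
    by (rule tensor_terms(1)[OF linear_map_closed[OF R(2) r]])
  show T: "finite ?T" by auto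
  show "?T \<subseteq> carrier G" using linear_map_closed[OF \<chi>] ps by fastforce
  show "slice R (\<lambda>x. lookup (\<chi> x) s) r = 0" if "s \<notin> ?T" for s
  proof -
    have "map (\<lambda>(a, b). scal R (lookup (\<chi> b) s) a) ?ps = map (\<lambda>_. 0) ?ps"
      using that by (intro map_cong refl) (auto simp: in_keys_iff scal_zero[OF R(1)])
    then show ?thesis unfolding slice_def sweedler_terms by (simp only: sum_list_0)
  qed
  have "(\<Sum>s\<in>?T. slice R (\<lambda>x. lookup (\<chi> x) s) r) =
    sweedler R (\<lambda>a b. \<Sum>s\<in>?T. scal R (lookup (\<chi> b) s) a) r"
    by (simp only: slice_def sweedler_sum)
  also have "\<dots> = slice R (counit R) r"
    unfolding slice_def sweedler_terms
  proof (intro arg_cong[where f = sum_list] map_cong refl, clarify)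
    fix a b assume ab: "(a, b) \<in> set ?ps"
    have "(\<Sum>s\<in>?T. lookup (\<chi> b) s) = (\<Sum>g\<in>keys (\<chi> b). lookup (\<chi> b) g)"
      by (rule sum.mono_neutral_right[OF T]) (use ab in \<open>auto simp: in_keys_iff\<close>)
    also have "\<dots> = counit R b" using sum ab ps by blast
    finally show "(\<Sum>s\<in>?T. scal R (lookup (\<chi> b) s) a) = scal R (counit R b) a"
      by (simp add: scal_sum_left[OF R(1), symmetric])
  qed
  finally show "r = (\<Sum>s\<in>?T. slice R (\<lambda>x. lookup (\<chi> x) s) r)"
    by (simp add: slice_counit[OF r])
qed

end

section \<open>Families of coalgebra maps into a group algebra\<close>

text \<open>The map of group algebras induced by the projection of the power to its factor at
  \<open>q\<close>.\<close>

definition point_eval ::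
  "('a, 'm) monoid_scheme \<Rightarrow> 'q \<Rightarrow> (('q \<Rightarrow> 'a) \<Rightarrow>\<^sub>0 'k::field) \<Rightarrow> ('a \<Rightarrow>\<^sub>0 'k)" where
  "point_eval A q = lin_ext (group_algebra A) (\<lambda>f. point (f q))"

lemma linear_point_eval:
  "q \<in> I \<Longrightarrow> linear_map (group_algebra (product_group I (\<lambda>_. A))) (group_algebra A) (point_eval A q)"
  unfolding point_eval_def by (rule linear_map_lin_ext[OF vspace_group_algebra]) auto

lemma point_eval_point: "point_eval A q (point f) = point (f q)"
  unfolding point_eval_def by (rule lin_ext_point[OF vspace_group_algebra])

text \<open>With \<open>I\<close> the carrier of \<open>Q\<close>, the map \<open>\<chi> q\<close>
  will be the restriction of a map on R \<otimes> kQ to the slot of \<open>q\<close>. The locale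
  produces the only coalgebra map \<open>\<phi>\<close> into the group algebra of the power whose
  composite with each \<open>point_eval A q\<close> is \<open>\<chi> q\<close>.\<close>

locale coalgebra_map_family = cocomm_coalgebra R
  for R :: "('k::field, 'r::ab_group_add, 'z) coalg_scheme" +
  fixes I :: "'q set" and A :: "('a, 'm) monoid_scheme" and \<chi> :: "'q \<Rightarrow> 'r \<Rightarrow> ('a \<Rightarrow>\<^sub>0 'k)"
  assumes \<chi>: "q \<in> I \<Longrightarrow> coalgebra_map R (group_algebra A) (\<chi> q)"
begin

abbreviation (input) F :: "('q \<Rightarrow> 'a) set" where
  "F \<equiv> I \<rightarrow>\<^sub>E carrier A"

abbreviation (input) P :: "('q \<Rightarrow> 'a) monoid" where
  "P \<equiv> product_group I (\<lambda>_. A)"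

definition e :: "'q \<Rightarrow> 'a \<Rightarrow> 'r \<Rightarrow> 'k" where
  "e q s r = lookup (\<chi> q r) s"

lemma functional_e: "q \<in> I \<Longrightarrow> functional (e q s)"
  unfolding e_def using linear_map_compose[OF coalgebra_mapD(1)[OF \<chi>] linear_map_lookup] .

lemma convol_e:
  assumes "q \<in> I" "r \<in> carrier R"
  shows "convol R (e q s) (e q t) r = (if s = t then e q s r else 0)"
  using \<chi>[OF assms(1)] assms(2)
  unfolding coalgebra_map_group_algebra_iff[OF R(1,2)] convol_def e_def by blast

lemma slice_e_slice_e:
  assumes "q \<in> I" "r \<in> carrier R"
  shows "slice R (e q s) (slice R (e q t) r) = (if s = t then slice R (e q s) r else 0)"
proof -
  have "slice R (e q s) (slice R (e q t) r) = slice R (\<lambda>x. if s = t then e q s x else 0) r"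
    unfolding slice_slice[OF functional_e functional_e assms(2), OF assms(1) assms(1)]
    by (rule slice_cong[OF assms(2) convol_e[OF assms(1)]])
  then show ?thesis by (simp add: slice_zero)
qed

text \<open>A joint eigenspace of the commuting idempotent operators \<open>slice R (e q s)\<close>.\<close>

definition joint :: "('q \<Rightarrow> 'a) \<Rightarrow> 'r set" where
  "joint f = {r \<in> carrier R. \<forall>q\<in>I. slice R (e q (f q)) r = r}"

text \<open>The vector \<open>r\<close> is its own image under the idempotent for
  \<open>f q\<close>, which is orthogonal to the one for any other \<open>s\<close>.\<close>

lemma slice_joint:
  assumes "q \<in> I" "r \<in> joint f"
  shows "slice R (e q s) r = (if s = f q then r else 0)"
  using slice_e_slice_e[OF assms(1), of r s "f q"] assms by (auto simp: joint_def)

lemma e_joint: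
  assumes "q \<in> I" "r \<in> joint f"
  shows "e q s r = (if s = f q then counit R r else 0)"
proof -
  have "e q s r = counit R (slice R (e q s) r)"
    using counit_slice[OF functional_e] assms by (simp add: joint_def)
  then show ?thesis by (simp add: slice_joint[OF assms] linear_map_zero[OF R(1) R(3)])
qed

text \<open>If some operator moves \<open>r\<close>, then \<open>r\<close> splits into pieces whose spaces of slices
  have smaller dimension.\<close>

lemma lspan_joint:
  assumes "r \<in> carrier R" shows "r \<in> lspan R (\<Union>f\<in>F. joint f)"
  using assms
proof (induction "dim (slices r)" arbitrary: r rule: less_induct)
  case less
  note r = less.prems
  let ?L = "lspan R (\<Union>f\<in>F. joint f)"
  have dec: "\<exists>T. finite T \<and> T \<subseteq> carrier A \<and> r = (\<Sum>s\<in>T. slice R (e q s) r)" if "q \<in> I" for q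
  proof -
    have l: "linear_map R (group_algebra A) (\<chi> q)"
      and sum: "\<And>r. r \<in> carrier R \<Longrightarrow>
        (\<Sum>g\<in>keys (\<chi> q r). lookup (\<chi> q r) g) = counit R r"
      using \<chi>[OF that] unfolding coalgebra_map_group_algebra_iff[OF R(1,2)] by blast+
    have e: "e q s = (\<lambda>x. lookup (\<chi> q x) s)" for s by (simp add: e_def fun_eq_iff)
    show ?thesis
      unfolding e by (rule slice_sum_decomposition[OF l sum r]) (assumption, intro exI conjI)
  qed
  show ?case
  \<comment> \<open>Either every index has an idempotent that fixes \<open>r\<close>, and then
    \<open>f\<close> chooses one at all indices at once, or a single index suffices to split
    \<open>r\<close>.\<close>
  proof (cases "\<forall>q\<in>I. \<exists>s\<in>carrier A. slice R (e q s) r = r")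
    case True
    then obtain f where f: "\<And>q. q \<in> I \<Longrightarrow> f q \<in> carrier A \<and> slice R (e q (f q)) r = r" by metis
    have "restrict f I \<in> F" "r \<in> joint (restrict f I)" using f r by (auto simp: joint_def)
    then have "r \<in> (\<Union>f\<in>F. joint f)" by blast
    from lspan.step[OF this lspan.zero, of R 1] show ?thesis by (simp add: scal_one[OF R(1)])
  next
    case False
    then obtain q where q: "q \<in> I" and ne: "\<And>s. s \<in> carrier A \<Longrightarrow> slice R (e q s) r \<noteq> r" by blast
    have "slice R (e q s) r \<in> ?L" if s: "s \<in> carrier A" for s
    proof (rule less.hyps)
      have sub: "slices (slice R (e q s) r) \<subseteq> slices r"
        by (rule slices_slice_subset[OF functional_e[OF q] r])
      \<comment> \<open>Were \<open>r\<close> a slice of its own piece, the idempotent of that piece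
        would commute past the slicing and fix \<open>r\<close>, contrary to the choice of
        \<open>q\<close>.\<close>
      have "r \<notin> slices (slice R (e q s) r)"
      proof
        assume "r \<in> slices (slice R (e q s) r)"
        then obtain e' where e': "functional e'" "r = slice R e' (slice R (e q s) r)"
          unfolding slices_def by blast
        note es = functional_e[OF q]
        have "slice R (e q s) r = slice R (e q s) (slice R e' (slice R (e q s) r))"
          using e'(2) by simp
        also have "\<dots> = slice R e' (slice R (e q s) (slice R (e q s) r))"
          by (rule slice_commute[OF es e'(1) slice_closed[OF es r]])
        also have "\<dots> = r" using slice_e_slice_e[OF q r, of s s] e'(2) by simp
        finally show False using ne[OF s] by simp
      qed
      then show "dim (slices (slice R (e q s) r)) < dim (slices r)"
        using dim_slices_less[OF sub self_in_slices[OF r]] by blast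
      show "slice R (e q s) r \<in> carrier R" by (rule slice_closed[OF functional_e[OF q] r])
    qed
    moreover obtain T where "T \<subseteq> carrier A" "r = (\<Sum>s\<in>T. slice R (e q s) r)"
      using dec[OF q] by blast
    ultimately show ?thesis using lspan_sum[of T "\<lambda>s. slice R (e q s) r" R] by (metis subsetD)
  qed
qed

lemma spanned_by_joint: "spanned_by R (\<Union>f\<in>F. joint f)"
  using lspan_joint by (auto simp: spanned_by_def joint_def)

lemma subspace_joint: "subspace (joint f)"
  by (rule subspaceI)
    (auto simp: joint_def vspace_zero[OF R(1)] vspace_add[OF R(1)] vspace_scal[OF R(1)]
      linear_map_zero[OF R(1) linear_slice[OF functional_e]]
      linear_map_add[OF linear_slice[OF functional_e]]
      linear_map_scal[OF linear_slice[OF functional_e]])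

text \<open>Two distinct labels differ at some \<open>q\<close>, and an idempotent at that
  \<open>q\<close> fixes the term of one label while annihilating that of the other. Applied to the
  vanishing sum it removes the term \<open>z g\<close> and leaves a shorter sum.\<close>

lemma joint_independent:
  assumes "finite K" "K \<subseteq> F" "\<And>f. f \<in> K \<Longrightarrow> z f \<in> joint f" "(\<Sum>f\<in>K. z f) = 0" "f \<in> K"
  shows "z f = 0"
  using assms
proof (induction K arbitrary: z f rule: finite_induct)
  case (insert g K)
  have K0: "z h = 0" if h: "h \<in> K" for h
  proof -
    have "h \<noteq> g" "h \<in> F" "g \<in> F" using h insert by auto
    then obtain q where q: "q \<in> I" "h q \<noteq> g q" using PiE_ext[of h I "\<lambda>_. carrier A" g] by blast
    let ?p = "slice R (e q (h q))"
    \<comment> \<open>Besides \<open>z g\<close> the idempotent may drop further terms;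
      \<open>z'\<close> records what survives, which is why the induction runs over all families
      \<open>z\<close>. At \<open>h\<close> nothing is lost.\<close>
    define z' where "z' k = (if k q = h q then z k else 0)" for k
    have p: "?p (z k) = z' k" if "k \<in> insert g K" for k
      using slice_joint[OF q(1) insert.prems(2)[OF that]] by (auto simp: z'_def)
    have zR: "z k \<in> carrier R" if "k \<in> insert g K" for k
      using insert.prems(2)[OF that] by (simp add: joint_def)
    have "0 = ?p (\<Sum>k\<in>insert g K. z k)"
      using insert.prems(3) linear_map_zero[OF R(1) linear_slice[OF functional_e[OF q(1)]]] by simp
    also have "\<dots> = (\<Sum>k\<in>insert g K. ?p (z k))"
      by (rule linear_map_sum[OF R(1) linear_slice[OF functional_e[OF q(1)]] zR])
    also have "\<dots> = (\<Sum>k\<in>insert g K. z' k)" using p by (rule sum.cong[OF refl])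
    also have "\<dots> = (\<Sum>k\<in>K. z' k)" using insert.hyps q(2) by (simp add: z'_def)
    finally have "(\<Sum>k\<in>K. z' k) = 0" by simp
    moreover have "z' k \<in> joint k" if "k \<in> K" for k
      using insert.prems(2)[of k] that subspace_0[OF subspace_joint] by (simp add: z'_def)
    ultimately have "z' h = 0" using insert.IH insert.prems(1) h by blast
    then show ?thesis by (simp add: z'_def)
  qed
  then have "z g = 0" using insert.prems(3) insert.hyps by simp
  then show ?case using K0 insert.prems(4) by blast
qed simp

section \<open>Decomposition into joint eigenvectors\<close>

definition total :: "(('q \<Rightarrow> 'a) \<Rightarrow>\<^sub>0 'r) \<Rightarrow> 'r" where
  "total z = (\<Sum>f\<in>keys z. lookup z f)"

text \<open>Storing a decomposition as a finitely supported function with vectors as coefficients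
  provides addition and extensional equality of decompositions.\<close>

definition decomposition :: "(('q \<Rightarrow> 'a) \<Rightarrow>\<^sub>0 'r) \<Rightarrow> bool" where
  "decomposition z \<longleftrightarrow> keys z \<subseteq> F \<and> (\<forall>f. lookup z f \<in> joint f)"

lemma total_superset:
  "finite K \<Longrightarrow> keys z \<subseteq> K \<Longrightarrow> total z = (\<Sum>f\<in>K. lookup z f)"
  unfolding total_def by (rule sum.mono_neutral_left) (auto simp: in_keys_iff)

lemma total_plus: "total (y + z) = total y + total z"
  using total_superset[of "keys y \<union> keys z"] keys_add[of y z]
  by (simp add: lookup_add sum.distrib)

lemma decomposition_plus: "decomposition y \<Longrightarrow> decomposition z \<Longrightarrow> decomposition (y + z)"
  using keys_add[of y z] subspace_add[OF subspace_joint]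
  unfolding decomposition_def lookup_add by (meson order_trans Un_least)

lemma decomposition_exists:
  assumes "r \<in> carrier R" obtains z where "decomposition z" "total z = r"
proof -
  have "\<exists>z. decomposition z \<and> total z = r" if "r \<in> lspan R (\<Union>f\<in>F. joint f)" for r
    using that
  proof induction
    case zero
    show ?case
      by (rule exI[of _ 0]) (simp add: decomposition_def total_def subspace_0[OF subspace_joint])
  next
    case (step b x c)
    then obtain z f where z: "decomposition z" "total z = x" and f: "f \<in> F" "b \<in> joint f" by blast
    let ?y = "Poly_Mapping.single f (scal R c b)"
    have "decomposition ?y"
      using f subspace_scale[OF subspace_joint] subspace_0[OF subspace_joint]
      by (simp add: decomposition_def lookup_single when_def)
    moreover have "total ?y = scal R c b"
      using total_superset[of "{f}" ?y] by simp
    ultimately show ?case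
      using z by (intro exI[of _ "?y + z"]) (simp add: decomposition_plus total_plus)
  qed
  then show thesis using lspan_joint[OF assms] that by blast
qed

text \<open>The differences of corresponding components are joint eigenvectors with sum 0, so
  \<open>joint_independent\<close> applies over the union of the supports.\<close>

lemma decomposition_unique:
  assumes y: "decomposition y" and z: "decomposition z" and eq: "total y = total z"
  shows "y = z"
proof (rule poly_mapping_eqI)
  fix f
  let ?K = "keys y \<union> keys z"
  let ?d = "\<lambda>f. lookup y f - lookup z f"
  have "(\<Sum>f\<in>?K. ?d f) = 0"
    using eq total_superset[of ?K y] total_superset[of ?K z] by (simp add: sum_subtractf)
  moreover have "?d f \<in> joint f" for f
    using y z subspace_diff[OF subspace_joint] by (simp add: decomposition_def)
  moreover have "?K \<subseteq> F" using y z by (simp add: decomposition_def)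
  ultimately have "?d f = 0" if "f \<in> ?K"
    using joint_independent[of ?K ?d f] that by simp
  then show "lookup y f = lookup z f"
    by (cases "f \<in> ?K") (auto simp: in_keys_iff)
qed

definition decompose :: "'r \<Rightarrow> (('q \<Rightarrow> 'a) \<Rightarrow>\<^sub>0 'r)" where
  "decompose r = (SOME z. decomposition z \<and> total z = r)"

lemma decompose: "r \<in> carrier R \<Longrightarrow> decomposition (decompose r)"
  "r \<in> carrier R \<Longrightarrow> total (decompose r) = r"
  unfolding decompose_def using someI_ex[of "\<lambda>z. decomposition z \<and> total z = r"]
  by (metis decomposition_exists)+

lemma decompose_eqI: "decomposition z \<Longrightarrow> total z = r \<Longrightarrow> r \<in> carrier R \<Longrightarrow> decompose r = z"
  using decomposition_unique decompose by metis

section \<open>The induced coalgebra map into the group algebra of the power\<close>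

text \<open>A vector \<open>r\<close> of \<open>joint f\<close> has to go to
  \<open>counit R r\<close> times the point of \<open>f\<close>: the idempotents leave only this
  coefficient, and the counit is to be preserved. The definition applies this to all components at
  once.\<close>

definition \<phi> :: "'r \<Rightarrow> (('q \<Rightarrow> 'a) \<Rightarrow>\<^sub>0 'k)" where
  "\<phi> r = Poly_Mapping.map (counit R) (decompose r)"

lemma lookup_map_counit:
  "lookup (Poly_Mapping.map (counit R) z) f = counit R (lookup z f)"
  using linear_map_zero[OF R(1) R(3)] by (simp add: map.rep_eq when_def)

lemma \<phi>_joint:
  assumes "f \<in> F" "r \<in> joint f"
  shows "\<phi> r = pm_scale (counit R r) (point f)"
proof -
  have "decompose r = Poly_Mapping.single f r"
  proof (rule decompose_eqI)
    show "decomposition (Poly_Mapping.single f r)"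
      using assms subspace_0[OF subspace_joint]
      by (simp add: decomposition_def lookup_single when_def)
    show "total (Poly_Mapping.single f r) = r"
      using total_superset[of "{f}" "Poly_Mapping.single f r"] by simp
  qed (use assms in \<open>simp add: joint_def\<close>)
  then show ?thesis
    by (intro poly_mapping_eqI)
      (simp add: \<phi>_def lookup_map_counit lookup_single when_def linear_map_zero[OF R(1) R(3)])
qed

text \<open>Uniqueness makes \<open>decompose\<close> additive and homogeneous, since sums and
  multiples of decompositions are decompositions; the counit is linear.\<close>

lemma linear_\<phi>: "linear_map R (group_algebra P) \<phi>"
proof (rule linear_mapI)
  show "\<phi> r \<in> carrier (group_algebra P)" if "r \<in> carrier R" for r
  proof -
    have "keys (\<phi> r) \<subseteq> keys (decompose r)"
      using linear_map_zero[OF R(1) R(3)] by (auto simp: \<phi>_def in_keys_iff lookup_map_counit)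
    also have "\<dots> \<subseteq> F" using decompose(1)[OF that] by (simp add: decomposition_def)
    finally show ?thesis by simp
  qed
next
  fix x y assume xy: "x \<in> carrier R" "y \<in> carrier R"
  have "decompose (x + y) = decompose x + decompose y"
    by (rule decompose_eqI) (simp_all add: decomposition_plus total_plus decompose xy vspace_add[OF R(1)])
  moreover have "lookup (decompose r) f \<in> carrier R" if "r \<in> carrier R" for r f
    using decompose(1)[OF that] by (simp add: decomposition_def joint_def)
  ultimately show "\<phi> (x + y) = \<phi> x + \<phi> y"
    by (intro poly_mapping_eqI)
      (simp add: \<phi>_def lookup_map_counit lookup_add linear_map_add[OF R(3)] xy)
next
  fix c x assume x: "x \<in> carrier R"
  let ?z = "Poly_Mapping.map (scal R c) (decompose x)"
  have l: "lookup ?z f = scal R c (lookup (decompose x) f)" for f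
    by (simp add: map.rep_eq when_def)
  have k: "keys ?z \<subseteq> keys (decompose x)"
    by (auto simp: in_keys_iff l)
  have "total ?z = scal R c (total (decompose x))"
    unfolding total_superset[OF finite_keys k] l by (simp add: total_def scale_sum_right)
  moreover have "decomposition ?z"
    using decompose(1)[OF x] k subspace_scale[OF subspace_joint] by (auto simp: decomposition_def l)
  ultimately have "decompose (scal R c x) = ?z"
    by (intro decompose_eqI) (simp_all add: decompose x vspace_scal[OF R(1)])
  moreover have "lookup (decompose x) f \<in> carrier R" for f
    using decompose(1)[OF x] by (simp add: decomposition_def joint_def)
  ultimately show "\<phi> (scal R c x) = scal (group_algebra P) c (\<phi> x)"
    by (intro poly_mapping_eqI) (simp add: \<phi>_def lookup_map_counit l linear_map_scal[OF R(3)])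
qed

lemmas eq_on_joint = linear_map_eq_on_spanning[OF R(1) spanned_by_joint]

text \<open>The coordinates of \<open>\<phi>\<close>. In the dual algebra
  \<open>\<epsilon> f\<close> takes the place of the product of all \<open>e q (f q)\<close>, which
  is no finite expression for infinite \<open>I\<close>.\<close>

definition \<epsilon> :: "('q \<Rightarrow> 'a) \<Rightarrow> 'r \<Rightarrow> 'k" where
  "\<epsilon> f r = lookup (\<phi> r) f"

lemma functional_\<epsilon>: "functional (\<epsilon> f)"
  unfolding \<epsilon>_def by (rule linear_map_compose[OF linear_\<phi> linear_map_lookup])

lemma \<epsilon>_joint: "f \<in> F \<Longrightarrow> r \<in> joint f \<Longrightarrow> \<epsilon> g r = (if g = f then counit R r else 0)"
  by (simp add: \<epsilon>_def \<phi>_joint lookup_single when_def)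

lemma sum_\<phi>:
  assumes r: "r \<in> carrier R"
  shows "(\<Sum>g\<in>keys (\<phi> r). lookup (\<phi> r) g) = counit R r"
proof -
  have "counit (group_algebra P) (\<phi> r) = counit R r"
  proof (rule eq_on_joint[OF linear_map_compose[OF linear_\<phi> linear_map_counit_group_algebra] R(3) _ r])
    fix b assume "b \<in> (\<Union>f\<in>F. joint f)"
    then obtain f where f: "f \<in> F" "b \<in> joint f" by blast
    then have "grouplike (group_algebra P :: ('k, _) hopf) (point f)" by (simp add: grouplike_point)
    then show "counit (group_algebra P) (\<phi> b) = counit R b"
      using linear_map_scal[OF linear_map_counit_group_algebra, of "point f" P "counit R b"] f
      by (simp add: \<phi>_joint[OF f] grouplike_def)
  qed
  then show ?thesis by (simp add: counit_group_algebra lin_ext_def)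
qed

text \<open>The operator of \<open>\<epsilon> g\<close> is the projection to \<open>joint g\<close>.
  If \<open>g\<close> and \<open>f\<close> differ at \<open>q\<close>, the convolution of
  \<open>\<epsilon> g\<close> with \<open>e q (f q)\<close> is 0 while \<open>e q (f q)\<close>
  fixes \<open>r\<close>. For \<open>g = f\<close> the slices of \<open>r\<close> under all
  \<open>\<epsilon> s\<close> add up to \<open>r\<close>, and only one of them is left.\<close>

lemma slice_\<epsilon>_joint:
  assumes f: "f \<in> F" "r \<in> joint f" and g: "g \<in> F"
  shows "slice R (\<epsilon> g) r = (if g = f then r else 0)"
proof -
  have r: "r \<in> carrier R" using f by (simp add: joint_def)
  have ne: "slice R (\<epsilon> g) r = 0" if g: "g \<in> F" "g \<noteq> f" for g
  proof -
    obtain q where q: "q \<in> I" "f q \<noteq> g q" using PiE_ext[of f I "\<lambda>_. carrier A" g] f g by blast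
    note eq = functional_e[OF q(1), of "f q"]
    \<comment> \<open>On an eigenvector with label \<open>h\<close> either \<open>e q (f q)\<close>
      gives 0, or \<open>h q = f q\<close> differs from \<open>g q\<close> and
      \<open>\<epsilon> g\<close> gives 0.\<close>
    have 0: "convol R (\<epsilon> g) (e q (f q)) x = 0" if x: "x \<in> carrier R" for x
    proof (rule eq_on_joint[OF functional_convol[OF functional_\<epsilon> eq]
          linear_map_const_zero[OF vspace_base_space] _ x])
      fix b assume "b \<in> (\<Union>f\<in>F. joint f)"
      then obtain h where h: "h \<in> F" "b \<in> joint h" by blast
      then have b: "b \<in> carrier R" by (simp add: joint_def)
      have "convol R (\<epsilon> g) (e q (f q)) b = \<epsilon> g (slice R (e q (f q)) b)"
        by (rule functional_slice[OF functional_\<epsilon> eq b, symmetric])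
      also have "\<dots> = 0"
        using q(2) by (auto simp: slice_joint[OF q(1) h(2)] \<epsilon>_joint[OF h]
            linear_map_zero[OF R(1) functional_\<epsilon>])
      finally show "convol R (\<epsilon> g) (e q (f q)) b = 0" .
    qed
    have "slice R (\<epsilon> g) r = slice R (\<epsilon> g) (slice R (e q (f q)) r)"
      using slice_joint[OF q(1) f(2)] by simp
    also have "\<dots> = slice R (\<lambda>_. 0) r"
      unfolding slice_slice[OF functional_\<epsilon> eq r] by (rule slice_cong[OF r 0])
    finally show ?thesis by (simp add: slice_zero)
  qed
  show ?thesis
  proof (cases "g = f")
    case True
    have \<epsilon>: "(\<lambda>x. lookup (\<phi> x) s) = \<epsilon> s" for s by (simp add: \<epsilon>_def fun_eq_iff)
    obtain T where T: "finite T" "T \<subseteq> carrier P" "\<And>s. s \<notin> T \<Longrightarrow> slice R (\<epsilon> s) r = 0"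
      "r = (\<Sum>s\<in>T. slice R (\<epsilon> s) r)"
      by (rule slice_sum_decomposition[OF linear_\<phi> sum_\<phi> r, unfolded \<epsilon>]) (assumption, rule that)
    have "(\<Sum>s\<in>T. slice R (\<epsilon> s) r) = (\<Sum>s\<in>T. if s = f then slice R (\<epsilon> f) r else 0)"
      using ne T(2) by (intro sum.cong) auto
    also have "\<dots> = slice R (\<epsilon> f) r" using T(1,3) by simp
    finally show ?thesis using T(4) True by simp
  qed (use ne g in auto)
qed

text \<open>On a joint eigenvector the convolution of two coordinates is \<open>\<epsilon> s\<close>
  of a slice, which \<open>slice_\<epsilon>_joint\<close> computes. For a label \<open>t\<close>
  outside \<open>F\<close> the functional \<open>\<epsilon> t\<close> vanishes on the
  carrier.\<close>

lemma coalgebra_map_\<phi>: "coalgebra_map R (group_algebra P) \<phi>"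
  unfolding coalgebra_map_group_algebra_iff[OF R(1,2)]
proof (intro conjI ballI allI linear_\<phi> sum_\<phi>)
  fix r s t assume r: "r \<in> carrier R"
  have "convol R (\<epsilon> s) (\<epsilon> t) r = (if s = t then \<epsilon> s r else 0)"
  proof (cases "t \<in> F")
    case True
    have R0: "functional (\<lambda>r. if s = t then \<epsilon> s r else 0)"
      using functional_\<epsilon> linear_map_const_zero[OF vspace_base_space] by (cases "s = t") simp_all
    show ?thesis
    proof (rule eq_on_joint[OF functional_convol[OF functional_\<epsilon> functional_\<epsilon>] R0 _ r])
      fix b assume "b \<in> (\<Union>f\<in>F. joint f)"
      then obtain f where f: "f \<in> F" "b \<in> joint f" by blast
      then have "b \<in> carrier R" by (simp add: joint_def)
      then show "convol R (\<epsilon> s) (\<epsilon> t) b = (if s = t then \<epsilon> s b else 0)"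
        using functional_slice[OF functional_\<epsilon> functional_\<epsilon>, of b s t]
          linear_map_zero[OF R(1) functional_\<epsilon>]
        by (auto simp: slice_\<epsilon>_joint[OF f True] \<epsilon>_joint[OF f])
    qed
  next
    case False
    then have 0: "\<epsilon> t x = 0" if "x \<in> carrier R" for x
      using linear_map_closed[OF linear_\<phi> that] by (auto simp: \<epsilon>_def in_keys_iff)
    have "convol R (\<epsilon> s) (\<epsilon> t) r = sweedler R (\<lambda>a b. 0) r"
      unfolding convol_def by (rule sweedler_cong[OF R(2) r]) (simp add: 0)
    then show ?thesis using 0[OF r] by (auto simp: sweedler_terms case_prod_unfold)
  qed
  then show "sweedler R (\<lambda>a b. lookup (\<phi> a) s * lookup (\<phi> b) t) r =
    (if s = t then lookup (\<phi> r) s else 0)"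
    by (simp add: convol_def \<epsilon>_def)
qed

abbreviation (input) at_point :: "'q \<Rightarrow> (('q \<Rightarrow> 'a) \<Rightarrow>\<^sub>0 'k) \<Rightarrow> ('a \<Rightarrow>\<^sub>0 'k)" where
  "at_point \<equiv> point_eval A"

lemmas linear_at_point = linear_point_eval[of _ I A]

lemma at_point_\<phi>:
  assumes q: "q \<in> I" and r: "r \<in> carrier R"
  shows "at_point q (\<phi> r) = \<chi> q r"
proof (rule eq_on_joint[OF linear_map_compose[OF linear_\<phi> linear_at_point[OF q]]
      coalgebra_mapD(1)[OF \<chi>[OF q]] _ r])
  fix b assume "b \<in> (\<Union>f\<in>F. joint f)"
  then obtain f where f: "f \<in> F" "b \<in> joint f" by blast
  have "at_point q (\<phi> b) = pm_scale (counit R b) (point (f q))"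
    using linear_map_scal[OF linear_at_point[OF q], of "point f" "counit R b"] f
    by (simp add: \<phi>_joint[OF f] point_eval_point)
  also have "\<dots> = \<chi> q b"
    using e_joint[OF q f(2)] by (intro poly_mapping_eqI) (simp add: e_def lookup_single when_def)
  finally show "at_point q (\<phi> b) = \<chi> q b" .
qed

text \<open>Let \<open>b\<close> lie in \<open>joint f\<close>, and let \<open>g\<close> differ from
  \<open>f\<close> at \<open>q\<close>. Replacing \<open>b\<close> by its slice under
  \<open>e q (f q)\<close> does not change the coefficient of \<open>\<psi> b\<close> at
  \<open>g\<close>, but expresses it as a convolution; carried over by \<open>\<psi>\<close>, this
  is the convolution of two functionals on the power that exclude each other. The one coefficient
  left, at \<open>f\<close>, is fixed by the counit.\<close>

lemma \<phi>_unique: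
  assumes \<psi>: "coalgebra_map R (group_algebra P) \<psi>"
    and eq: "\<And>q r. q \<in> I \<Longrightarrow> r \<in> carrier R \<Longrightarrow> at_point q (\<psi> r) = \<chi> q r"
    and r: "r \<in> carrier R"
  shows "\<psi> r = \<phi> r"
proof (rule eq_on_joint[OF coalgebra_mapD(1)[OF \<psi>] linear_\<phi> _ r])
  let ?l = lookup and ?P = "group_algebra P"
  note lin = coalgebra_mapD(1)[OF \<psi>]
  fix b assume "b \<in> (\<Union>f\<in>F. joint f)"
  then obtain f where f: "f \<in> F" "b \<in> joint f" by blast
  then have b: "b \<in> carrier R" by (simp add: joint_def)
  have \<psi>b: "\<psi> b \<in> carrier ?P" by (rule linear_map_closed[OF lin b])
  have zero: "?l (\<psi> b) g = 0" if g: "g \<noteq> f" for g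
  proof (cases "g \<in> F")
    case True
    then obtain q where q: "q \<in> I" "f q \<noteq> g q"
      using PiE_ext[of f I "\<lambda>_. carrier A" g] f g by blast
    have fn: "linear_map ?P base_space (\<lambda>v. ?l (at_point q v) (f q))"
      by (rule linear_map_compose[OF linear_at_point[OF q(1)] linear_map_lookup])
    have bil: "bilinear_map ?P ?P base_space (\<lambda>u v. ?l u g * ?l (at_point q v) (f q))"
      by (rule bilinear_map_mult[OF linear_map_lookup fn])
    have 0: "sweedler ?P (\<lambda>u v. ?l u g * ?l (at_point q v) (f q)) x = 0" if x: "x \<in> carrier ?P" for x
    proof (rule linear_map_eq_on_spanning[OF vspace_group_algebra spanned_by_points
          linear_map_sweedler[OF group_algebra_coalgD(1,2) vspace_base_space bil]
          linear_map_const_zero[OF vspace_base_space] _ x])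
      fix y :: "('q \<Rightarrow> 'a) \<Rightarrow>\<^sub>0 'k" assume "y \<in> point ` carrier P"
      then obtain h where h: "h \<in> carrier P" "y = point h" by auto
      show "sweedler ?P (\<lambda>u v. ?l u g * ?l (at_point q v) (f q)) y = 0"
        unfolding h(2) using q(2)
        by (subst sweedler_grouplike[OF vspace_group_algebra vspace_base_space bil
              grouplike_point[OF h(1)]]) (auto simp: point_eval_point lookup_single when_def)
    qed
    have \<psi>g: "functional (\<lambda>x. ?l (\<psi> x) g)" by (rule linear_map_compose[OF lin linear_map_lookup])
    have "?l (\<psi> b) g = ?l (\<psi> (slice R (e q (f q)) b)) g"
      using slice_joint[OF q(1) f(2)] by simp
    also have "\<dots> = convol R (\<lambda>x. ?l (\<psi> x) g) (e q (f q)) b"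
      by (rule functional_slice[OF \<psi>g functional_e[OF q(1)] b])
    also have "\<dots> = sweedler R (\<lambda>x y. ?l (\<psi> x) g * ?l (at_point q (\<psi> y)) (f q)) b"
      unfolding convol_def by (rule sweedler_cong[OF R(2) b]) (simp add: e_def eq[OF q(1)])
    also have "\<dots> = sweedler ?P (\<lambda>u v. ?l u g * ?l (at_point q v) (f q)) (\<psi> b)"
      by (rule sweedler_coalgebra_map[OF R(2) b vspace_group_algebra vspace_base_space \<psi> bil,
            symmetric])
    finally show ?thesis using 0[OF \<psi>b] by simp
  qed (use \<psi>b in \<open>auto simp: in_keys_iff\<close>)
  have "counit R b = counit ?P (\<psi> b)" using coalgebra_mapD(3)[OF \<psi> b] by simp
  also have "\<dots> = (\<Sum>g\<in>{f}. ?l (\<psi> b) g)"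
    using lin_ext_superset[OF vspace_base_space, of "{f}" "\<psi> b" "\<lambda>_. 1"] zero
    by (auto simp: counit_group_algebra in_keys_iff)
  finally show "\<psi> b = \<phi> b"
    using zero by (intro poly_mapping_eqI) (auto simp: \<phi>_joint[OF f] lookup_single when_def)
qed

end

section \<open>Exponentials of group algebras\<close>

abbreviation (input) "power_group Q A \<equiv> product_group (carrier Q) (\<lambda>_. A)"

lemma bilinear_lin_ext:
  assumes U: "is_vspace U" and T: "\<And>g. g \<in> carrier G \<Longrightarrow> linear_map V U (T g)"
  shows "bilinear_map (group_algebra G) V U (\<lambda>x v. lin_ext U (\<lambda>g. T g v) x)"
proof (rule bilinear_mapI)
  show "linear_map V U (\<lambda>v. lin_ext U (\<lambda>g. T g v) x)" if "x \<in> carrier (group_algebra G)" for x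
    unfolding lin_ext_def using that T by (intro linear_map_sum_fun[OF U] linear_map_scal_fun[OF U]) auto
  show "linear_map (group_algebra G) U (\<lambda>x. lin_ext U (\<lambda>g. T g v) x)" if "v \<in> carrier V" for v
    using linear_map_lin_ext[OF U, of G "\<lambda>g. T g v"] linear_map_closed[OF T that] by simp
qed

lemma bilinear_map_flip: "bilinear_map V W U f \<Longrightarrow> bilinear_map W V U (\<lambda>x y. f y x)"
  by (simp add: bilinear_map_def)

section \<open>Transfer between records with the same coalgebra\<close>

context
  fixes C :: "('k::field, 'v::ab_group_add, 'y) coalg_scheme"
    and C' :: "('k, 'v, 'z) coalg_scheme"
  assumes same: "carrier C = carrier C'" "scal C = scal C'" "comul C = comul C'" "counit C = counit C'"
begin

lemma sweedler_coalg_cong: "sweedler C = sweedler C'"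
  unfolding sweedler_def[abs_def] tensor_lift_space_cong[OF same(1,2) same(1,2)] same ..

lemma cocommutative_coalgebra_cong: "cocommutative_coalgebra C \<longleftrightarrow> cocommutative_coalgebra C'"
  unfolding cocommutative_coalgebra_def coalgebra_def sweedler_coalg_cong
    tensor_space_cong[OF same(1,2) same(1,2)] tensor_cong[OF same(1,2) same(1,2)]
    tensor_cong[OF same(1,2) refl refl] tensor_cong[OF refl refl same(1,2)] vspace_cong[OF same(1,2)]
    linear_map_cong[OF same(1,2) refl refl] linear_map_cong[OF same(1,2) same(1,2)] same ..

lemma coalgebra_map_cod_cong: "coalgebra_map R C f \<longleftrightarrow> coalgebra_map R C' f"
  unfolding coalgebra_map_def tensor_cong[OF same(1,2) same(1,2)]
    linear_map_cong[OF refl refl same(1,2)] same ..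

lemma coalgebra_map_dom_cong: "coalgebra_map C R f \<longleftrightarrow> coalgebra_map C' R f"
  unfolding coalgebra_map_def sweedler_coalg_cong linear_map_cong[OF same(1,2) refl refl] same ..

lemma tensor_coalg_cong_left: "tensor_coalg C D = tensor_coalg C' D"
  unfolding tensor_coalg_def sweedler_coalg_cong tensor_space_cong[OF same(1,2) refl refl]
    tensor_cong[OF same(1,2) refl refl] tensor_lift_space_cong[OF same(1,2) refl refl] same ..

end

text \<open>The exponential in \<open>is_exponential\<close> is a record of exact type
  \<open>coalg\<close>, so the Hopf record of the group algebra of the power is truncated; its
  coalgebra fields survive.\<close>

lemma truncate_coalg_simps [simp]:
  "carrier (coalg.truncate C) = carrier C" "scal (coalg.truncate C) = scal C"
  "comul (coalg.truncate C) = comul C" "counit (coalg.truncate C) = counit C"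
  by (simp_all add: coalg.truncate_def)

lemma coalgebra_map_point_eval:
  assumes "q \<in> I"
  shows "coalgebra_map (group_algebra (product_group I (\<lambda>_. A))) (group_algebra A) (point_eval A q)"
  by (rule coalgebra_map_of_grouplike[OF group_algebra_coalgD group_algebra_coalgD spanned_by_points _
        linear_point_eval[OF assms]])
    (use assms in \<open>auto simp: point_eval_point intro!: grouplike_point\<close>)

text \<open>The bilinear extension of the application of a function \<open>f\<close> to a group
  element \<open>q\<close>; it is the evaluation of the concrete exponential.\<close>

definition group_exp_eval ::
  "('a, 'm) monoid_scheme \<Rightarrow> ('q, 'n) monoid_scheme \<Rightarrow>
    ('k::field, ('q \<Rightarrow> 'a) \<Rightarrow>\<^sub>0 'k, 'q \<Rightarrow>\<^sub>0 'k) tensor \<Rightarrow> ('a \<Rightarrow>\<^sub>0 'k)" where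
  "group_exp_eval A Q = tensor_lift (group_algebra (power_group Q A)) (group_algebra Q)
    (\<lambda>x y. lin_ext (group_algebra A) (\<lambda>q. point_eval A q x) y)"

lemma grouplike_points: "x \<in> point ` carrier G \<Longrightarrow> grouplike (group_algebra G) x"
  by (auto simp del: group_algebra_simps intro: grouplike_point)

context
  fixes A :: "('a, 'm) monoid_scheme" and Q :: "('q, 'n) monoid_scheme"
    and type_k :: "'k::field itself"
begin

private abbreviation (input) "P \<equiv> power_group Q A"
private abbreviation (input) "kP \<equiv> group_algebra P :: ('k, ('q \<Rightarrow> 'a) \<Rightarrow>\<^sub>0 'k) hopf"
private abbreviation (input) "kA \<equiv> group_algebra A :: ('k, 'a \<Rightarrow>\<^sub>0 'k) hopf"
private abbreviation (input) "kQ \<equiv> group_algebra Q :: ('k, 'q \<Rightarrow>\<^sub>0 'k) hopf"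
private abbreviation (input) "ev \<equiv> group_exp_eval A Q :: ('k, ('q \<Rightarrow> 'a) \<Rightarrow>\<^sub>0 'k, 'q \<Rightarrow>\<^sub>0 'k) tensor \<Rightarrow> ('a \<Rightarrow>\<^sub>0 'k)"

lemma bilinear_group_exp: "bilinear_map kP kQ kA (\<lambda>x y. lin_ext kA (\<lambda>q. point_eval A q x) y)"
  by (rule bilinear_map_flip[OF bilinear_lin_ext[OF vspace_group_algebra linear_point_eval]])

lemma linear_group_exp_eval: "linear_map (tensor_space kP kQ) kA ev"
  unfolding group_exp_eval_def
  by (rule linear_map_tensor_lift[OF vspace_group_algebra vspace_group_algebra
        vspace_group_algebra bilinear_group_exp])

lemma group_exp_eval_tensor_point:
  assumes "x \<in> carrier kP" "q \<in> carrier Q"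
  shows "ev (tensor kP kQ x (point q)) = point_eval A q x"
  unfolding group_exp_eval_def
  by (subst tensor_lift_tensor[OF vspace_group_algebra vspace_group_algebra
        vspace_group_algebra bilinear_group_exp assms(1) point_in_group_algebra[OF assms(2)]])
    (rule lin_ext_point[OF vspace_group_algebra])

text \<open>In the slot of a group element \<open>q\<close> the evaluation is
  \<open>point_eval A q\<close>, a coalgebra map, and \<open>coalgebra_map_tensor_coalg_iff\<close>
  reassembles the slots.\<close>

lemma coalgebra_map_group_exp_eval: "coalgebra_map (tensor_coalg kP kQ) kA ev"
proof -
  have "coalgebra_map kP kA (\<lambda>x. ev (tensor kP kQ x b))" if b: "b \<in> point ` carrier Q" for b
  proof -
    obtain q where q: "q \<in> carrier Q" "b = point q" using b by blast
    show ?thesis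
      using coalgebra_map_point_eval[OF q(1), of A] unfolding q(2)
      by (subst coalgebra_map_cong[OF linear_map_comul_group_algebra vspace_group_algebra
            group_exp_eval_tensor_point]) (auto simp: q(1))
  qed
  then show ?thesis
    using coalgebra_map_tensor_coalg_iff[OF group_algebra_coalgD group_algebra_coalgD
        group_algebra_coalgD spanned_by_points grouplike_points] linear_group_exp_eval by blast
qed

context
  fixes R :: "('k, 'r::ab_group_add) coalg"
  assumes R: "cocommutative_coalgebra R"
begin

private lemma RD: "is_vspace R" "linear_map R (tensor_space R R) (comul R)"
    "linear_map R base_space (counit R)"
  using R coalgebraD by (auto simp: cocommutative_coalgebra_def)

private definition uncurried where
  "uncurried \<phi> = (\<lambda>t\<in>carrier (tensor_coalg R kQ). ev (tensor_map R kQ kP kQ \<phi> (\<lambda>c. c) t))"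

private lemma bilinear_uncurried:
  "linear_map R kP \<phi> \<Longrightarrow> bilinear_map R kQ (tensor_space kP kQ) (\<lambda>v w. tensor kP kQ (\<phi> v) w)"
  by (rule bilinear_map_compose[OF bilinear_map_tensor _ linear_map_ident])

private lemma TkP: "is_vspace (tensor_space kP kQ)"
  by (rule vspace_tensor_space[OF vspace_group_algebra])

private lemma TR: "is_vspace (tensor_space R kQ)"
  by (rule vspace_tensor_space[OF RD(1)])

private lemma uncurried_point:
  assumes "linear_map R kP \<phi>" "r \<in> carrier R" "q \<in> carrier Q"
  shows "uncurried \<phi> (tensor R kQ r (point q)) = point_eval A q (\<phi> r)"
proof -
  have "tensor R kQ r (point q) \<in> carrier (tensor_coalg R kQ)"
    unfolding tensor_coalg_space by (rule tensor_in_space[OF assms(2) point_in_group_algebra[OF assms(3)]])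
  then have "uncurried \<phi> (tensor R kQ r (point q)) = ev (tensor kP kQ (\<phi> r) (point q))"
    unfolding uncurried_def tensor_map_def
    by (simp only: restrict_apply' tensor_lift_tensor[OF RD(1) vspace_group_algebra TkP
          bilinear_uncurried[OF assms(1)] assms(2) point_in_group_algebra[OF assms(3)]])
  also have "\<dots> = point_eval A q (\<phi> r)"
    by (rule group_exp_eval_tensor_point[OF linear_map_closed[OF assms(1,2)] assms(3)])
  finally show ?thesis .
qed

private lemma linear_restrict:
  assumes V: "is_vspace V" and f: "linear_map V U f"
  shows "linear_map V U (restrict f (carrier V))"
  using f vspace_add[OF V] vspace_scal[OF V] by (simp add: linear_map_def)

private lemma linear_uncurried:
  assumes "linear_map R kP \<phi>" shows "linear_map (tensor_space R kQ) kA (uncurried \<phi>)"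
  unfolding uncurried_def tensor_coalg_space tensor_map_def
  by (rule linear_restrict[OF TR linear_map_compose[OF linear_map_tensor_lift[OF RD(1) vspace_group_algebra
            TkP bilinear_uncurried[OF assms]] linear_group_exp_eval]])

private lemma uncurried_closed:
  assumes \<phi>: "coalgebra_map R kP \<phi>" shows "uncurried \<phi> \<in> coalgebra_maps (tensor_coalg R kQ) kA"
proof -
  note lin = coalgebra_mapD(1)[OF \<phi>]
  have "coalgebra_map R kA (\<lambda>r. uncurried \<phi> (tensor R kQ r b))" if b: "b \<in> point ` carrier Q" for b
  proof -
    obtain q where q: "q \<in> carrier Q" "b = point q" using b by blast
    have "coalgebra_map R kA (\<lambda>r. point_eval A q (\<phi> r))"
      by (rule coalgebra_map_compose[OF RD(2) vspace_group_algebra vspace_group_algebra \<phi>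
            coalgebra_map_point_eval[OF q(1)]])
    then show ?thesis
      unfolding q(2) by (subst coalgebra_map_cong[OF RD(2) RD(1) uncurried_point[OF lin _ q(1)]])
  qed
  then have "coalgebra_map (tensor_coalg R kQ) kA (uncurried \<phi>)"
    using coalgebra_map_tensor_coalg_iff[OF RD group_algebra_coalgD
        group_algebra_coalgD spanned_by_points grouplike_points] linear_uncurried[OF lin] by blast
  then show ?thesis by (simp add: coalgebra_maps_def uncurried_def)
qed

text \<open>A coalgebra map on R \<otimes> kQ amounts to a family of coalgebra maps on
  \<open>R\<close> indexed by \<open>Q\<close>. Injectivity is \<open>\<phi>_unique\<close> for the
  family of a given map; surjectivity is the construction of \<open>\<phi>\<close> from the family
  of a given \<open>\<psi>\<close>.\<close>

lemma bij_betw_group_exp: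
  "bij_betw (\<lambda>\<phi>. \<lambda>t\<in>carrier (tensor_coalg R kQ). ev (tensor_map R kQ kP kQ \<phi> (\<lambda>c. c) t))
    (coalgebra_maps R kP) (coalgebra_maps (tensor_coalg R kQ) kA)"
  unfolding uncurried_def[symmetric]
proof (rule bij_betwI')
  fix \<phi> \<phi>' assume \<phi>: "\<phi> \<in> coalgebra_maps R kP" and \<phi>': "\<phi>' \<in> coalgebra_maps R kP"
  then have c: "coalgebra_map R kP \<phi>" "coalgebra_map R kP \<phi>'" by (auto simp: coalgebra_maps_def)
  show "uncurried \<phi> = uncurried \<phi>' \<longleftrightarrow> \<phi> = \<phi>'"
  proof
    assume eq: "uncurried \<phi> = uncurried \<phi>'"
    \<comment> \<open>The family comes from \<open>\<phi>\<close>, and \<open>\<phi>'\<close> has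
      the same evaluations, so both agree with the map constructed from this family.\<close>
    interpret fam: coalgebra_map_family R "carrier Q" A "\<lambda>q r. point_eval A q (\<phi> r)"
      by unfold_locales
        (rule R, rule coalgebra_map_compose[OF RD(2) vspace_group_algebra vspace_group_algebra c(1)
            coalgebra_map_point_eval])
    have "point_eval A q (\<phi>' r) = point_eval A q (\<phi> r)" if "q \<in> carrier Q" "r \<in> carrier R" for q r
      using uncurried_point[OF coalgebra_mapD(1)[OF c(1)] that(2,1)]
        uncurried_point[OF coalgebra_mapD(1)[OF c(2)] that(2,1)] eq by simp
    then have "\<phi>' r = \<phi> r" if "r \<in> carrier R" for r
      using fam.\<phi>_unique[OF c(1) _ that] fam.\<phi>_unique[OF c(2) _ that] by simp
    then show "\<phi> = \<phi>'"
      using \<phi> \<phi>' unfolding coalgebra_maps_def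
      by (intro extensionalityI[of _ "carrier R"]) auto
  qed simp
next
  show "uncurried \<phi> \<in> coalgebra_maps (tensor_coalg R kQ) kA" if "\<phi> \<in> coalgebra_maps R kP" for \<phi>
    using that by (intro uncurried_closed) (simp add: coalgebra_maps_def)
next
  fix \<psi> assume "\<psi> \<in> coalgebra_maps (tensor_coalg R kQ) kA"
  then have ext: "\<psi> \<in> extensional (carrier (tensor_coalg R kQ))"
    and \<psi>: "coalgebra_map (tensor_coalg R kQ) kA \<psi>" by (auto simp: coalgebra_maps_def)
  then have lin\<psi>: "linear_map (tensor_space R kQ) kA \<psi>"
    and point: "\<And>b. b \<in> point ` carrier Q \<Longrightarrow> coalgebra_map R kA (\<lambda>r. \<psi> (tensor R kQ r b))"
    using coalgebra_map_tensor_coalg_iff[OF RD group_algebra_coalgD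
        group_algebra_coalgD spanned_by_points grouplike_points] by blast+
  interpret fam: coalgebra_map_family R "carrier Q" A "\<lambda>q r. \<psi> (tensor R kQ r (point q))"
    by unfold_locales (rule R, rule point[OF imageI])
  have c: "coalgebra_map R kP (restrict fam.\<phi> (carrier R))"
    by (subst coalgebra_map_cong[OF RD(2,1), where g = fam.\<phi>]) (simp_all only: restrict_apply' fam.coalgebra_map_\<phi>)
  have "\<psi> = uncurried (restrict fam.\<phi> (carrier R))"
  proof (rule extensionalityI[OF ext])
    show "uncurried (restrict fam.\<phi> (carrier R)) \<in> extensional (carrier (tensor_coalg R kQ))"
      by (simp add: uncurried_def)
    fix t assume "t \<in> carrier (tensor_coalg R kQ)"
    then have t: "t \<in> carrier (tensor_space R kQ)" by simp
    show "\<psi> t = uncurried (restrict fam.\<phi> (carrier R)) t"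
    proof (rule linear_map_eq_on_spanning[OF TR spanned_by_tensor_space[OF RD(1) vspace_group_algebra
            spanned_by_carrier[OF RD(1)] spanned_by_points] lin\<psi> linear_uncurried[OF coalgebra_mapD(1)[OF c]] _ t])
      fix b assume "b \<in> {tensor R kQ r x |r x. r \<in> carrier R \<and> x \<in> point ` carrier Q}"
      then obtain r q where b: "b = tensor R kQ r (point q)" "r \<in> carrier R" "q \<in> carrier Q" by blast
      show "\<psi> b = uncurried (restrict fam.\<phi> (carrier R)) b"
        unfolding b(1) uncurried_point[OF coalgebra_mapD(1)[OF c] b(2,3)]
        using fam.at_point_\<phi>[OF b(3,2)] b(2) by simp
    qed
  qed
  moreover have "restrict fam.\<phi> (carrier R) \<in> coalgebra_maps R kP"
    using c by (simp add: coalgebra_maps_def)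
  ultimately show "\<exists>\<phi>\<in>coalgebra_maps R kP. \<psi> = uncurried \<phi>" by blast
qed

end

lemma is_exponential_group_algebra:
  "is_exponential TYPE('r::ab_group_add) kQ kA (coalg.truncate kP) ev"
proof -
  note same = truncate_coalg_simps[of kP]
  have "coalgebra_maps R (coalg.truncate kP) = coalgebra_maps R kP" for R :: "('k, 'r) coalg"
    unfolding coalgebra_maps_def coalgebra_map_cod_cong[OF same] ..
  moreover have "tensor_map R kQ (coalg.truncate kP) kQ = tensor_map R kQ kP kQ" for R :: "('k, 'r) coalg"
    unfolding tensor_map_def[abs_def] tensor_cong[OF same(1,2) refl refl] ..
  ultimately show ?thesis
    unfolding is_exponential_def cocommutative_coalgebra_cong[OF same] tensor_coalg_cong_left[OF same]
    using cocommutative_group_algebra coalgebra_map_group_exp_eval bij_betw_group_exp by auto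
qed

end

section \<open>Hopf algebras spanned by a group of grouplike elements\<close>

lemma trilinear_map_eq_on_spanning:
  fixes V :: "('k::field, 'v::ab_group_add, 'x) vspace_scheme"
    and W :: "('k, 'w::ab_group_add, 'y) vspace_scheme"
    and X :: "('k, 'u::ab_group_add, 'z) vspace_scheme"
    and U :: "('k, 't::ab_group_add, 'p) vspace_scheme"
  assumes V: "is_vspace V" and W: "is_vspace W" and X: "is_vspace X"
    and B: "spanned_by V B" and C: "spanned_by W C" and D: "spanned_by X D"
    and f: "\<And>x. x \<in> carrier X \<Longrightarrow> bilinear_map V W U (\<lambda>v w. f v w x)"
      "\<And>v w. v \<in> carrier V \<Longrightarrow> w \<in> carrier W \<Longrightarrow> linear_map X U (f v w)"
    and g: "\<And>x. x \<in> carrier X \<Longrightarrow> bilinear_map V W U (\<lambda>v w. g v w x)"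
      "\<And>v w. v \<in> carrier V \<Longrightarrow> w \<in> carrier W \<Longrightarrow> linear_map X U (g v w)"
    and eq: "\<And>b c d. b \<in> B \<Longrightarrow> c \<in> C \<Longrightarrow> d \<in> D \<Longrightarrow> f b c d = g b c d"
    and x: "v \<in> carrier V" "w \<in> carrier W" "x \<in> carrier X"
  shows "f v w x = g v w x"
proof (rule bilinear_map_eq_on_spanning[OF V W B C f(1) g(1) _ x(1,2)])
  fix b c assume bc: "b \<in> B" "c \<in> C"
  then have "b \<in> carrier V" "c \<in> carrier W"
    using spanned_by_subset[OF B] spanned_by_subset[OF C] by blast+
  then show "f b c x = g b c x"
    using linear_map_eq_on_spanning[OF X D f(2) g(2) eq[OF bc] x(3)] by blast
qed (rule x(3))+

text \<open>Each Hopf axiom is a multilinear identity that on the spanning family \<open>b\<close>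
  becomes a group law. The locale is instantiated for group algebras and for the wreath product;
  independence of the family enters only through the map \<open>\<Phi>\<close> of
  \<open>hopf_isomorphic_group_algebra\<close>.\<close>

locale grouplike_group = group G
  for G :: "('g, 'm) monoid_scheme" (structure) +
  fixes H :: "('k::field, 'v::ab_group_add, 'z) hopf_scheme" and b :: "'g \<Rightarrow> 'v"
  assumes H: "is_vspace H" "linear_map H (tensor_space H H) (comul H)"
      "linear_map H base_space (counit H)"
    and b: "g \<in> carrier G \<Longrightarrow> grouplike H (b g)"
    and span: "spanned_by H (b ` carrier G)"
    and bilinear_hmult: "bilinear_map H H H (hmult H)"
    and hmult_b: "g \<in> carrier G \<Longrightarrow> h \<in> carrier G \<Longrightarrow> hmult H (b g) (b h) = b (g \<otimes> h)"
    and hone_b: "hone H = b \<one>"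
    and linear_antipode: "linear_map H H (antipode H)"
    and antipode_b: "g \<in> carrier G \<Longrightarrow> antipode H (b g) = b (inv g)"
begin

lemma b_closed: "g \<in> carrier G \<Longrightarrow> b g \<in> carrier H"
  using b by (simp add: grouplike_def)

lemma b_image: "x \<in> b ` carrier G \<Longrightarrow> grouplike H x"
  using b by blast

lemma cocommutative: "cocommutative_coalgebra H"
  by (rule cocommutative_coalgebra_of_grouplike[OF H span b_image])

lemmas sg = sweedler_grouplike[OF H(1) _ _ b]

lemma hmult_left: "y \<in> carrier H \<Longrightarrow> linear_map V H f \<Longrightarrow> linear_map V H (\<lambda>x. hmult H (f x) y)"
  by (rule linear_map_compose[OF _ bilinear_map_left[OF bilinear_hmult]])

lemma hmult_right: "y \<in> carrier H \<Longrightarrow> linear_map V H f \<Longrightarrow> linear_map V H (\<lambda>x. hmult H y (f x))"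
  by (rule linear_map_compose[OF _ bilinear_map_right[OF bilinear_hmult]])

lemma hmult_closed: "x \<in> carrier H \<Longrightarrow> y \<in> carrier H \<Longrightarrow> hmult H x y \<in> carrier H"
  by (rule bilinear_map_closed[OF bilinear_hmult])

lemma TH: "is_vspace (tensor_space H H)"
  by (rule vspace_tensor_space[OF H(1)])

lemma bilinear_comul_right:
  assumes "x1 \<in> carrier H" "x2 \<in> carrier H"
  shows "bilinear_map H H (tensor_space H H) (\<lambda>y1 y2. tensor H H (hmult H x1 y1) (hmult H x2 y2))"
  by (rule bilinear_map_compose[OF bilinear_map_tensor]; rule bilinear_map_right[OF bilinear_hmult]; fact)

lemma bilinear_comul_left:
  assumes y: "y \<in> carrier H"
  shows "bilinear_map H H (tensor_space H H)
    (\<lambda>x1 x2. sweedler H (\<lambda>y1 y2. tensor H H (hmult H x1 y1) (hmult H x2 y2)) y)"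
proof -
  have "bilinear_map H H (tensor_space H H) (\<lambda>x1 x2. tensor H H (hmult H x1 y1) (hmult H x2 y2))"
    if "y1 \<in> carrier H" "y2 \<in> carrier H" for y1 y2
    by (rule bilinear_map_compose[OF bilinear_map_tensor]; rule bilinear_map_left[OF bilinear_hmult]; fact)
  then show ?thesis
    by (intro bilinear_mapI linear_map_sweedler_fun[OF H(2) y TH])
      (blast dest: bilinear_map_right bilinear_map_left)+
qed

lemma bilinear_comul_hmult:
  "bilinear_map H H (tensor_space H H)
    (\<lambda>x y. sweedler H (\<lambda>x1 x2. sweedler H (\<lambda>y1 y2. tensor H H (hmult H x1 y1) (hmult H x2 y2)) y) x)"
  by (intro bilinear_mapI linear_map_sweedler[OF H(1,2) TH] linear_map_sweedler_fun[OF H(2) _ TH]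
      bilinear_comul_left bilinear_comul_right)

lemma comul_hmult:
  assumes "x \<in> carrier H" "y \<in> carrier H"
  shows "comul H (hmult H x y) =
    sweedler H (\<lambda>x1 x2. sweedler H (\<lambda>y1 y2. tensor H H (hmult H x1 y1) (hmult H x2 y2)) y) x"
proof (rule bilinear_map_eq_on_spanning[OF H(1) H(1) span span
      linear_map_comp_bilinear[OF bilinear_hmult H(2)] bilinear_comul_hmult _ assms])
  fix u v assume "u \<in> b ` carrier G" "v \<in> b ` carrier G"
  then obtain g h where g: "g \<in> carrier G" and h: "h \<in> carrier G" and u: "u = b g" and v: "v = b h"
    by blast
  show "comul H (hmult H u v) =
    sweedler H (\<lambda>x1 x2. sweedler H (\<lambda>y1 y2. tensor H H (hmult H x1 y1) (hmult H x2 y2)) v) u"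
    unfolding u v sg[OF TH bilinear_comul_left[OF b_closed[OF h]] g]
      sg[OF TH bilinear_comul_right[OF b_closed[OF g] b_closed[OF g]] h] hmult_b[OF g h]
    using b[OF m_closed[OF g h]] by (simp add: grouplike_def)
qed

lemma counit_hmult:
  assumes "x \<in> carrier H" "y \<in> carrier H"
  shows "counit H (hmult H x y) = counit H x * counit H y"
proof (rule bilinear_map_eq_on_spanning[OF H(1) H(1) span span
      linear_map_comp_bilinear[OF bilinear_hmult H(3)] bilinear_map_mult[OF H(3) H(3)] _ assms])
  fix u v assume "u \<in> b ` carrier G" "v \<in> b ` carrier G"
  then show "counit H (hmult H u v) = counit H u * counit H v"
    using b by (auto simp: hmult_b grouplike_def)
qed

lemma hmult_assoc:
  assumes "x \<in> carrier H" "y \<in> carrier H" "z \<in> carrier H"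
  shows "hmult H (hmult H x y) z = hmult H x (hmult H y z)"
  by (rule trilinear_map_eq_on_spanning[OF H(1) H(1) H(1) span span span, where U = H,
        OF _ _ _ _ _ assms])
    (auto intro!: bilinear_mapI hmult_left hmult_right linear_map_ident hmult_closed
      simp: hmult_b m_assoc)

lemma hmult_one:
  assumes "x \<in> carrier H"
  shows "hmult H (hone H) x = x" "hmult H x (hone H) = x"
  by (rule linear_map_eq_on_spanning[OF H(1) span _ linear_map_ident _ assms],
      auto intro!: hmult_left hmult_right linear_map_ident b_closed simp: hone_b hmult_b)+

lemma antipode_axiom:
  assumes x: "x \<in> carrier H"
  shows "sweedler H (\<lambda>x1 x2. hmult H (antipode H x1) x2) x = scal H (counit H x) (hone H)"
    and "sweedler H (\<lambda>x1 x2. hmult H x1 (antipode H x2)) x = scal H (counit H x) (hone H)"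
proof -
  have 1: "bilinear_map H H H (\<lambda>x1 x2. hmult H (antipode H x1) x2)"
    by (rule bilinear_map_compose[OF bilinear_hmult linear_antipode linear_map_ident])
  have 2: "bilinear_map H H H (\<lambda>x1 x2. hmult H x1 (antipode H x2))"
    by (rule bilinear_map_compose[OF bilinear_hmult linear_map_ident linear_antipode])
  have R: "linear_map H H (\<lambda>x. scal H (counit H x) (hone H))"
    by (rule linear_map_scal_left[OF H(1) H(3)]) (simp add: hone_b b_closed)
  show "sweedler H (\<lambda>x1 x2. hmult H (antipode H x1) x2) x = scal H (counit H x) (hone H)"
  proof (rule linear_map_eq_on_spanning[OF H(1) span linear_map_sweedler[OF H(1,2) H(1) 1] R _ x])
    fix u assume "u \<in> b ` carrier G"
    then obtain g where g: "g \<in> carrier G" "u = b g" by blast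
    show "sweedler H (\<lambda>x1 x2. hmult H (antipode H x1) x2) u = scal H (counit H u) (hone H)"
      unfolding g(2) sg[OF H(1) 1 g(1)] using b[OF g(1)] g(1)
      by (simp add: antipode_b hmult_b hone_b grouplike_def scal_one[OF H(1)])
  qed
  show "sweedler H (\<lambda>x1 x2. hmult H x1 (antipode H x2)) x = scal H (counit H x) (hone H)"
  proof (rule linear_map_eq_on_spanning[OF H(1) span linear_map_sweedler[OF H(1,2) H(1) 2] R _ x])
    fix u assume "u \<in> b ` carrier G"
    then obtain g where g: "g \<in> carrier G" "u = b g" by blast
    show "sweedler H (\<lambda>x1 x2. hmult H x1 (antipode H x2)) u = scal H (counit H u) (hone H)"
      unfolding g(2) sg[OF H(1) 2 g(1)] using b[OF g(1)] g(1)
      by (simp add: antipode_b hmult_b hone_b grouplike_def scal_one[OF H(1)])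
  qed
qed

lemma hopf_algebra: "hopf_algebra H"
proof -
  have "grouplike H (hone H)" using b by (simp add: hone_b)
  then show ?thesis
    using cocommutative bilinear_hmult linear_antipode
    by (simp add: hopf_algebra_def cocommutative_coalgebra_def hmult_assoc hmult_one comul_hmult
        counit_hmult antipode_axiom grouplike_def)
qed

end

text \<open>Read as an iterated \<open>lin_ext\<close>, the double sum of the definition is bilinear
  and its value on points is immediate.\<close>

lemma bilinear_hmult_group_algebra:
  assumes "group G"
  shows "bilinear_map (group_algebra G) (group_algebra G) (group_algebra G) (hmult (group_algebra G))"
    and "hmult (group_algebra G) (point g) (point h) = point (g \<otimes>\<^bsub>G\<^esub> h)"
proof -
  interpret group G by fact
  let ?H = "group_algebra G"
  have eq: "hmult ?H = (\<lambda>x y. lin_ext ?H (\<lambda>g. lin_ext ?H (\<lambda>h. point (g \<otimes>\<^bsub>G\<^esub> h)) y) x)"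
    by (intro ext) (simp add: group_algebra_def group_space_def Let_def lin_ext_def
        scal_sum[OF vspace_group_algebra, simplified] scal_scal[OF vspace_group_algebra, simplified])
  show "bilinear_map ?H ?H ?H (hmult ?H)"
    unfolding eq
    by (intro bilinear_lin_ext linear_map_lin_ext vspace_group_algebra point_in_group_algebra m_closed)
  show "hmult ?H (point g) (point h) = point (g \<otimes>\<^bsub>G\<^esub> h)"
    unfolding eq by (simp add: lin_ext_point[OF vspace_group_algebra])
qed

lemma linear_antipode_group_algebra:
  assumes "group G"
  shows "linear_map (group_algebra G) (group_algebra G) (antipode (group_algebra G))"
    and "antipode (group_algebra G) (point g) = point (inv\<^bsub>G\<^esub> g)"
proof -
  interpret group G by fact
  let ?H = "group_algebra G"
  have eq: "antipode ?H = lin_ext ?H (\<lambda>g. point (inv\<^bsub>G\<^esub> g))"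
    by (intro ext) (simp add: group_algebra_def group_space_def Let_def lin_ext_def)
  show "linear_map ?H ?H (antipode ?H)"
    unfolding eq by (intro linear_map_lin_ext vspace_group_algebra point_in_group_algebra inv_closed)
  show "antipode ?H (point g) = point (inv\<^bsub>G\<^esub> g)"
    unfolding eq by (simp add: lin_ext_point[OF vspace_group_algebra])
qed

lemma hone_group_algebra: "hone (group_algebra G) = point \<one>\<^bsub>G\<^esub>"
  by (simp add: group_algebra_def Let_def)

lemma grouplike_group_group_algebra:
  assumes "group G" shows "grouplike_group G (group_algebra G) point"
  by (intro grouplike_group.intro grouplike_group_axioms.intro assms group_algebra_coalgD grouplike_point
      spanned_by_points bilinear_hmult_group_algebra hone_group_algebra linear_antipode_group_algebra)

context grouplike_group
begin

text \<open>The inverse of \<open>\<Phi>\<close> is \<open>lin_ext H b\<close>. Compatibility with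
  the operations is checked on the spanning family, where both sides are given by
  \<open>G\<close>.\<close>

lemma hopf_isomorphic_group_algebra:
  assumes \<Phi>: "linear_map H (group_algebra G) \<Phi>" "\<And>g. g \<in> carrier G \<Longrightarrow> \<Phi> (b g) = point g"
  shows "hopf_isomorphic H (group_algebra G)"
proof -
  let ?K = "group_algebra G :: ('k, 'g \<Rightarrow>\<^sub>0 'k) hopf"
  interpret K: grouplike_group G ?K point
    by (rule grouplike_group_group_algebra[OF group_axioms])
  have coalg: "coalgebra_map H ?K \<Phi>"
    by (rule coalgebra_map_of_grouplike[OF H group_algebra_coalgD span b_image \<Phi>(1)])
      (auto simp: \<Phi>(2) K.b simp del: group_algebra_simps)
  have mult: "\<Phi> (hmult H x y) = hmult ?K (\<Phi> x) (\<Phi> y)" if "x \<in> carrier H" "y \<in> carrier H" for x y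
    by (rule bilinear_map_eq_on_spanning[OF H(1) H(1) span span
          linear_map_comp_bilinear[OF bilinear_hmult \<Phi>(1)]
          bilinear_map_compose[OF K.bilinear_hmult \<Phi>(1) \<Phi>(1)] _ that])
      (auto simp: hmult_b K.hmult_b \<Phi>(2) simp del: group_algebra_simps)
  have anti: "\<Phi> (antipode H x) = antipode ?K (\<Phi> x)" if "x \<in> carrier H" for x
    by (rule linear_map_eq_on_spanning[OF H(1) span linear_map_compose[OF linear_antipode \<Phi>(1)]
          linear_map_compose[OF \<Phi>(1) K.linear_antipode] _ that])
      (auto simp: antipode_b K.antipode_b \<Phi>(2) simp del: group_algebra_simps)
  have lin: "linear_map ?K H (lin_ext H b)"
    by (rule linear_map_lin_ext[OF H(1) b_closed])
  have "lin_ext H b (\<Phi> x) = x" if "x \<in> carrier H" for x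
    by (rule linear_map_eq_on_spanning[OF H(1) span linear_map_compose[OF \<Phi>(1) lin] linear_map_ident _ that])
      (auto simp: \<Phi>(2) lin_ext_point[OF H(1)])
  moreover have "\<Phi> (lin_ext H b x) = x" if "x \<in> carrier ?K" for x
    by (rule linear_map_eq_on_spanning[OF K.H(1) K.span linear_map_compose[OF lin \<Phi>(1)] linear_map_ident _ that])
      (auto simp: \<Phi>(2) lin_ext_point[OF H(1)])
  ultimately have "bij_betw \<Phi> (carrier H) (carrier ?K)"
    by (intro bij_betw_byWitness[where f' = "lin_ext H b"])
      (use linear_map_closed[OF \<Phi>(1)] linear_map_closed[OF lin] in blast)+
  then show ?thesis
    unfolding hopf_isomorphic_def hopf_map_def
    using hopf_algebra K.hopf_algebra coalg mult anti \<Phi>(2)[OF one_closed] hone_b K.hone_b by auto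
qed

end

section \<open>Wreath products\<close>

text \<open>The action of \<open>q\<close> in the wreath product of groups. Restricting to
  \<open>carrier Q\<close> keeps the result extensional, as the carrier of
  \<open>product_group\<close> demands.\<close>

definition shift :: "('q, 'n) monoid_scheme \<Rightarrow> 'q \<Rightarrow> ('q \<Rightarrow> 'a) \<Rightarrow> 'q \<Rightarrow> 'a" where
  "shift Q q f = (\<lambda>r\<in>carrier Q. f (r \<otimes>\<^bsub>Q\<^esub> q))"

lemma wreath_group_simps:
  "carrier (wreath_group A Q) = (carrier Q \<rightarrow>\<^sub>E carrier A) \<times> carrier Q"
  "(f, q) \<otimes>\<^bsub>wreath_group A Q\<^esub> (g, r) =
    (f \<otimes>\<^bsub>power_group Q A\<^esub> shift Q q g, q \<otimes>\<^bsub>Q\<^esub> r)"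
  "\<one>\<^bsub>wreath_group A Q\<^esub> = (\<one>\<^bsub>power_group Q A\<^esub>, \<one>\<^bsub>Q\<^esub>)"
  by (simp_all add: wreath_group_def Let_def shift_def)

context
  fixes A :: "('a, 'm) monoid_scheme" and Q :: "('q, 'n) monoid_scheme"
  assumes A: "group A" and Q: "group Q"
begin

interpretation A: group A by (rule A)
interpretation Q: group Q by (rule Q)

private abbreviation (input) "AQ \<equiv> power_group Q A"

interpretation AQ: group AQ by (rule product_group[OF A])

lemma shift_closed: "q \<in> carrier Q \<Longrightarrow> f \<in> carrier AQ \<Longrightarrow> shift Q q f \<in> carrier AQ"
  by (auto simp: shift_def)

lemma shift_mult:
  "q \<in> carrier Q \<Longrightarrow> shift Q q (f \<otimes>\<^bsub>AQ\<^esub> g) = shift Q q f \<otimes>\<^bsub>AQ\<^esub> shift Q q g"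
  by (auto simp: shift_def fun_eq_iff restrict_def)

text \<open>Right translation of the argument is a left action: the outer shift multiplies the
  argument by \<open>q\<close> on the right, and then the inner one by \<open>r\<close>.\<close>

lemma shift_shift:
  "q \<in> carrier Q \<Longrightarrow> r \<in> carrier Q \<Longrightarrow> shift Q q (shift Q r f) = shift Q (q \<otimes>\<^bsub>Q\<^esub> r) f"
  by (auto simp: shift_def fun_eq_iff restrict_def Q.m_assoc)

lemma shift_one: "f \<in> carrier AQ \<Longrightarrow> shift Q \<one>\<^bsub>Q\<^esub> f = f"
  by (auto simp: shift_def fun_eq_iff restrict_def PiE_def extensional_def)

lemma shift_of_one: "q \<in> carrier Q \<Longrightarrow> shift Q q \<one>\<^bsub>AQ\<^esub> = \<one>\<^bsub>AQ\<^esub>"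
  by (auto simp: shift_def fun_eq_iff restrict_def)

text \<open>The first entry must be the inverse of the shift of \<open>f\<close> by the inverse of
  \<open>q\<close>; shifting is a homomorphism, so this is the shift of the inverse. It is also the
  shape of the antipode of a smash product.\<close>

lemma wreath_left_inverse:
  assumes f: "f \<in> carrier AQ" and q: "q \<in> carrier Q"
  shows "(shift Q (inv\<^bsub>Q\<^esub> q) (inv\<^bsub>AQ\<^esub> f), inv\<^bsub>Q\<^esub> q) \<otimes>\<^bsub>wreath_group A Q\<^esub> (f, q) = \<one>\<^bsub>wreath_group A Q\<^esub>"
  unfolding wreath_group_simps
  using shift_mult[of "inv\<^bsub>Q\<^esub> q" "inv\<^bsub>AQ\<^esub> f" f] shift_of_one[of "inv\<^bsub>Q\<^esub> q"] q AQ.l_inv[OF f]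
  by (simp del: mult_product_group one_product_group inv_product_group)

lemma group_wreath_group: "group (wreath_group A Q)"
proof (rule groupI)
  note [simp del] = mult_product_group one_product_group carrier_product_group inv_product_group
  note c = carrier_product_group[of "carrier Q" "\<lambda>_. A", symmetric]
  fix x assume x: "x \<in> carrier (wreath_group A Q)"
  then obtain f q where fq: "x = (f, q)" "f \<in> carrier AQ" "q \<in> carrier Q"
    by (auto simp: wreath_group_simps c)
  show "\<one>\<^bsub>wreath_group A Q\<^esub> \<otimes>\<^bsub>wreath_group A Q\<^esub> x = x"
    using fq by (simp add: wreath_group_simps shift_one)
  show "\<exists>y\<in>carrier (wreath_group A Q). y \<otimes>\<^bsub>wreath_group A Q\<^esub> x = \<one>\<^bsub>wreath_group A Q\<^esub>"
    using wreath_left_inverse[OF fq(2,3)] fq shift_closed[of "inv\<^bsub>Q\<^esub> q" "inv\<^bsub>AQ\<^esub> f"]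
    by (intro bexI[of _ "(shift Q (inv\<^bsub>Q\<^esub> q) (inv\<^bsub>AQ\<^esub> f), inv\<^bsub>Q\<^esub> q)"])
      (auto simp: wreath_group_simps c)
  fix y assume "y \<in> carrier (wreath_group A Q)"
  then obtain g r where gr: "y = (g, r)" "g \<in> carrier AQ" "r \<in> carrier Q"
    by (auto simp: wreath_group_simps c)
  show "x \<otimes>\<^bsub>wreath_group A Q\<^esub> y \<in> carrier (wreath_group A Q)"
    using fq gr by (simp add: wreath_group_simps c shift_closed)
  fix z assume "z \<in> carrier (wreath_group A Q)"
  then obtain h s where hs: "z = (h, s)" "h \<in> carrier AQ" "s \<in> carrier Q"
    by (auto simp: wreath_group_simps c)
  show "(x \<otimes>\<^bsub>wreath_group A Q\<^esub> y) \<otimes>\<^bsub>wreath_group A Q\<^esub> z = x \<otimes>\<^bsub>wreath_group A Q\<^esub> (y \<otimes>\<^bsub>wreath_group A Q\<^esub> z)"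
    using fq gr hs
    by (simp add: wreath_group_simps shift_closed shift_mult shift_shift AQ.m_assoc Q.m_assoc)
next
  show "\<one>\<^bsub>wreath_group A Q\<^esub> \<in> carrier (wreath_group A Q)"
    using AQ.one_closed by (simp add: wreath_group_simps)
qed

lemma inv_wreath_group:
  assumes f: "f \<in> carrier AQ" and q: "q \<in> carrier Q"
  shows "inv\<^bsub>wreath_group A Q\<^esub> (f, q) = (shift Q (inv\<^bsub>Q\<^esub> q) (inv\<^bsub>AQ\<^esub> f), inv\<^bsub>Q\<^esub> q)"
  by (rule group.inv_equality[OF group_wreath_group wreath_left_inverse[OF f q]])
    (use f q shift_closed[of "inv\<^bsub>Q\<^esub> q" "inv\<^bsub>AQ\<^esub> f"] AQ.inv_closed[OF f] in
      \<open>simp_all add: wreath_group_simps del: inv_product_group\<close>)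

end

section \<open>Structure maps of the exponential\<close>

lemma linear_map_tensor_map_exp:
  assumes R: "is_vspace R" and C: "is_vspace C" and E: "is_vspace E" and \<phi>: "linear_map R E \<phi>"
  shows "linear_map (tensor_space R C) (tensor_space E C) (tensor_map R C E C \<phi> (\<lambda>c. c))"
    and "r \<in> carrier R \<Longrightarrow> c \<in> carrier C \<Longrightarrow>
      tensor_map R C E C \<phi> (\<lambda>c. c) (tensor R C r c) = tensor E C (\<phi> r) c"
proof -
  have bil: "bilinear_map R C (tensor_space E C) (\<lambda>v w. tensor E C (\<phi> v) w)"
    by (rule bilinear_map_compose[OF bilinear_map_tensor \<phi> linear_map_ident])
  note T = vspace_tensor_space[OF E]
  show "linear_map (tensor_space R C) (tensor_space E C) (tensor_map R C E C \<phi> (\<lambda>c. c))"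
    unfolding tensor_map_def by (rule linear_map_tensor_lift[OF R C T bil])
  show "r \<in> carrier R \<Longrightarrow> c \<in> carrier C \<Longrightarrow>
      tensor_map R C E C \<phi> (\<lambda>c. c) (tensor R C r c) = tensor E C (\<phi> r) c"
    unfolding tensor_map_def by (rule tensor_lift_tensor[OF R C T bil])
qed

context
  fixes C :: "('k::field, 'c::ab_group_add, 'y) coalg_scheme"
    and D :: "('k, 'd::ab_group_add, 'z) coalg_scheme"
    and E :: "('k, 'e::ab_group_add) coalg"
    and ev :: "('k, 'e, 'c) tensor \<Rightarrow> 'd"
    and R :: "('k, 'r::ab_group_add) coalg"
  assumes exponential: "is_exponential TYPE('r) C D E ev"
    and C: "is_vspace C" and R: "cocommutative_coalgebra R"
begin

private lemma E_vspace: "is_vspace E"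
  using exponential coalgebraD by (auto simp: is_exponential_def cocommutative_coalgebra_def)

private lemma R_coalg: "is_vspace R" "linear_map R (tensor_space R R) (comul R)"
  using R coalgebraD by (auto simp: cocommutative_coalgebra_def)

private abbreviation (input) "transposed \<equiv> \<lambda>\<phi>. \<lambda>t\<in>carrier (tensor_coalg R C). ev (tensor_map R C E C \<phi> (\<lambda>c. c) t)"

private lemma bij: "bij_betw transposed (coalgebra_maps R E) (coalgebra_maps (tensor_coalg R C) D)"
  using exponential R by (simp only: is_exponential_def)

private lemma linear_ev: "linear_map (tensor_space E C) D ev"
  using exponential by (simp add: is_exponential_def coalgebra_map_def)

text \<open>Injectivity of transposition, for maps that are meaningful only on the carrier: both are
  restricted to extensional maps, and agreement on pure tensors makes their transposes
  equal.\<close>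

lemma exponential_unique:
  assumes \<phi>: "coalgebra_map R E \<phi>" and \<phi>': "coalgebra_map R E \<phi>'"
    and eq: "\<And>r c. r \<in> carrier R \<Longrightarrow> c \<in> carrier C \<Longrightarrow>
      ev (tensor E C (\<phi> r) c) = ev (tensor E C (\<phi>' r) c)"
    and r: "r \<in> carrier R"
  shows "\<phi> r = \<phi>' r"
proof -
  let ?f = "restrict \<phi> (carrier R)" and ?f' = "restrict \<phi>' (carrier R)"
  have f: "coalgebra_map R E ?f" "coalgebra_map R E ?f'"
    using \<phi> \<phi>' by (subst coalgebra_map_cong[OF R_coalg(2,1), where g = \<phi>] coalgebra_map_cong[OF R_coalg(2,1), where g = \<phi>'];
      simp)+
  note lin = coalgebra_mapD(1)[OF f(1)] coalgebra_mapD(1)[OF f(2)]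
  have "ev (tensor_map R C E C ?f (\<lambda>c. c) t) = ev (tensor_map R C E C ?f' (\<lambda>c. c) t)"
    if t: "t \<in> carrier (tensor_space R C)" for t
    by (rule linear_map_eq_on_spanning[OF vspace_tensor_space[OF R_coalg(1)]
          spanned_by_tensor_space[OF R_coalg(1) C spanned_by_carrier[OF R_coalg(1)] spanned_by_carrier[OF C]]
          linear_map_compose[OF linear_map_tensor_map_exp(1)[OF R_coalg(1) C E_vspace lin(1)] linear_ev]
          linear_map_compose[OF linear_map_tensor_map_exp(1)[OF R_coalg(1) C E_vspace lin(2)] linear_ev] _ t])
      (use eq in \<open>auto simp: linear_map_tensor_map_exp(2)[OF R_coalg(1) C E_vspace lin(1)]
        linear_map_tensor_map_exp(2)[OF R_coalg(1) C E_vspace lin(2)]\<close>)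
  then have "transposed ?f = transposed ?f'" by (intro restrict_ext) simp
  then have "?f = ?f'"
    using bij f by (auto simp: bij_betw_def coalgebra_maps_def dest: inj_onD)
  then show ?thesis using r by (metis restrict_apply')
qed

text \<open>Surjectivity of transposition, read off on pure tensors.\<close>

lemma exponential_exists:
  assumes \<psi>: "coalgebra_map (tensor_coalg R C) D \<psi>"
    and cm: "linear_map C (tensor_space C C) (comul C)" "linear_map C base_space (counit C)"
  obtains \<phi> where "coalgebra_map R E \<phi>"
    "\<And>r c. r \<in> carrier R \<Longrightarrow> c \<in> carrier C \<Longrightarrow> ev (tensor E C (\<phi> r) c) = \<psi> (tensor R C r c)"
proof -
  let ?T = "tensor_coalg R C"
  have R3: "linear_map R base_space (counit R)"
    using R coalgebraD by (auto simp: cocommutative_coalgebra_def)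
  have T: "linear_map ?T (tensor_space ?T ?T) (comul ?T)" "is_vspace ?T"
    using linear_map_comul_tensor_coalg[OF R_coalg R3 C cm] vspace_tensor_space[OF R_coalg(1)] by simp_all
  have "coalgebra_map ?T D (restrict \<psi> (carrier ?T))"
    using \<psi> by (subst coalgebra_map_cong[OF T, where g = \<psi>]) simp
  then have "restrict \<psi> (carrier ?T) \<in> coalgebra_maps ?T D" by (simp add: coalgebra_maps_def)
  then have "restrict \<psi> (carrier ?T) \<in> transposed ` coalgebra_maps R E"
    using bij_betw_imp_surj_on[OF bij] by simp
  then obtain \<phi> where \<phi>: "restrict \<psi> (carrier ?T) = transposed \<phi>" "\<phi> \<in> coalgebra_maps R E"
    by (rule imageE)
  then have c: "coalgebra_map R E \<phi>" by (simp add: coalgebra_maps_def)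
  show thesis
  proof (rule that[OF c])
    fix r c assume rc: "r \<in> carrier R" "c \<in> carrier C"
    then have "tensor R C r c \<in> carrier ?T" by (simp add: tensor_in_space)
    then have "ev (tensor_map R C E C \<phi> (\<lambda>c. c) (tensor R C r c)) = \<psi> (tensor R C r c)"
      using fun_cong[OF \<phi>(1), of "tensor R C r c"] by simp
    then show "ev (tensor E C (\<phi> r) c) = \<psi> (tensor R C r c)"
      using linear_map_tensor_map_exp(2)[OF R_coalg(1) C E_vspace coalgebra_mapD(1)[OF c] rc] by simp
  qed
qed

end

lemma coalgebra_maps_restrict:
  assumes "linear_map C (tensor_space C C) (comul C)" "is_vspace C" "coalgebra_map C D f"
  shows "restrict f (carrier C) \<in> coalgebra_maps C D"
  using assms(3) coalgebra_map_cong[OF assms(1,2), of "restrict f (carrier C)" f D]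
  by (simp add: coalgebra_maps_def)

text \<open>Extensionality turns agreement on a spanning set into equality of functions, the form of
  uniqueness that definite descriptions require.\<close>

lemma coalgebra_maps_eqI:
  assumes "is_vspace C" "spanned_by C B" "f \<in> coalgebra_maps C D" "g \<in> coalgebra_maps C D"
    and "\<And>b. b \<in> B \<Longrightarrow> f b = g b"
  shows "f = g"
proof (rule extensionalityI[of _ "carrier C"])
  fix x assume "x \<in> carrier C"
  then show "f x = g x"
    using assms linear_map_eq_on_spanning[OF assms(1,2), of D f g]
    by (auto simp: coalgebra_maps_def coalgebra_map_def)
qed (use assms in \<open>auto simp: coalgebra_maps_def\<close>)

text \<open>The ground field is spanned by the grouplike 1, so a coalgebra map out of it is the
  choice of a grouplike element. This handles the unit of the exponential.\<close>

lemma base_coalg_facts: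
  "is_vspace (base_coalg :: ('k::field, 'k) coalg)"
  "linear_map (base_coalg :: ('k, 'k) coalg) (tensor_space base_coalg base_coalg) (comul base_coalg)"
  "linear_map (base_coalg :: ('k, 'k) coalg) base_space (counit base_coalg)"
  "spanned_by (base_coalg :: ('k, 'k) coalg) {1}"
  "grouplike (base_coalg :: ('k, 'k) coalg) 1"
proof -
  let ?B = "base_coalg :: ('k, 'k) coalg" and ?S = "base_space :: ('k, 'k) vspace"
  have s: "carrier ?B = carrier ?S" "scal ?B = scal ?S" by (simp_all add: base_coalg_def)
  show "is_vspace ?B" unfolding vspace_cong[OF s] by (rule vspace_base_space)
  have "linear_map ?S (tensor_space ?S ?S) (\<lambda>a. tensor ?S ?S a 1)"
    by (rule linear_map_tensor_left) simp
  then show "linear_map ?B (tensor_space ?B ?B) (comul ?B)"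
    unfolding tensor_space_cong[OF s s] linear_map_cong[OF s refl refl] by (simp add: base_coalg_def)
  show "linear_map ?B base_space (counit ?B)"
    unfolding linear_map_cong[OF s refl refl] by (simp add: base_coalg_def linear_map_ident)
  have "x \<in> lspan ?B {1}" for x :: 'k
    using lspan.step[OF singletonI lspan.zero, of ?B x "1::'k"] by (simp add: s)
  then show "spanned_by ?B {1}" by (auto simp: spanned_by_def s)
  show "grouplike ?B 1"
    unfolding grouplike_def tensor_cong[OF s s] by (simp add: base_coalg_def)
qed

section \<open>An exponential with a grouplike basis\<close>

text \<open>What the computation of the structure maps uses of an exponential: a grouplike family
  \<open>\<gamma>\<close> labelled by functions, a coordinate map \<open>\<beta>\<close> that makes
  it a basis, and the values of the evaluation on it. The universal property serves only to obtain
  these data.\<close>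

locale group_exponential =
  fixes A :: "('a, 'm) monoid_scheme" and Q :: "('q, 'n) monoid_scheme"
    and E :: "('k::field, 'e::ab_group_add) coalg"
    and ev :: "('k, 'e, 'q \<Rightarrow>\<^sub>0 'k) tensor \<Rightarrow> ('a \<Rightarrow>\<^sub>0 'k)"
    and \<gamma> :: "('q \<Rightarrow> 'a) \<Rightarrow> 'e" and \<beta> :: "'e \<Rightarrow> (('q \<Rightarrow> 'a) \<Rightarrow>\<^sub>0 'k)"
  assumes A: "group A" and Q: "group Q" and coalgebra_E: "coalgebra E"
    and \<gamma>: "f \<in> carrier (power_group Q A) \<Longrightarrow> grouplike E (\<gamma> f)"
    and span: "spanned_by E (\<gamma> ` carrier (power_group Q A))"
    and \<beta>: "coalgebra_map E (group_algebra (power_group Q A)) \<beta>"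
    and \<beta>_\<gamma>: "f \<in> carrier (power_group Q A) \<Longrightarrow> \<beta> (\<gamma> f) = point f"
    and ev: "linear_map (tensor_space E (group_algebra Q)) (group_algebra A) ev"
    and ev_\<gamma>: "f \<in> carrier (power_group Q A) \<Longrightarrow> q \<in> carrier Q \<Longrightarrow>
      ev (tensor E (group_algebra Q) (\<gamma> f) (point q)) = point (f q)"
begin

abbreviation (input) "P \<equiv> power_group Q A"
abbreviation (input) "kP \<equiv> group_algebra P :: ('k, ('q \<Rightarrow> 'a) \<Rightarrow>\<^sub>0 'k) hopf"
abbreviation (input) "kA \<equiv> group_algebra A :: ('k, 'a \<Rightarrow>\<^sub>0 'k) hopf"
abbreviation (input) "kQ \<equiv> group_algebra Q :: ('k, 'q \<Rightarrow>\<^sub>0 'k) hopf"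

declare mult_product_group [simp del] one_product_group [simp del] inv_product_group [simp del]
  carrier_product_group [simp del] group_algebra_simps [simp del]

sublocale A: group A by (rule A)
sublocale Q: group Q by (rule Q)
sublocale P: group P by (rule product_group[OF A])
sublocale kA: grouplike_group A kA point by (rule grouplike_group_group_algebra[OF A])
sublocale kQ: grouplike_group Q kQ point by (rule grouplike_group_group_algebra[OF Q])
sublocale kP: grouplike_group P kP point by (rule grouplike_group_group_algebra[OF P.group_axioms])

lemmas E = coalgebraD[OF coalgebra_E]

lemma \<gamma>_closed: "f \<in> carrier P \<Longrightarrow> \<gamma> f \<in> carrier E"
  using \<gamma> by (simp add: grouplike_def)

lemma P_value: "f \<in> carrier P \<Longrightarrow> q \<in> carrier Q \<Longrightarrow> f q \<in> carrier A"
  by (auto simp: carrier_product_group)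

lemma P_eqI: "f \<in> carrier P \<Longrightarrow> g \<in> carrier P \<Longrightarrow> (\<And>q. q \<in> carrier Q \<Longrightarrow> f q = g q) \<Longrightarrow> f = g"
  unfolding carrier_product_group by (rule PiE_ext)

lemma P_ops:
  "q \<in> carrier Q \<Longrightarrow> (f \<otimes>\<^bsub>P\<^esub> g) q = f q \<otimes>\<^bsub>A\<^esub> g q"
  "q \<in> carrier Q \<Longrightarrow> \<one>\<^bsub>P\<^esub> q = \<one>\<^bsub>A\<^esub>"
  "f \<in> carrier P \<Longrightarrow> q \<in> carrier Q \<Longrightarrow> (inv\<^bsub>P\<^esub> f) q = inv\<^bsub>A\<^esub> (f q)"
  "r \<in> carrier Q \<Longrightarrow> shift Q q f r = f (r \<otimes>\<^bsub>Q\<^esub> q)"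
  using inv_product_group[of f "carrier Q" "\<lambda>_. A"] A
  by (simp_all add: mult_product_group one_product_group carrier_product_group shift_def)

text \<open>The inverse of \<open>\<beta>\<close>; product and antipode of the group algebra of the
  power are carried to \<open>E\<close> along this pair.\<close>

definition \<alpha> :: "(('q \<Rightarrow> 'a) \<Rightarrow>\<^sub>0 'k) \<Rightarrow> 'e" where
  "\<alpha> = lin_ext E \<gamma>"

lemma linear_\<alpha>: "linear_map kP E \<alpha>"
  unfolding \<alpha>_def by (rule linear_map_lin_ext[OF E(1) \<gamma>_closed])

lemma \<alpha>_point: "\<alpha> (point f) = \<gamma> f"
  unfolding \<alpha>_def by (rule lin_ext_point[OF E(1)])

lemmas linear_\<beta> = coalgebra_mapD(1)[OF \<beta>]

lemma \<alpha>_\<beta>: "x \<in> carrier E \<Longrightarrow> \<alpha> (\<beta> x) = x"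
  by (rule linear_map_eq_on_spanning[OF E(1) span linear_map_compose[OF linear_\<beta> linear_\<alpha>] linear_map_ident])
    (auto simp: \<beta>_\<gamma> \<alpha>_point)

text \<open>The map \<open>\<beta>\<close> sends a grouplike element to a point, and
  \<open>\<alpha>\<close> brings it back.\<close>

lemma grouplike_E:
  assumes "grouplike E x" obtains f where "f \<in> carrier P" "x = \<gamma> f"
proof -
  have "grouplike kP (\<beta> x)"
    by (rule grouplike_coalgebra_map[OF E(1) vspace_group_algebra \<beta> assms])
  then obtain f where f: "f \<in> carrier P" "\<beta> x = point f" by (rule grouplike_group_algebraE)
  then have "x = \<gamma> f" using \<alpha>_\<beta>[OF grouplike_closed[OF assms]] by (simp add: \<alpha>_point)
  then show thesis using that f by blast
qed

text \<open>The value at a grouplike element is grouplike, hence some \<open>\<gamma> f\<close>, and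
  evaluation at all group elements \<open>q\<close> reads off \<open>f\<close>. This is how a
  transposed specification determines a structure map on grouplike elements.\<close>

lemma coalgebra_map_value:
  assumes X: "is_vspace X" and m: "m \<in> coalgebra_maps X E" and x: "grouplike X x" and h: "h \<in> carrier P"
    and eq: "\<And>q. q \<in> carrier Q \<Longrightarrow> ev (tensor E kQ (m x) (point q)) = point (h q)"
  shows "m x = \<gamma> h"
proof -
  have "grouplike E (m x)"
    using grouplike_coalgebra_map[OF X E(1) _ x] m by (simp add: coalgebra_maps_def)
  then obtain f where f: "f \<in> carrier P" "m x = \<gamma> f" by (rule grouplike_E)
  have "f q = h q" if q: "q \<in> carrier Q" for q
  proof -
    have "point (f q) = (point (h q) :: 'a \<Rightarrow>\<^sub>0 'k)" using eq[OF q] f by (simp add: ev_\<gamma>[OF f(1) q])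
    then have "lookup (point (f q) :: 'a \<Rightarrow>\<^sub>0 'k) (f q) = lookup (point (h q)) (f q)"
      by simp
    then show ?thesis by (simp add: lookup_single when_def split: if_splits)
  qed
  then show ?thesis using P_eqI[OF f(1) h] f(2) by blast
qed

lemma ev_right: "x \<in> carrier E \<Longrightarrow> linear_map V kQ f \<Longrightarrow> linear_map V kA (\<lambda>c. ev (tensor E kQ x (f c)))"
  by (rule linear_map_compose[OF linear_map_compose[OF _ linear_map_tensor_right] ev])

lemma ev_left: "c \<in> carrier kQ \<Longrightarrow> linear_map V E f \<Longrightarrow> linear_map V kA (\<lambda>x. ev (tensor E kQ (f x) c))"
  by (rule linear_map_compose[OF linear_map_compose[OF _ linear_map_tensor_left] ev])

lemma TE: "is_vspace (tensor_space E V)"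
  by (rule vspace_tensor_space[OF E(1)])

lemmas EE = linear_map_comul_tensor_coalg[OF E E] linear_map_counit_tensor_coalg[OF E E]

lemma spanned_by_EE:
  "spanned_by (tensor_space E E) {tensor E E x y | x y. x \<in> \<gamma> ` carrier P \<and> y \<in> \<gamma> ` carrier P}"
  by (rule spanned_by_tensor_space[OF E(1) E(1) span span])

section \<open>Multiplication of the exponential\<close>

text \<open>The predicate under \<open>THE\<close> in \<open>exp_mult\<close>. Existence and
  uniqueness are needed before the description can be used; unit, antipode and action follow the
  same pattern.\<close>

definition mult_spec where
  "mult_spec m \<longleftrightarrow> m \<in> coalgebra_maps (tensor_coalg E E) E \<and>
    (\<forall>x\<in>carrier E. \<forall>y\<in>carrier E. \<forall>c\<in>carrier kQ.
      ev (tensor E kQ (m (tensor E E x y)) c) =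
      sweedler kQ (\<lambda>c1 c2. hmult kA (ev (tensor E kQ x c1)) (ev (tensor E kQ y c2))) c)"

lemma bilinear_mult_ev:
  assumes "x \<in> carrier E" "y \<in> carrier E"
  shows "bilinear_map kQ kQ kA (\<lambda>c1 c2. hmult kA (ev (tensor E kQ x c1)) (ev (tensor E kQ y c2)))"
  by (rule bilinear_map_compose[OF kA.bilinear_hmult]; rule ev_right[OF _ linear_map_ident]; fact)

lemma mult_ev_\<gamma>:
  assumes f: "f \<in> carrier P" and g: "g \<in> carrier P" and q: "q \<in> carrier Q"
  shows "sweedler kQ (\<lambda>c1 c2. hmult kA (ev (tensor E kQ (\<gamma> f) c1)) (ev (tensor E kQ (\<gamma> g) c2))) (point q) =
    point ((f \<otimes>\<^bsub>P\<^esub> g) q)"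
  unfolding kQ.sg[OF vspace_group_algebra bilinear_mult_ev[OF \<gamma>_closed[OF f] \<gamma>_closed[OF g]] q]
  by (simp add: ev_\<gamma> f g q kA.hmult_b P_value P_ops)

lemma mult_spec_value:
  assumes m: "mult_spec m" and f: "f \<in> carrier P" and g: "g \<in> carrier P"
  shows "m (tensor E E (\<gamma> f) (\<gamma> g)) = \<gamma> (f \<otimes>\<^bsub>P\<^esub> g)"
proof (rule coalgebra_map_value[where X = "tensor_coalg E E" and m = m])
  show "ev (tensor E kQ (m (tensor E E (\<gamma> f) (\<gamma> g))) (point q)) = point ((f \<otimes>\<^bsub>P\<^esub> g) q)"
    if q: "q \<in> carrier Q" for q
    using m mult_ev_\<gamma>[OF f g q] kQ.b_closed[OF q] \<gamma>_closed f g by (simp add: mult_spec_def)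
qed (use m f g in \<open>auto simp: mult_spec_def TE grouplike_tensor[OF E E] \<gamma>\<close>)

text \<open>The product of the group algebra of the power is carried to \<open>E\<close> along
  \<open>\<alpha>\<close> and \<open>\<beta>\<close>. It is a coalgebra map because it sends tensors
  of basis elements to basis elements; the specification is trilinear and on the basis says that
  functions are multiplied pointwise.\<close>

lemma mult_spec_exists: "\<exists>m. mult_spec m"
proof -
  let ?f = "\<lambda>x y. \<alpha> (hmult kP (\<beta> x) (\<beta> y))"
  let ?m = "tensor_lift E E ?f"
  let ?r = "restrict ?m (carrier (tensor_coalg E E))"
  have bil: "bilinear_map E E E ?f"
    by (rule bilinear_map_compose[OF linear_map_comp_bilinear[OF kP.bilinear_hmult linear_\<alpha>] linear_\<beta> linear_\<beta>])
  have lin: "linear_map (tensor_space E E) E ?m"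
    by (rule linear_map_tensor_lift[OF E(1) E(1) E(1) bil])
  have val: "?m (tensor E E x y) = ?f x y" if "x \<in> carrier E" "y \<in> carrier E" for x y
    by (rule tensor_lift_tensor[OF E(1) E(1) E(1) bil that])
  have \<gamma>\<gamma>: "?f (\<gamma> f) (\<gamma> g) = \<gamma> (f \<otimes>\<^bsub>P\<^esub> g)" if "f \<in> carrier P" "g \<in> carrier P" for f g
    using that by (simp add: \<beta>_\<gamma> kP.hmult_b \<alpha>_point)
  have "coalgebra_map (tensor_coalg E E) E ?m"
  proof (rule coalgebra_map_of_grouplike)
    show "spanned_by (tensor_coalg E E) {tensor E E x y | x y. x \<in> \<gamma> ` carrier P \<and> y \<in> \<gamma> ` carrier P}"
      using spanned_by_EE by simp
  qed (use EE TE E lin in \<open>auto simp: val \<gamma>_closed \<gamma>\<gamma> \<gamma> grouplike_tensor[OF E E]\<close>)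
  then have r: "?r \<in> coalgebra_maps (tensor_coalg E E) E"
    by (intro coalgebra_maps_restrict) (simp_all add: EE TE)
  have "ev (tensor E kQ (?f x y) c) =
      sweedler kQ (\<lambda>c1 c2. hmult kA (ev (tensor E kQ x c1)) (ev (tensor E kQ y c2))) c"
    if x: "x \<in> carrier E" "y \<in> carrier E" "c \<in> carrier kQ" for x y c
  proof (rule trilinear_map_eq_on_spanning[OF E(1) E(1) vspace_group_algebra span span spanned_by_points
        _ _ _ _ _ x, where U = kA])
    show "bilinear_map E E kA (\<lambda>x y. ev (tensor E kQ (?f x y) c))" if "c \<in> carrier kQ" for c
      by (rule linear_map_comp_bilinear[OF bil ev_left[OF that linear_map_ident]])
    show "linear_map kQ kA (\<lambda>c. ev (tensor E kQ (?f x y) c))" if "x \<in> carrier E" "y \<in> carrier E" for x y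
      by (rule ev_right[OF bilinear_map_closed[OF bil that] linear_map_ident])
    show "bilinear_map E E kA (\<lambda>x y. sweedler kQ (\<lambda>c1 c2. hmult kA (ev (tensor E kQ x c1)) (ev (tensor E kQ y c2))) c)"
      if "c \<in> carrier kQ" for c
      by (intro bilinear_mapI linear_map_sweedler_fun[OF kQ.H(2) that vspace_group_algebra])
        (intro kA.hmult_left kA.hmult_right ev_left linear_map_ident linear_map_closed[OF ev] tensor_in_space;
          assumption)+
    show "linear_map kQ kA (sweedler kQ (\<lambda>c1 c2. hmult kA (ev (tensor E kQ x c1)) (ev (tensor E kQ y c2))))"
      if "x \<in> carrier E" "y \<in> carrier E" for x y
      by (rule linear_map_sweedler[OF kQ.H(1,2) vspace_group_algebra bilinear_mult_ev[OF that]])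
    show "ev (tensor E kQ (?f u v) w) =
      sweedler kQ (\<lambda>c1 c2. hmult kA (ev (tensor E kQ u c1)) (ev (tensor E kQ v c2))) w"
      if "u \<in> \<gamma> ` carrier P" "v \<in> \<gamma> ` carrier P" "w \<in> point ` carrier Q" for u v w
      using that by (auto simp: \<gamma>\<gamma> mult_ev_\<gamma> ev_\<gamma>)
  qed
  then have "mult_spec ?r"
    unfolding mult_spec_def using r by (simp add: val tensor_in_space)
  then show ?thesis by blast
qed

lemma mult_spec_exp_mult: "mult_spec (exp_mult kA kQ E ev)"
proof -
  obtain m where m: "mult_spec m" using mult_spec_exists by blast
  have "m' = m" if m': "mult_spec m'" for m'
    by (rule coalgebra_maps_eqI[of "tensor_coalg E E"])
      (use spanned_by_EE m m' in \<open>auto simp: TE mult_spec_value, auto simp: mult_spec_def\<close>)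
  then have "mult_spec (THE m. mult_spec m)" by (rule theI[where P = mult_spec, OF m])
  then show ?thesis unfolding exp_mult_def mult_spec_def[symmetric] .
qed

lemma linear_exp_mult: "linear_map (tensor_space E E) E (exp_mult kA kQ E ev)"
  using mult_spec_exp_mult by (auto simp: mult_spec_def coalgebra_maps_def coalgebra_map_def)

lemmas exp_mult_\<gamma> = mult_spec_value[OF mult_spec_exp_mult]

section \<open>Unit of the exponential\<close>

definition unit_spec where
  "unit_spec u \<longleftrightarrow> u \<in> coalgebra_maps base_coalg E \<and>
    (\<forall>c\<in>carrier kQ. ev (tensor E kQ (u 1) c) = scal kA (counit kQ c) (hone kA))"

lemma unit_spec_value:
  assumes u: "unit_spec u"
  shows "u 1 = \<gamma> \<one>\<^bsub>P\<^esub>"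
proof (rule coalgebra_map_value[where X = base_coalg and m = u])
  fix q assume q: "q \<in> carrier Q"
  show "ev (tensor E kQ (u 1) (point q)) = point (\<one>\<^bsub>P\<^esub> q)"
    using u kQ.b_closed[OF q] kQ.b[OF q]
    by (simp add: unit_spec_def P_ops q kA.hone_b grouplike_def scal_one[OF kA.H(1)])
qed (use u in \<open>auto simp: unit_spec_def base_coalg_facts\<close>)

text \<open>At the point of \<open>q\<close> the counit is 1 and the constant function has the value
  one, so both sides of the specification are \<open>hone kA\<close>; linearity in \<open>c\<close>
  gives the rest.\<close>

lemma unit_spec_exists: "\<exists>u. unit_spec u"
proof -
  let ?u = "\<lambda>c. scal E c (\<gamma> \<one>\<^bsub>P\<^esub>)"
  let ?r = "restrict ?u (carrier base_coalg)"
  have c: "carrier base_coalg = UNIV" by (simp add: base_coalg_def)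
  have "linear_map base_space E ?u"
    by (rule linear_map_scal_left[OF E(1) linear_map_ident \<gamma>_closed[OF P.one_closed]])
  then have lin: "linear_map base_coalg E ?u"
    by (simp add: linear_map_def base_coalg_def)
  have "coalgebra_map base_coalg E ?u"
    by (rule coalgebra_map_of_grouplike[OF base_coalg_facts(1-3) E base_coalg_facts(4) _ lin])
      (auto simp: base_coalg_facts scal_one[OF E(1)] \<gamma>)
  then have r: "?r \<in> coalgebra_maps base_coalg E"
    by (intro coalgebra_maps_restrict base_coalg_facts)
  have "ev (tensor E kQ (\<gamma> \<one>\<^bsub>P\<^esub>) c) = scal kA (counit kQ c) (hone kA)" if "c \<in> carrier kQ" for c
  proof (rule linear_map_eq_on_spanning[OF kQ.H(1) kQ.span ev_right[OF \<gamma>_closed[OF P.one_closed] linear_map_ident]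
        linear_map_scal_left[OF kA.H(1) kQ.H(3)] _ that])
    show "hone kA \<in> carrier kA" by (simp add: kA.hone_b kA.b_closed)
    fix w :: "'q \<Rightarrow>\<^sub>0 'k" assume "w \<in> point ` carrier Q"
    then obtain q where q: "w = point q" "q \<in> carrier Q" by blast
    then show "ev (tensor E kQ (\<gamma> \<one>\<^bsub>P\<^esub>) w) = scal kA (counit kQ w) (hone kA)"
      using kQ.b[OF q(2)] by (simp add: ev_\<gamma> P_ops kA.hone_b grouplike_def scal_one[OF kA.H(1)])
  qed
  then have "unit_spec ?r"
    unfolding unit_spec_def using r by (simp add: c scal_one[OF E(1)])
  then show ?thesis by blast
qed

lemma exp_unit_value: "exp_unit kA kQ E ev 1 = \<gamma> \<one>\<^bsub>P\<^esub>"
proof -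
  obtain u where u: "unit_spec u" using unit_spec_exists by blast
  have "u' = u" if u': "unit_spec u'" for u'
    by (rule coalgebra_maps_eqI[OF base_coalg_facts(1,4)])
      (use u u' in \<open>auto simp: unit_spec_value, auto simp: unit_spec_def\<close>)
  then have "unit_spec (THE u. unit_spec u)" by (rule theI[where P = unit_spec, OF u])
  then have "unit_spec (exp_unit kA kQ E ev)" unfolding exp_unit_def unit_spec_def[symmetric] .
  then show ?thesis by (rule unit_spec_value)
qed

section \<open>Antipode of the exponential\<close>

definition antipode_spec where
  "antipode_spec s \<longleftrightarrow> s \<in> coalgebra_maps E E \<and>
    (\<forall>x\<in>carrier E. \<forall>c\<in>carrier kQ. ev (tensor E kQ (s x) c) = antipode kA (ev (tensor E kQ x c)))"

lemma antipode_spec_value: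
  assumes s: "antipode_spec s" and f: "f \<in> carrier P"
  shows "s (\<gamma> f) = \<gamma> (inv\<^bsub>P\<^esub> f)"
proof (rule coalgebra_map_value[where m = s, OF E(1) _ \<gamma>[OF f] P.inv_closed[OF f]])
  show "ev (tensor E kQ (s (\<gamma> f)) (point q)) = point ((inv\<^bsub>P\<^esub> f) q)" if q: "q \<in> carrier Q" for q
    using s \<gamma>_closed[OF f] kQ.b_closed[OF q]
    by (simp add: antipode_spec_def ev_\<gamma>[OF f q] kA.antipode_b[OF P_value[OF f q]] P_ops f q)
qed (use s in \<open>simp add: antipode_spec_def\<close>)

lemma antipode_spec_exists: "\<exists>s. antipode_spec s"
proof -
  let ?s = "\<lambda>x. \<alpha> (antipode kP (\<beta> x))"
  have lin: "linear_map E E ?s"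
    by (rule linear_map_compose[OF linear_map_compose[OF linear_\<beta> kP.linear_antipode] linear_\<alpha>])
  have s\<gamma>: "?s (\<gamma> f) = \<gamma> (inv\<^bsub>P\<^esub> f)" if "f \<in> carrier P" for f
    using that by (simp add: \<beta>_\<gamma> kP.antipode_b \<alpha>_point)
  have "coalgebra_map E E ?s"
    by (rule coalgebra_map_of_grouplike[OF E E span _ lin]) (auto simp: \<gamma> s\<gamma>)
  then have r: "restrict ?s (carrier E) \<in> coalgebra_maps E E"
    by (intro coalgebra_maps_restrict E)
  have "ev (tensor E kQ (?s x) c) = antipode kA (ev (tensor E kQ x c))"
    if x: "x \<in> carrier E" "c \<in> carrier kQ" for x c
  proof (rule bilinear_map_eq_on_spanning[OF E(1) kQ.H(1) span kQ.span _ _ _ x, where U = kA])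
    have b: "bilinear_map E kQ kA (\<lambda>x c. ev (tensor E kQ x c))"
      by (rule linear_map_comp_bilinear[OF bilinear_map_tensor ev])
    show "bilinear_map E kQ kA (\<lambda>x c. ev (tensor E kQ (?s x) c))"
      by (rule bilinear_map_compose[OF b lin linear_map_ident])
    show "bilinear_map E kQ kA (\<lambda>x c. antipode kA (ev (tensor E kQ x c)))"
      by (rule linear_map_comp_bilinear[OF b kA.linear_antipode])
    show "ev (tensor E kQ (?s u) v) = antipode kA (ev (tensor E kQ u v))"
      if "u \<in> \<gamma> ` carrier P" "v \<in> point ` carrier Q" for u v
      using that by (auto simp: s\<gamma> ev_\<gamma> kA.antipode_b P_value P_ops)
  qed
  then have "antipode_spec (restrict ?s (carrier E))"
    unfolding antipode_spec_def using r by simp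
  then show ?thesis by blast
qed

lemma antipode_spec_exp_antipode: "antipode_spec (exp_antipode kA kQ E ev)"
proof -
  obtain s where s: "antipode_spec s" using antipode_spec_exists by blast
  have "s' = s" if s': "antipode_spec s'" for s'
    by (rule coalgebra_maps_eqI[OF E(1) span])
      (use s s' in \<open>auto simp: antipode_spec_value, auto simp: antipode_spec_def\<close>)
  then have "antipode_spec (THE s. antipode_spec s)" by (rule theI[where P = antipode_spec, OF s])
  then show ?thesis unfolding exp_antipode_def antipode_spec_def[symmetric] .
qed

lemma linear_exp_antipode: "linear_map E E (exp_antipode kA kQ E ev)"
  using antipode_spec_exp_antipode by (simp add: antipode_spec_def coalgebra_maps_def coalgebra_map_def)

lemmas exp_antipode_\<gamma> = antipode_spec_value[OF antipode_spec_exp_antipode]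

section \<open>Action on the exponential by right translation\<close>

lemmas QE = linear_map_comul_tensor_coalg[OF kQ.H E] linear_map_counit_tensor_coalg[OF kQ.H E]

lemma TQ: "is_vspace (tensor_space kQ V)"
  by (rule vspace_tensor_space[OF kQ.H(1)])

lemma spanned_by_QE:
  "spanned_by (tensor_space kQ E) {tensor kQ E q x | q x. q \<in> point ` carrier Q \<and> x \<in> \<gamma> ` carrier P}"
  by (rule spanned_by_tensor_space[OF kQ.H(1) E(1) kQ.span span])

definition action_spec where
  "action_spec a \<longleftrightarrow> a \<in> coalgebra_maps (tensor_coalg kQ E) E \<and>
    (\<forall>q\<in>carrier kQ. \<forall>x\<in>carrier E. \<forall>r\<in>carrier kQ.
      ev (tensor E kQ (a (tensor kQ E q x)) r) = ev (tensor E kQ x (hmult kQ r q)))"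

lemmas shift_P = shift_closed[OF A Q]

text \<open>Evaluated at \<open>r\<close>, the action of \<open>q\<close> becomes evaluation of
  \<open>\<gamma> f\<close> at the product of \<open>r\<close> and \<open>q\<close>, which is the
  value of \<open>shift Q q f\<close> at \<open>r\<close>.\<close>

lemma action_spec_value:
  assumes a: "action_spec a" and q: "q \<in> carrier Q" and f: "f \<in> carrier P"
  shows "a (tensor kQ E (point q) (\<gamma> f)) = \<gamma> (shift Q q f)"
proof (rule coalgebra_map_value[where X = "tensor_coalg kQ E" and m = a])
  show "ev (tensor E kQ (a (tensor kQ E (point q) (\<gamma> f))) (point r)) = point (shift Q q f r)"
    if r: "r \<in> carrier Q" for r
    using a kQ.b_closed[OF q] kQ.b_closed[OF r] \<gamma>_closed[OF f]
    by (simp add: action_spec_def kQ.hmult_b q r ev_\<gamma> f P_ops)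
qed (use a q f in \<open>auto simp: action_spec_def TQ grouplike_tensor[OF kQ.H E] \<gamma> kQ.b shift_P\<close>)

text \<open>The action is not an operation of the group algebra of the power. It is built by two
  linear extensions, of \<open>shift Q h\<close> over functions and then over the group elements
  \<open>h\<close>.\<close>

lemma action_spec_exists: "\<exists>a. action_spec a"
proof -
  let ?T = "\<lambda>h x. lin_ext E (\<lambda>f. \<gamma> (shift Q h f)) (\<beta> x)"
  let ?f = "\<lambda>q x. lin_ext E (\<lambda>h. ?T h x) q"
  let ?a = "tensor_lift kQ E ?f"
  let ?r = "restrict ?a (carrier (tensor_coalg kQ E))"
  have T: "linear_map E E (?T h)" if "h \<in> carrier Q" for h
    by (rule linear_map_compose[OF linear_\<beta> linear_map_lin_ext[OF E(1) \<gamma>_closed[OF shift_P[OF that]]]])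
  have bil: "bilinear_map kQ E E ?f"
    by (rule bilinear_lin_ext[OF E(1) T])
  have lin: "linear_map (tensor_space kQ E) E ?a"
    by (rule linear_map_tensor_lift[OF kQ.H(1) E(1) E(1) bil])
  have val: "?a (tensor kQ E q x) = ?f q x" if "q \<in> carrier kQ" "x \<in> carrier E" for q x
    by (rule tensor_lift_tensor[OF kQ.H(1) E(1) E(1) bil that])
  have q\<gamma>: "?f (point q) (\<gamma> f) = \<gamma> (shift Q q f)" if "q \<in> carrier Q" "f \<in> carrier P" for q f
    using that by (simp add: lin_ext_point[OF E(1)] \<beta>_\<gamma>)
  have "coalgebra_map (tensor_coalg kQ E) E ?a"
  proof (rule coalgebra_map_of_grouplike)
    show "spanned_by (tensor_coalg kQ E) {tensor kQ E q x | q x. q \<in> point ` carrier Q \<and> x \<in> \<gamma> ` carrier P}"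
      using spanned_by_QE by simp
    show "grouplike E (?a b)"
      if b: "b \<in> {tensor kQ E q x | q x. q \<in> point ` carrier Q \<and> x \<in> \<gamma> ` carrier P}" for b
    proof -
      from b obtain q f where "b = tensor kQ E (point q) (\<gamma> f)" "q \<in> carrier Q" "f \<in> carrier P" by blast
      then show ?thesis
        using val[OF kQ.b_closed \<gamma>_closed] by (simp only: q\<gamma> \<gamma> shift_P)
    qed
  qed (use QE TQ E lin in \<open>auto simp: \<gamma> grouplike_tensor[OF kQ.H E] kQ.b\<close>)
  then have r: "?r \<in> coalgebra_maps (tensor_coalg kQ E) E"
    by (intro coalgebra_maps_restrict) (simp_all add: QE TQ)
  have "ev (tensor E kQ (?f q x) r) = ev (tensor E kQ x (hmult kQ r q))"
    if x: "q \<in> carrier kQ" "x \<in> carrier E" "r \<in> carrier kQ" for q x r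
  proof (rule trilinear_map_eq_on_spanning[OF kQ.H(1) E(1) kQ.H(1) kQ.span span kQ.span
        _ _ _ _ _ x, where U = kA])
    show "bilinear_map kQ E kA (\<lambda>q x. ev (tensor E kQ (?f q x) r))" if "r \<in> carrier kQ" for r
      by (rule linear_map_comp_bilinear[OF bil ev_left[OF that linear_map_ident]])
    show "linear_map kQ kA (\<lambda>r. ev (tensor E kQ (?f q x) r))" if "q \<in> carrier kQ" "x \<in> carrier E" for q x
      by (rule ev_right[OF bilinear_map_closed[OF bil that] linear_map_ident])
    show "bilinear_map kQ E kA (\<lambda>q x. ev (tensor E kQ x (hmult kQ r q)))" if "r \<in> carrier kQ" for r
      using that by (intro bilinear_mapI ev_left ev_right kQ.hmult_right kQ.hmult_closed linear_map_ident)
    show "linear_map kQ kA (\<lambda>r. ev (tensor E kQ x (hmult kQ r q)))" if "q \<in> carrier kQ" "x \<in> carrier E" for q x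
      using that by (intro ev_right kQ.hmult_left linear_map_ident)
    show "ev (tensor E kQ (?f u v) w) = ev (tensor E kQ v (hmult kQ w u))"
      if "u \<in> point ` carrier Q" "v \<in> \<gamma> ` carrier P" "w \<in> point ` carrier Q" for u v w
    proof -
      from that obtain q f r where "u = point q" "v = \<gamma> f" "w = point r"
        "q \<in> carrier Q" "f \<in> carrier P" "r \<in> carrier Q" by blast
      then show ?thesis by (simp only: q\<gamma> kQ.hmult_b ev_\<gamma> shift_P P_ops Q.m_closed)
    qed
  qed
  then have "action_spec ?r"
    unfolding action_spec_def using r val by (simp add: tensor_in_space)
  then show ?thesis by blast
qed

lemma action_spec_exp_action: "action_spec (exp_action kQ E ev)"
proof -
  obtain a where a: "action_spec a" using action_spec_exists by blast
  have "a' = a" if a': "action_spec a'" for a'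
    by (rule coalgebra_maps_eqI[of "tensor_coalg kQ E"])
      (use spanned_by_QE a a' in \<open>auto simp: TQ action_spec_value, auto simp: action_spec_def\<close>)
  then have "action_spec (THE a. action_spec a)" by (rule theI[where P = action_spec, OF a])
  then show ?thesis unfolding exp_action_def action_spec_def[symmetric] .
qed

lemma linear_exp_action: "linear_map (tensor_space kQ E) E (exp_action kQ E ev)"
  using action_spec_exp_action by (auto simp: action_spec_def coalgebra_maps_def coalgebra_map_def)

lemmas exp_action_\<gamma> = action_spec_value[OF action_spec_exp_action]

end

section \<open>The Hopf wreath product on its grouplike basis\<close>

context group_exponential
begin

abbreviation (input) "W \<equiv> wreath_group A Q"
abbreviation (input) "H \<equiv> wreath_hopf kA kQ E ev"
abbreviation (input) "T \<equiv> tensor_space E kQ"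

definition mul :: "'e \<Rightarrow> 'e \<Rightarrow> 'e" where
  "mul x y = exp_mult kA kQ E ev (tensor E E x y)"

definition act :: "('q \<Rightarrow>\<^sub>0 'k) \<Rightarrow> 'e \<Rightarrow> 'e" where
  "act q x = exp_action kQ E ev (tensor kQ E q x)"

lemma bilinear_mul: "bilinear_map E E E mul"
  unfolding mul_def[abs_def] by (rule linear_map_comp_bilinear[OF bilinear_map_tensor linear_exp_mult])

lemma bilinear_act: "bilinear_map kQ E E act"
  unfolding act_def[abs_def] by (rule linear_map_comp_bilinear[OF bilinear_map_tensor linear_exp_action])

text \<open>The product of \<open>h # q\<close> and \<open>k # r\<close> in smash notation, before
  extension to arbitrary tensors.\<close>

definition smash_term where
  "smash_term h q k r = sweedler kQ (\<lambda>q1 q2. tensor E kQ (mul h (act q1 k)) (hmult kQ q2 r)) q"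

definition antipode_term where
  "antipode_term h q = sweedler kQ
    (\<lambda>q1 q2. tensor E kQ (act (antipode kQ q1) (exp_antipode kA kQ E ev h)) (antipode kQ q2)) q"

text \<open>The record \<open>exp_hopf\<close> keeps the coalgebra fields of \<open>E\<close>, so
  tensors and lifts over it are tensors and lifts over \<open>E\<close>.\<close>

lemma wreath_hopf_simps:
  "carrier H = carrier T" "scal H = scal T"
  "comul H = comul (tensor_coalg E kQ)" "counit H = counit (tensor_coalg E kQ)"
  "hmult H = (\<lambda>s t. tensor_lift E kQ (\<lambda>h q. tensor_lift E kQ (smash_term h q) t) s)"
  "hone H = tensor E kQ (\<gamma> \<one>\<^bsub>P\<^esub>) (point \<one>\<^bsub>Q\<^esub>)"
  "antipode H = tensor_lift E kQ antipode_term"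
proof -
  let ?X = "exp_hopf kA kQ E ev"
  have X: "carrier ?X = carrier E" "scal ?X = scal E" "comul ?X = comul E" "counit ?X = counit E"
    by (simp_all add: exp_hopf_def)
  note eqs = tensor_coalg_cong_left[OF X] tensor_cong[OF X(1,2) refl refl] tensor_cong[OF refl refl X(1,2)]
    tensor_lift_space_cong[OF X(1,2) refl refl]
  note H = wreath_hopf_def[of kA kQ E ev, unfolded smash_product_def Let_def eqs]
  show "carrier H = carrier T" "scal H = scal T"
    "comul H = comul (tensor_coalg E kQ)" "counit H = counit (tensor_coalg E kQ)"
    by (simp_all add: H)
  show "hmult H = (\<lambda>s t. tensor_lift E kQ (\<lambda>h q. tensor_lift E kQ (smash_term h q) t) s)"
    by (simp add: H exp_hopf_def smash_term_def[abs_def] mul_def act_def)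
  show "hone H = tensor E kQ (\<gamma> \<one>\<^bsub>P\<^esub>) (point \<one>\<^bsub>Q\<^esub>)"
    by (simp add: H exp_hopf_def exp_unit_value kQ.hone_b)
  show "antipode H = tensor_lift E kQ antipode_term"
    by (simp add: H exp_hopf_def antipode_term_def[abs_def] act_def)
qed

lemma bilinear_smash_inner:
  assumes "h \<in> carrier E" "k \<in> carrier E" "r \<in> carrier kQ"
  shows "bilinear_map kQ kQ T (\<lambda>q1 q2. tensor E kQ (mul h (act q1 k)) (hmult kQ q2 r))"
  by (rule bilinear_map_compose[OF bilinear_map_tensor])
    (use assms in \<open>auto intro: linear_map_compose[OF bilinear_map_left[OF bilinear_act] bilinear_map_right[OF bilinear_mul]]
      bilinear_map_left[OF kQ.bilinear_hmult]\<close>)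

text \<open>Bilinearity in each pair of variables, \<open>h\<close> and \<open>q\<close> here and
  \<open>k\<close> and \<open>r\<close> in \<open>bilinear_smash_right\<close>, makes the nested
  lifts of the multiplication computable on pure tensors.\<close>

lemma bilinear_smash_left:
  assumes k: "k \<in> carrier E" and r: "r \<in> carrier kQ"
  shows "bilinear_map E kQ T (\<lambda>h q. smash_term h q k r)"
  unfolding smash_term_def
proof (rule bilinear_map_sweedler_right[OF kQ.H(1,2) TE])
  show "bilinear_map kQ kQ T (\<lambda>q1 q2. tensor E kQ (mul h (act q1 k)) (hmult kQ q2 r))" if "h \<in> carrier E" for h
    by (rule bilinear_smash_inner[OF that k r])
  show "linear_map E T (\<lambda>h. tensor E kQ (mul h (act q1 k)) (hmult kQ q2 r))"
    if "q1 \<in> carrier kQ" "q2 \<in> carrier kQ" for q1 q2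
    by (rule linear_map_tensor_fun_left[OF bilinear_map_left[OF bilinear_mul
            bilinear_map_closed[OF bilinear_act that(1) k]] kQ.hmult_closed[OF that(2) r]])
qed

lemma bilinear_smash_right:
  assumes h: "h \<in> carrier E" and q: "q \<in> carrier kQ"
  shows "bilinear_map E kQ T (smash_term h q)"
proof (rule bilinear_mapI)
  show "linear_map kQ T (smash_term h q k)" if k: "k \<in> carrier E" for k
    unfolding smash_term_def
    by (rule linear_map_sweedler_fun[OF kQ.H(2) q TE])
      (rule linear_map_tensor_fun_right[OF bilinear_map_right[OF kQ.bilinear_hmult]
        bilinear_map_closed[OF bilinear_mul h bilinear_map_closed[OF bilinear_act _ k]]])
  show "linear_map E T (\<lambda>k. smash_term h q k r)" if r: "r \<in> carrier kQ" for r
    unfolding smash_term_def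
    by (rule linear_map_sweedler_fun[OF kQ.H(2) q TE])
      (rule linear_map_tensor_fun_left[OF linear_map_compose[OF bilinear_map_right[OF bilinear_act]
        bilinear_map_right[OF bilinear_mul h]] kQ.hmult_closed[OF _ r]])
qed

text \<open>For the grouplike point of \<open>q\<close> both Sweedler components are that point, and
  the formula becomes the multiplication of the wreath product of groups.\<close>

lemma smash_term_\<gamma>:
  assumes f: "f \<in> carrier P" and q: "q \<in> carrier Q" and g: "g \<in> carrier P" and r: "r \<in> carrier Q"
  shows "smash_term (\<gamma> f) (point q) (\<gamma> g) (point r) =
    tensor E kQ (\<gamma> (f \<otimes>\<^bsub>P\<^esub> shift Q q g)) (point (q \<otimes>\<^bsub>Q\<^esub> r))"
  unfolding smash_term_def
    kQ.sg[OF TE bilinear_smash_inner[OF \<gamma>_closed[OF f] \<gamma>_closed[OF g] kQ.b_closed[OF r]] q]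
  by (simp add: mul_def act_def exp_action_\<gamma> exp_mult_\<gamma> kQ.hmult_b shift_P f q g r)

lemma bilinear_antipode_inner:
  assumes "h \<in> carrier E"
  shows "bilinear_map kQ kQ T
    (\<lambda>q1 q2. tensor E kQ (act (antipode kQ q1) (exp_antipode kA kQ E ev h)) (antipode kQ q2))"
  by (rule bilinear_map_compose[OF bilinear_map_tensor linear_map_compose[OF kQ.linear_antipode
        bilinear_map_left[OF bilinear_act linear_map_closed[OF linear_exp_antipode assms]]] kQ.linear_antipode])

lemma bilinear_antipode_term: "bilinear_map E kQ T antipode_term"
  unfolding antipode_term_def
proof (rule bilinear_map_sweedler_right[OF kQ.H(1,2) TE bilinear_antipode_inner])
  show "linear_map E T
    (\<lambda>h. tensor E kQ (act (antipode kQ q1) (exp_antipode kA kQ E ev h)) (antipode kQ q2))"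
    if "q1 \<in> carrier kQ" "q2 \<in> carrier kQ" for q1 q2
    by (rule linear_map_tensor_fun_left[OF linear_map_compose[OF linear_exp_antipode
            bilinear_map_right[OF bilinear_act linear_map_closed[OF kQ.linear_antipode that(1)]]]
          linear_map_closed[OF kQ.linear_antipode that(2)]])
qed

text \<open>The smash antipode becomes the inverse in the wreath product of groups, the pair found
  in \<open>wreath_left_inverse\<close>.\<close>

lemma antipode_term_\<gamma>:
  assumes f: "f \<in> carrier P" and q: "q \<in> carrier Q"
  shows "antipode_term (\<gamma> f) (point q) =
    tensor E kQ (\<gamma> (shift Q (inv\<^bsub>Q\<^esub> q) (inv\<^bsub>P\<^esub> f))) (point (inv\<^bsub>Q\<^esub> q))"
  unfolding antipode_term_def kQ.sg[OF TE bilinear_antipode_inner[OF \<gamma>_closed[OF f]] q]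
  by (simp add: act_def exp_antipode_\<gamma> kQ.antipode_b exp_action_\<gamma> f q)

definition basis :: "('q \<Rightarrow> 'a) \<times> 'q \<Rightarrow> ('k, 'e, 'q \<Rightarrow>\<^sub>0 'k) tensor" where
  "basis = (\<lambda>(f, q). tensor E kQ (\<gamma> f) (point q))"

lemma W_carrier: "carrier W = carrier P \<times> carrier Q"
  by (simp add: wreath_group_simps carrier_product_group)

lemma T: "is_vspace T" "linear_map T (tensor_space T T) (comul (tensor_coalg E kQ))"
  "linear_map T base_space (counit (tensor_coalg E kQ))"
  by (rule TE linear_map_comul_tensor_coalg[OF E kQ.H] linear_map_counit_tensor_coalg[OF E kQ.H])+

lemma grouplike_group_wreath: "grouplike_group W H basis"
proof (intro grouplike_group.intro grouplike_group_axioms.intro)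
  note s = wreath_hopf_simps(1,2)
  show "group W" by (rule group_wreath_group[OF A Q])
  show "is_vspace H" unfolding vspace_cong[OF s] by (rule T)
  show "linear_map H (tensor_space H H) (comul H)"
    unfolding linear_map_cong[OF s refl refl] tensor_space_cong[OF s s] wreath_hopf_simps by (rule T)
  show "linear_map H base_space (counit H)"
    unfolding linear_map_cong[OF s refl refl] wreath_hopf_simps by (rule T)
  show "grouplike H (basis w)" if "w \<in> carrier W" for w
  proof -
    obtain f q where w: "w = (f, q)" "f \<in> carrier P" "q \<in> carrier Q" using \<open>w \<in> carrier W\<close> unfolding W_carrier by blast
    then have "grouplike (tensor_coalg E kQ) (basis w)"
      using grouplike_tensor[OF E kQ.H \<gamma> kQ.b] by (simp add: basis_def)
    then show ?thesis
      by (simp add: grouplike_def wreath_hopf_simps tensor_cong[OF s s])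
  qed
  have "{tensor E kQ x y |x y. x \<in> \<gamma> ` carrier P \<and> y \<in> point ` carrier Q} = basis ` carrier W"
    by (force simp: basis_def W_carrier)
  then show "spanned_by H (basis ` carrier W)"
    using spanned_by_tensor_space[OF E(1) kQ.H(1) span kQ.span] unfolding spanned_by_cong[OF s] by simp
  have lift: "linear_map T T (tensor_lift E kQ f)" if "bilinear_map E kQ T f" for f
    by (rule linear_map_tensor_lift[OF E(1) kQ.H(1) TE that])
  have left: "bilinear_map E kQ T (\<lambda>h q. tensor_lift E kQ (smash_term h q) t)" if t: "t \<in> carrier T" for t
    by (intro bilinear_mapI linear_map_tensor_lift_fun[OF TE t];
        (erule (2) bilinear_map_left[OF bilinear_smash_left] bilinear_map_right[OF bilinear_smash_left])?)
  show "bilinear_map H H H (hmult H)"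
    unfolding bilinear_map_cong[OF s s s] wreath_hopf_simps
  proof (rule bilinear_mapI)
    show "linear_map T T (\<lambda>t. tensor_lift E kQ (\<lambda>h q. tensor_lift E kQ (smash_term h q) t) u)"
      if "u \<in> carrier T" for u
      by (rule linear_map_tensor_lift_fun[OF TE that lift[OF bilinear_smash_right]])
    show "linear_map T T (\<lambda>u. tensor_lift E kQ (\<lambda>h q. tensor_lift E kQ (smash_term h q) t) u)"
      if "t \<in> carrier T" for t
      by (rule lift[OF left[OF that]])
  qed
  show "hmult H (basis v) (basis w) = basis (v \<otimes>\<^bsub>W\<^esub> w)" if "v \<in> carrier W" "w \<in> carrier W" for v w
  proof -
    obtain f q g r where vw: "v = (f, q)" "w = (g, r)" and c: "f \<in> carrier P" "q \<in> carrier Q"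
      "g \<in> carrier P" "r \<in> carrier Q"
      using \<open>v \<in> carrier W\<close> \<open>w \<in> carrier W\<close> unfolding W_carrier by blast
    have "basis w \<in> carrier T"
      unfolding vw basis_def prod.case by (rule tensor_in_space[OF \<gamma>_closed[OF c(3)] kQ.b_closed[OF c(4)]])
    from tensor_lift_tensor[OF E(1) kQ.H(1) TE left[OF this] \<gamma>_closed[OF c(1)] kQ.b_closed[OF c(2)]]
    have "hmult H (basis v) (basis w) = tensor_lift E kQ (smash_term (\<gamma> f) (point q)) (basis w)"
      by (simp add: wreath_hopf_simps vw basis_def)
    also have "\<dots> = smash_term (\<gamma> f) (point q) (\<gamma> g) (point r)"
      unfolding vw basis_def prod.case
      by (rule tensor_lift_tensor[OF E(1) kQ.H(1) TE bilinear_smash_right]) (use c \<gamma>_closed kQ.b_closed in auto)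
    finally show ?thesis by (simp add: smash_term_\<gamma>[OF c] vw basis_def wreath_group_simps)
  qed
  show "hone H = basis \<one>\<^bsub>W\<^esub>" by (simp add: wreath_hopf_simps basis_def wreath_group_simps)
  show "linear_map H H (antipode H)"
    unfolding linear_map_cong[OF s s] wreath_hopf_simps by (rule lift[OF bilinear_antipode_term])
  show "antipode H (basis w) = basis (inv\<^bsub>W\<^esub> w)" if "w \<in> carrier W" for w
  proof -
    obtain f q where w: "w = (f, q)" and c: "f \<in> carrier P" "q \<in> carrier Q"
      using \<open>w \<in> carrier W\<close> unfolding W_carrier by blast
    have "antipode H (basis w) = antipode_term (\<gamma> f) (point q)"
      unfolding w basis_def prod.case wreath_hopf_simps
      by (rule tensor_lift_tensor[OF E(1) kQ.H(1) TE bilinear_antipode_term \<gamma>_closed[OF c(1)] kQ.b_closed[OF c(2)]])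
    then show ?thesis
      by (simp add: antipode_term_\<gamma>[OF c] w inv_wreath_group[OF A Q c] basis_def)
  qed
qed

text \<open>Only a linear map with the right values on the basis is missing. It applies
  \<open>\<beta>\<close> to the first tensor factor, extends linearly over \<open>Q\<close> in the
  second, and relabels the point of \<open>f\<close> in slot \<open>q\<close> by the pair of
  both.\<close>

lemma hopf_isomorphic_wreath: "hopf_isomorphic H (group_algebra W)"
proof -
  interpret H: grouplike_group W H basis by (rule grouplike_group_wreath)
  let ?K = "group_algebra W :: ('k, ('q \<Rightarrow> 'a) \<times> 'q \<Rightarrow>\<^sub>0 'k) hopf"
  let ?g = "\<lambda>q. lin_ext ?K (\<lambda>f. point (f, q))"
  let ?f = "\<lambda>x y. lin_ext ?K (\<lambda>q. ?g q (\<beta> x)) y"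
  have g: "linear_map E ?K (\<lambda>x. ?g q (\<beta> x))" if "q \<in> carrier Q" for q
    by (rule linear_map_compose[OF linear_\<beta> linear_map_lin_ext[OF vspace_group_algebra point_in_group_algebra]])
      (simp add: W_carrier that)
  have bil: "bilinear_map E kQ ?K ?f"
    by (rule bilinear_map_flip[OF bilinear_lin_ext[OF vspace_group_algebra g]])
  note s = wreath_hopf_simps(1,2)
  show ?thesis
  proof (rule H.hopf_isomorphic_group_algebra)
    show "linear_map H ?K (tensor_lift E kQ ?f)"
      unfolding linear_map_cong[OF s refl refl]
      by (rule linear_map_tensor_lift[OF E(1) kQ.H(1) vspace_group_algebra bil])
    fix w assume "w \<in> carrier W"
    then obtain f q where w: "w = (f, q)" and c: "f \<in> carrier P" "q \<in> carrier Q"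
      unfolding W_carrier by blast
    show "tensor_lift E kQ ?f (basis w) = point w"
      unfolding w basis_def prod.case
        tensor_lift_tensor[OF E(1) kQ.H(1) vspace_group_algebra bil \<gamma>_closed[OF c(1)] kQ.b_closed[OF c(2)]]
      by (simp add: lin_ext_point[OF vspace_group_algebra] \<beta>_\<gamma> c)
  qed
qed

end

section \<open>Uniqueness of the exponential and the isomorphism\<close>

text \<open>Uniqueness of a universal object. The map \<open>\<alpha>\<close> out of the concrete
  exponential comes from the property of \<open>E\<close> at the type of that group algebra
  (\<open>e2\<close>); that \<open>\<alpha>\<close> after \<open>\<beta>\<close> is the identity
  comes from the property of \<open>E\<close> at its own type (\<open>e1\<close>). The points,
  carried over by \<open>\<alpha>\<close>, are the basis.\<close>

lemma group_exponential_of_is_exponential: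
  fixes A :: "('a, 'm) monoid_scheme" and Q :: "('q, 'n) monoid_scheme"
    and E :: "('k::field, 'e::ab_group_add) coalg"
  assumes A: "group A" and Q: "group Q"
    and e1: "is_exponential TYPE('e) (group_algebra Q) (group_algebra A) E ev"
    and e2: "is_exponential TYPE(('q \<Rightarrow> 'a) \<Rightarrow>\<^sub>0 'k) (group_algebra Q) (group_algebra A) E ev"
  shows "\<exists>\<gamma> \<beta>. group_exponential A Q E ev \<gamma> \<beta>"
proof -
  let ?P = "power_group Q A"
  let ?kP = "group_algebra ?P :: ('k, ('q \<Rightarrow> 'a) \<Rightarrow>\<^sub>0 'k) hopf"
  let ?kA = "group_algebra A :: ('k, 'a \<Rightarrow>\<^sub>0 'k) hopf"
  let ?kQ = "group_algebra Q :: ('k, 'q \<Rightarrow>\<^sub>0 'k) hopf"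
  let ?E0 = "coalg.truncate ?kP"
  let ?ev0 = "group_exp_eval A Q :: ('k, ('q \<Rightarrow> 'a) \<Rightarrow>\<^sub>0 'k, 'q \<Rightarrow>\<^sub>0 'k) tensor \<Rightarrow> ('a \<Rightarrow>\<^sub>0 'k)"
  note same = truncate_coalg_simps[of ?kP]
  note u1 = is_exponential_group_algebra[where 'r = 'e and 'k = 'k, of Q A]
  note u2 = is_exponential_group_algebra[where 'r = "('q \<Rightarrow> 'a) \<Rightarrow>\<^sub>0 'k" and 'k = 'k, of Q A]
  have Qf: "is_vspace ?kQ" "linear_map ?kQ (tensor_space ?kQ ?kQ) (comul ?kQ)"
    "linear_map ?kQ base_space (counit ?kQ)"
    by (rule group_algebra_coalgD)+
  have cE: "cocommutative_coalgebra E" and evc: "coalgebra_map (tensor_coalg E ?kQ) ?kA ev"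
    using e1 by (simp_all add: is_exponential_def)
  then have coE: "coalgebra E" by (simp add: cocommutative_coalgebra_def)
  note E = coalgebraD[OF coE]
  have c0: "cocommutative_coalgebra ?E0"
    unfolding cocommutative_coalgebra_cong[OF same] by (rule cocommutative_group_algebra)
  then have "coalgebra ?E0" by (simp add: cocommutative_coalgebra_def)
  note E0 = coalgebraD[OF this]
  have ev0c: "coalgebra_map (tensor_coalg ?E0 ?kQ) ?kA ?ev0"
    unfolding tensor_coalg_cong_left[OF same] by (rule coalgebra_map_group_exp_eval)
  obtain \<alpha> where \<alpha>: "coalgebra_map ?E0 E \<alpha>"
    "\<And>r c. r \<in> carrier ?E0 \<Longrightarrow> c \<in> carrier ?kQ \<Longrightarrow> ev (tensor E ?kQ (\<alpha> r) c) = ?ev0 (tensor ?E0 ?kQ r c)"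
    by (rule exponential_exists[OF e2 Qf(1) c0 ev0c Qf(2,3)]) (erule that, assumption)
  obtain \<beta> where \<beta>: "coalgebra_map E ?E0 \<beta>"
    "\<And>r c. r \<in> carrier E \<Longrightarrow> c \<in> carrier ?kQ \<Longrightarrow> ?ev0 (tensor ?E0 ?kQ (\<beta> r) c) = ev (tensor E ?kQ r c)"
    by (rule exponential_exists[OF u1 Qf(1) cE evc Qf(2,3)]) (erule that, assumption)
  note closed = linear_map_closed[OF coalgebra_mapD(1)[OF \<alpha>(1)]] linear_map_closed[OF coalgebra_mapD(1)[OF \<beta>(1)]]
  have id: "coalgebra_map C C (\<lambda>x. x)" if "coalgebra C" for C :: "('k, 'v::ab_group_add) coalg"
  proof -
    \<comment> \<open>Lifting the pure tensor map gives the identity of the tensor space, which is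
      the comultiplication equation of the identity map.\<close>
    have "tensor_lift C C (tensor C C) t = t" if "t \<in> carrier (tensor_space C C)" for t
      using tensor_terms(2)[OF that] by (simp add: tensor_lift_terms)
    then show ?thesis
      using linear_map_closed[OF coalgebraD(2)[OF that]]
      by (simp add: coalgebra_map_def linear_map_ident sweedler_def)
  qed
  \<comment> \<open>The transposes of \<open>\<alpha>\<close> and \<open>\<beta>\<close> are the two
    evaluations, so each composite has the same transpose as the identity.\<close>
  have \<beta>\<alpha>: "\<beta> (\<alpha> x) = x" if "x \<in> carrier ?E0" for x
    by (rule exponential_unique[OF u2 Qf(1) c0 coalgebra_map_compose[OF E0(2) E(1) E0(1) \<alpha>(1) \<beta>(1)]
          id[OF \<open>coalgebra ?E0\<close>] _ that])
      (simp only: \<alpha>(2) \<beta>(2) closed)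
  have \<alpha>\<beta>: "\<alpha> (\<beta> x) = x" if "x \<in> carrier E" for x
    by (rule exponential_unique[OF e1 Qf(1) cE coalgebra_map_compose[OF E(2) E0(1) E(1) \<beta>(1) \<alpha>(1)]
          id[OF coE] _ that])
      (simp only: \<alpha>(2) \<beta>(2) closed)
  have lin\<alpha>: "linear_map ?kP E \<alpha>"
    using coalgebra_mapD(1)[OF \<alpha>(1)] unfolding linear_map_cong[OF same(1,2) refl refl] .
  have p: "point f \<in> carrier ?kP" if "f \<in> carrier ?P" for f
    by (rule point_in_group_algebra[OF that])
  have "group_exponential A Q E ev (\<lambda>f. \<alpha> (point f)) \<beta>"
  proof (rule group_exponential.intro[OF A Q coE])
    show "grouplike E (\<alpha> (point f))" if "f \<in> carrier ?P" for f
      by (rule grouplike_coalgebra_map[OF vspace_group_algebra E(1) _ grouplike_point[OF that]])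
        (use \<alpha>(1) coalgebra_map_dom_cong[OF same] in blast)
    then have "\<alpha> (point f) \<in> carrier E" if "f \<in> carrier ?P" for f
      using that by (simp add: grouplike_def)
    moreover have "x \<in> lspan E ((\<lambda>f. \<alpha> (point f)) ` carrier ?P)" if x: "x \<in> carrier E" for x
    proof -
      have "\<beta> x \<in> carrier ?kP" using closed(2)[OF x] unfolding same .
      then have "\<beta> x \<in> lspan ?kP (point ` carrier ?P)"
        using conjunct2[OF spanned_by_points[unfolded spanned_by_def]] by (rule rev_subsetD)
      then have "\<alpha> (\<beta> x) \<in> lspan E ((\<lambda>f. \<alpha> (point f)) ` carrier ?P)"
      proof (rule linear_map_lspan[OF vspace_group_algebra E(1) lin\<alpha>, rotated])
        show "point ` carrier ?P \<subseteq> carrier ?kP" using p by blast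
        fix b :: "('q \<Rightarrow> 'a) \<Rightarrow>\<^sub>0 'k" assume "b \<in> point ` carrier ?P"
        then have "\<alpha> b \<in> (\<lambda>f. \<alpha> (point f)) ` carrier ?P" by blast
        from lspan.step[OF this lspan.zero, of E 1]
        show "\<alpha> b \<in> lspan E ((\<lambda>f. \<alpha> (point f)) ` carrier ?P)" by (simp add: scal_one[OF E(1)])
      qed
      then show ?thesis by (simp add: \<alpha>\<beta>[OF x])
    qed
    ultimately show "spanned_by E ((\<lambda>f. \<alpha> (point f)) ` carrier ?P)"
      unfolding spanned_by_def by blast
    show "coalgebra_map E ?kP \<beta>" using \<beta>(1) coalgebra_map_cod_cong[OF same] by blast
    show "\<beta> (\<alpha> (point f)) = point f" if "f \<in> carrier ?P" for f
      by (rule \<beta>\<alpha>) (use p[OF that] same in simp)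
    show "linear_map (tensor_space E ?kQ) ?kA ev" using coalgebra_mapD(1)[OF evc] by simp
    show "ev (tensor E ?kQ (\<alpha> (point f)) (point q)) = point (f q)"
      if f: "f \<in> carrier ?P" and q: "q \<in> carrier Q" for f q
    proof -
      have "ev (tensor E ?kQ (\<alpha> (point f)) (point q)) = ?ev0 (tensor ?kP ?kQ (point f) (point q))"
        using \<alpha>(2)[of "point f" "point q"] p[OF f] point_in_group_algebra[OF q]
        unfolding same tensor_cong[OF same(1,2) refl refl] by blast
      then show ?thesis
        by (simp only: group_exp_eval_tensor_point[OF p[OF f] q] point_eval_point)
    qed
  qed
  then show ?thesis by blast
qed

text \<open>The first conjunct guards the second against vacuity; its witness is the truncated group
  algebra of the power with \<open>group_exp_eval\<close>, the same for every \<open>'r\<close>. The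
  second treats every exponential, on any type of vectors.\<close>

theorem theorem2:
  fixes \<AA> :: "('a, 'm) monoid_scheme" and \<QQ> :: "('q, 'n) monoid_scheme"
  assumes "group \<AA>" and "group \<QQ>"
  shows
    "let A = (group_algebra \<AA> :: ('k::field, 'a \<Rightarrow>\<^sub>0 'k) hopf);
         Q = (group_algebra \<QQ> :: ('k, 'q \<Rightarrow>\<^sub>0 'k) hopf) in
     (\<exists>(E :: ('k, ('q \<Rightarrow> 'a) \<Rightarrow>\<^sub>0 'k) coalg) ev. is_exponential TYPE('r::ab_group_add) Q A E ev) \<and>
     (\<forall>(E :: ('k, 'e::ab_group_add) coalg) ev.
        is_exponential TYPE('e) Q A E ev \<and> is_exponential TYPE(('q \<Rightarrow> 'a) \<Rightarrow>\<^sub>0 'k) Q A E ev \<longrightarrow>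
        hopf_isomorphic (wreath_hopf A Q E ev) (group_algebra (wreath_group \<AA> \<QQ>)))"
  unfolding Let_def
proof (intro conjI allI impI)
  show "\<exists>(E :: ('k, ('q \<Rightarrow> 'a) \<Rightarrow>\<^sub>0 'k) coalg) ev.
      is_exponential TYPE('r) (group_algebra \<QQ>) (group_algebra \<AA>) E ev"
    using is_exponential_group_algebra by blast
next
  fix E :: "('k, 'e) coalg" and ev
  assume "is_exponential TYPE('e) (group_algebra \<QQ>) (group_algebra \<AA>) E ev \<and>
    is_exponential TYPE(('q \<Rightarrow> 'a) \<Rightarrow>\<^sub>0 'k) (group_algebra \<QQ>) (group_algebra \<AA>) E ev"
  then obtain \<gamma> \<beta> where "group_exponential \<AA> \<QQ> E ev \<gamma> \<beta>"
    using group_exponential_of_is_exponential[OF assms] by blast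
  then interpret group_exponential \<AA> \<QQ> E ev \<gamma> \<beta> .
  show "hopf_isomorphic (wreath_hopf (group_algebra \<AA>) (group_algebra \<QQ>) E ev)
      (group_algebra (wreath_group \<AA> \<QQ>))"
    by (rule hopf_isomorphic_wreath)
qed

end
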